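(* Let $k\ge1$, $M_1,\dots,M_k\in\mathbb N_*$, and $\gamma_j^F:\mathcal M|_j\to(0,\infty)$, $j=1,\dots,k$. Let $X_k^F$ be the process on $\mathcal M|_k$ constructed from these parameters by the marks construction described in the context. Let $Z_k^F$ be the trap model on the $k$-level tree with waiting time parameter $\gamma_k^F$ and activation parameters $(p_j^F)_{j=1}^{k-1}$, that is, the continuous time Markov chain on $\mathcal M|_k$ with the coin tossing dynamics described in the context. Suppose $$p_j^F(x|_j)=\frac1{1+M_{j+1}\gamma_j^F(x|_j)}$$ for all $x|_j\in\mathcal M|_j$ and $j=1,\dots,k-1$. Then $X_k^F$ and $Z_k^F$ have the same distribution.
   Context: Notation: $\mathbb N_*=\{1,2,\dots\}$, $\mathbb R^+=[0,\infty)$, $\mathcal M_j=\{1,\dots,M_j\}$, $\mathcal M|_j=\mathcal M_1\times\cdots\times\mathcal M_j$, $x|_j=(x_1,\dots,x_j)$. The set $\mathcal M|_k$ is viewed as the set of leaves of the rooted tree whose $j$-th generation is $\mathcal M|_j$, the ancestor of $x\in\mathcal M|_k$ in generation $j$ being $x|_j$. The chain $Z_k^F$ with waiting time parameter $\gamma_k^F:\mathcal M|_k\to(0,\infty)$ and activation parameters $p_j^F:\mathcal M|_j\to(0,1)$, $j=1,\dots,k-1$ (and $p_0^F\equiv0$): it is a continuous time Markov chain on $\mathcal M|_k$ which, when at $x\in\mathcal M|_k$, waits an exponential time of mean $\gamma_k^F(x)$, and then samples (independently of the past) $g\in\{0,\dots,k-1\}$ with $P(g=i)=[1-p_i^F(x|_i)]\prod_{j=i+1}^{k-1}p_j^F(x|_j)$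 (empty product $=1$); if $g=i$, the coordinates $x|_i$ are left unchanged and the remaining coordinates $(x_{i+1},\dots,x_k)$ are replaced by a uniformly random element of $\mathcal M_{i+1}\times\cdots\times\mathcal M_k$ (so the "jump" may leave the state unchanged). The process $X_k^F$. For each level $l=1,\dots,k$ take independent rate-1 Poisson processes $N^{(x_l,l)}$, $x_l\in\mathbb N_*$, on $\mathbb R^+$, with $i$-th mark $\sigma_i^{(x_l,l)}$, and i.i.d. mean-1 exponential variables $T_s^{(l)}$, $s\in\mathbb R^+$; all independent of each other and across levels. Let $\mathcal S_l^F=\{\sigma_i^{(x_l,l)}:x_l\in\mathcal M_l,\ i\ge1\}$. Level 1: for $s=\sigma_i^{(x_1,1)}\in\mathcal S_1^F$ let $\xi_1^F(s)=x_1$; let $\mu_1^F$ be the purely atomic measure with $\mu_1^F(\{s\})=\gamma_1^F(\xi_1^F(s))T_s^{(1)}$, $s\in\mathcal S_1^F$, and no mass elsewhere; $\Gamma_1^F(r)=\mu_1^F([0,r])$, $\varphi_1^F(t)=\inf\{r\ge0:\Gamma_1^F(r)>t\}$, $(X_1^F,Y_1^F)(t)=(\xi_1^F(\varphi_1^F(t)),\varphi_1^F(t))$. Level $l$, $2\le l\le k$, given $(X_{l-1}^F,Y_{l-1}^F)$: the constancy intervals of $(X_{l-1}^F,Y_{l-1}^F)$ are the maximal intervals $[a,b)$ on which this process is constant; $\mathcal R_l^F$ is the set of their left endpoints $a$. To each $s\in\mathcal R_l^F$ attach an independent uniform variable $U_l(s)$ on $\mathcal M_l$ (independent of everything else). Let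 $\xi_l^F(s)=x_l$ if $s=\sigma_i^{(x_l,l)}\in\mathcal S_l^F$ and $\xi_l^F(s)=U_l(s)$ if $s\in\mathcal R_l^F$; let $\mu_l^F$ be purely atomic with $\mu_l^F(\{s\})=\gamma_l^F(X_{l-1}^F(s),\xi_l^F(s))T_s^{(l)}$ for $s\in\mathcal S_l^F\cup\mathcal R_l^F$ and no mass elsewhere; $\Gamma_l^F(r)=\mu_l^F([0,r])$, $\varphi_l^F(t)=\inf\{r\ge0:\Gamma_l^F(r)>t\}$, $X_l^F(t)=(X_{l-1}^F(\varphi_l^F(t)),\xi_l^F(\varphi_l^F(t)))$, $Y_l^F(t)=(Y_{l-1}^F(\varphi_l^F(t)),\varphi_l^F(t))$.
   Formalization: The chain Z_k is taken to start from the uniform distribution on the leaves (the law of X_k(0)), and the variables T_s and U_l(s) are read as i.i.d. sequences attached to the atoms, respectively to the left endpoints of constancy intervals, in increasing order. *)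

theory Defs
  imports "HOL-Probability.Probability"
begin

section \<open>The tree\<close>

text \<open>
  Level sizes are \<open>M 1, M 2, \<dots>\<close>.  A point \<open>(x\<^sub>i\<^sub>+\<^sub>1, \<dots>, x\<^sub>j)\<close> of the product of the levels
  \<open>i + 1, \<dots>, j\<close> is a list of length \<open>j - i\<close>; the ancestor of \<open>x\<close> in generation \<open>j\<close> is \<open>take j x\<close>.
\<close>

definition labels :: "(nat \<Rightarrow> nat) \<Rightarrow> nat \<Rightarrow> nat \<Rightarrow> nat list set" where
  "labels M i j = {x. length x = j - i \<and> (\<forall>m < j - i. x ! m \<in> {1..M (Suc (i + m))})}"

definition tree :: "(nat \<Rightarrow> nat) \<Rightarrow> nat \<Rightarrow> nat list set" where
  "tree M j = labels M 0 j"

text \<open>Laws of processes on \<open>[0, \<infinity>)\<close> live on the product \<open>\<sigma>\<close>-algebra.\<close>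

definition path_space :: "(real \<Rightarrow> nat list) measure" where
  "path_space = (\<Pi>\<^sub>M t\<in>{0..}. count_space UNIV)"

section \<open>The trap model\<close>

definition activation :: "(nat \<Rightarrow> nat list \<Rightarrow> real) \<Rightarrow> nat \<Rightarrow> nat list \<Rightarrow> real" where
  "activation p j x = (if j = 0 then 0 else p j (take j x))"

definition coin_prob :: "(nat \<Rightarrow> nat list \<Rightarrow> real) \<Rightarrow> nat \<Rightarrow> nat list \<Rightarrow> nat \<Rightarrow> real" where
  "coin_prob p k x i = (1 - activation p i x) * (\<Prod>j\<in>{i<..<k}. activation p j x)"

definition coin_pmf :: "(nat \<Rightarrow> nat list \<Rightarrow> real) \<Rightarrow> nat \<Rightarrow> nat list \<Rightarrow> nat pmf" where
  "coin_pmf p k x = embed_pmf (\<lambda>i. if i < k then coin_prob p k x i else 0)"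

lemma sum_coin_prob:
  assumes "1 \<le> k"
  shows "(\<Sum>i<k. coin_prob p k x i) = 1"
proof -
  have *: "(\<Sum>i<n. coin_prob p n x i) = 1 - (\<Prod>j<n. activation p j x)" for n
  proof (induction n)
    case (Suc n)
    have ivl: "{i<..<Suc n} = insert n {i<..<n}" if "i < n" for i
      using that by auto
    have "coin_prob p (Suc n) x i = activation p n x * coin_prob p n x i" if "i < n" for i
      using that by (simp add: coin_prob_def ivl)
    then have "(\<Sum>i<n. coin_prob p (Suc n) x i) = activation p n x * (\<Sum>i<n. coin_prob p n x i)"
      by (simp add: sum_distrib_left)
    moreover have "coin_prob p (Suc n) x n = 1 - activation p n x"
    proof -
      have "{n<..<Suc n} = {}" by auto
      then show ?thesis by (simp add: coin_prob_def)
    qed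
    ultimately show ?case
      using Suc by (simp add: algebra_simps)
  qed simp
  have "(\<Prod>j<k. activation p j x) = 0"
    using assms by (intro prod_zero) (auto simp: activation_def intro!: bexI[of _ 0])
  then show ?thesis
    by (simp add: *)
qed

lemma pmf_coin_pmf:
  assumes "1 \<le> k" "\<And>j. j \<in> {1..<k} \<Longrightarrow> p j (take j x) \<in> {0<..<1}"
  shows "pmf (coin_pmf p k x) i = (if i < k then coin_prob p k x i else 0)"
  unfolding coin_pmf_def
proof (rule pmf_embed_pmf)
  have act: "0 \<le> activation p j x \<and> activation p j x \<le> 1" if "j < k" for j
    using assms(2)[of j] that by (auto simp: activation_def)
  show nonneg: "0 \<le> (if i < k then coin_prob p k x i else 0)" for i
    using act by (auto simp: coin_prob_def intro!: mult_nonneg_nonneg prod_nonneg)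
  have "(\<integral>\<^sup>+ i. ennreal (if i < k then coin_prob p k x i else 0) \<partial>count_space UNIV)
      = (\<Sum>i<k. ennreal (if i < k then coin_prob p k x i else 0))"
    by (intro nn_integral_count_space') (auto split: if_splits)
  also have "\<dots> = ennreal (\<Sum>i<k. coin_prob p k x i)"
    by (subst sum_ennreal[OF nonneg]) simp
  finally show "(\<integral>\<^sup>+ i. ennreal (if i < k then coin_prob p k x i else 0) \<partial>count_space UNIV) = 1"
    using assms(1) by (simp add: sum_coin_prob)
qed

definition jump_pmf ::
    "(nat \<Rightarrow> nat) \<Rightarrow> (nat \<Rightarrow> nat list \<Rightarrow> real) \<Rightarrow> nat \<Rightarrow> nat list \<Rightarrow> nat list pmf" where
  "jump_pmf M p k x =
     bind_pmf (coin_pmf p k x) (\<lambda>i. map_pmf (\<lambda>z. take i x @ z) (pmf_of_set (labels M i k)))"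

definition jump_path :: "(nat \<Rightarrow> nat list) \<Rightarrow> (nat \<Rightarrow> real) \<Rightarrow> real \<Rightarrow> nat list" where
  "jump_path J H t = J (LEAST n. t < (\<Sum>m\<le>n. H m))"

text \<open>
  \<open>J n\<close> is the state after the \<open>n\<close>-th transition and \<open>H n\<close> the time spent there.  A transition need
  not change the state, so \<open>J\<close> may contain repetitions.  The chain is started from the uniform
  distribution on the leaves, which is the distribution of the process constructed from the marks
  at time \<open>0\<close>.
\<close>

definition trap_model ::
    "'b measure \<Rightarrow> nat \<Rightarrow> (nat \<Rightarrow> nat) \<Rightarrow> (nat list \<Rightarrow> real) \<Rightarrow> (nat \<Rightarrow> nat list \<Rightarrow> real)
      \<Rightarrow> (real \<Rightarrow> 'b \<Rightarrow> nat list) \<Rightarrow> bool" where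
  "trap_model Q k M g p Z \<longleftrightarrow>
     prob_space Q \<and>
     (\<forall>t\<ge>0. Z t \<in> Q \<rightarrow>\<^sub>M count_space UNIV) \<and>
     (\<exists>J H.
        (\<forall>n. J n \<in> Q \<rightarrow>\<^sub>M count_space UNIV) \<and>
        (\<forall>n. H n \<in> borel_measurable Q) \<and>
        (\<forall>n x s. (\<forall>m\<le>n. x m \<in> tree M k \<and> 0 \<le> s m) \<longrightarrow>
           measure Q {\<omega> \<in> space Q. \<forall>m\<le>n. J m \<omega> = x m \<and> s m < H m \<omega>} =
             pmf (pmf_of_set (tree M k)) (x 0) *
             (\<Prod>m<n. pmf (jump_pmf M p k (x m)) (x (Suc m))) *
             (\<Prod>m\<le>n. exp (- s m / g (x m)))) \<and>
        (AE \<omega> in Q. \<forall>t\<ge>0. Z t \<omega> = jump_path (\<lambda>n. J n \<omega>) (\<lambda>n. H n \<omega>) t))"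

section \<open>The marks construction\<close>

text \<open>
  \<open>\<sigma> l x i\<close> is the \<open>i\<close>-th mark, \<open>i \<ge> 1\<close>, of the Poisson process with label \<open>x\<close> on level \<open>l\<close>.

  An i.i.d. family indexed by all times \<open>s \<ge> 0\<close> does not determine the joint law of its values at
  random times, so the marks \<open>T\<^sub>s\<close> and \<open>U(s)\<close> are attached by enumeration: \<open>T l n\<close> belongs to the
  atom on level \<open>l\<close> with exactly \<open>n\<close> atoms before it, and \<open>U l n\<close> to the left endpoint of a constancy
  interval with exactly \<open>n\<close> left endpoints before it.
\<close>

definition rank :: "real set \<Rightarrow> real \<Rightarrow> nat" where
  "rank A s = card {a \<in> A. a < s}"

definition mark_set :: "(nat \<Rightarrow> nat) \<Rightarrow> (nat \<Rightarrow> nat \<Rightarrow> nat \<Rightarrow> real) \<Rightarrow> nat \<Rightarrow> real set" where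
  "mark_set M \<sigma> l = {\<sigma> l x i | x i. x \<in> {1..M l} \<and> 1 \<le> i}"

definition constancy_interval :: "(real \<Rightarrow> 'a) \<Rightarrow> real \<Rightarrow> real \<Rightarrow> bool" where
  "constancy_interval f a b \<longleftrightarrow>
     0 \<le> a \<and> a < b \<and> f constant_on {a..<b} \<and>
     (\<forall>a' b'. 0 \<le> a' \<and> a' \<le> a \<and> b \<le> b' \<and> f constant_on {a'..<b'} \<longrightarrow> a' = a \<and> b' = b)"

text \<open>The set \<open>\<R>\<^sub>l\<close>, determined by the path of level \<open>l - 1\<close>; there is none on level 1.\<close>

definition refresh_set :: "nat \<Rightarrow> (real \<Rightarrow> 'a) \<Rightarrow> real set" where
  "refresh_set l f = (if l = 1 then {} else {a. \<exists>b. constancy_interval f a b})"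

text \<open>Different Poisson processes almost surely have no common marks, so \<open>LEAST\<close> is harmless.\<close>

definition label ::
    "(nat \<Rightarrow> nat) \<Rightarrow> (nat \<Rightarrow> nat \<Rightarrow> nat \<Rightarrow> real) \<Rightarrow> (nat \<Rightarrow> nat \<Rightarrow> nat) \<Rightarrow> nat \<Rightarrow> real set \<Rightarrow> real \<Rightarrow> nat"
where
  "label M \<sigma> U l R s =
     (if s \<in> mark_set M \<sigma> l then LEAST x. x \<in> {1..M l} \<and> (\<exists>i\<ge>1. s = \<sigma> l x i)
      else U l (rank R s))"

definition atomic_measure :: "real set \<Rightarrow> (real \<Rightarrow> real) \<Rightarrow> real measure" where
  "atomic_measure A w = point_measure UNIV (\<lambda>s. if s \<in> A then ennreal (w s) else 0)"

definition right_inverse :: "real measure \<Rightarrow> real \<Rightarrow> real" where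
  "right_inverse \<mu> t = Inf {r. 0 \<le> r \<and> emeasure \<mu> {0..r} > ennreal t}"

text \<open>
  The pairs \<open>(X\<^sub>l(t), Y\<^sub>l(t))\<close>, where \<open>Y\<^sub>l(t)\<close> is a list of times.  Level 0 is an auxiliary starting
  point of the recursion carrying no information.
\<close>

primrec marks_path ::
    "(nat \<Rightarrow> nat) \<Rightarrow> (nat \<Rightarrow> nat list \<Rightarrow> real) \<Rightarrow> (nat \<Rightarrow> nat \<Rightarrow> nat \<Rightarrow> real) \<Rightarrow> (nat \<Rightarrow> nat \<Rightarrow> real)
      \<Rightarrow> (nat \<Rightarrow> nat \<Rightarrow> nat) \<Rightarrow> nat \<Rightarrow> real \<Rightarrow> nat list \<times> real list" where
  "marks_path M \<gamma> \<sigma> T U 0 = (\<lambda>t. ([], []))"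
| "marks_path M \<gamma> \<sigma> T U (Suc j) =
    (let l = Suc j;
         XY = marks_path M \<gamma> \<sigma> T U j;
         R = refresh_set l XY;
         A = mark_set M \<sigma> l \<union> R;
         \<xi> = label M \<sigma> U l R;
         \<mu> = atomic_measure A (\<lambda>s. \<gamma> l (fst (XY s) @ [\<xi> s]) * T l (rank A s));
         \<phi> = right_inverse \<mu>
     in (\<lambda>t. (fst (XY (\<phi> t)) @ [\<xi> (\<phi> t)], snd (XY (\<phi> t)) @ [\<phi> t])))"

definition marks_process ::
    "(nat \<Rightarrow> nat) \<Rightarrow> (nat \<Rightarrow> nat list \<Rightarrow> real) \<Rightarrow> (nat \<Rightarrow> nat \<Rightarrow> nat \<Rightarrow> 'a \<Rightarrow> real)
      \<Rightarrow> (nat \<Rightarrow> nat \<Rightarrow> 'a \<Rightarrow> real) \<Rightarrow> (nat \<Rightarrow> nat \<Rightarrow> 'a \<Rightarrow> nat) \<Rightarrow> nat \<Rightarrow> real \<Rightarrow> 'a \<Rightarrow> nat list" where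
  "marks_process M \<gamma> \<sigma> T U l t \<omega> =
     fst (marks_path M \<gamma> (\<lambda>l x i. \<sigma> l x i \<omega>) (\<lambda>l n. T l n \<omega>) (\<lambda>l n. U l n \<omega>) l t)"

datatype driver = Gap nat nat nat | Clock nat nat | Refresh nat nat

primrec driver_var ::
    "(nat \<Rightarrow> nat \<Rightarrow> nat \<Rightarrow> 'a \<Rightarrow> real) \<Rightarrow> (nat \<Rightarrow> nat \<Rightarrow> 'a \<Rightarrow> real) \<Rightarrow> (nat \<Rightarrow> nat \<Rightarrow> 'a \<Rightarrow> nat)
      \<Rightarrow> driver \<Rightarrow> 'a \<Rightarrow> real" where
  "driver_var \<sigma> T U (Gap l x i) = (\<lambda>\<omega>. \<sigma> l x (Suc i) \<omega> - \<sigma> l x i \<omega>)"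
| "driver_var \<sigma> T U (Clock l n) = T l n"
| "driver_var \<sigma> T U (Refresh l n) = (\<lambda>\<omega>. real (U l n \<omega>))"

definition drivers :: "nat \<Rightarrow> driver set" where
  "drivers k =
     {Gap l x i | l x i. l \<in> {1..k} \<and> 1 \<le> x} \<union>
     {Clock l n | l n. l \<in> {1..k}} \<union>
     {Refresh l n | l n. l \<in> {2..k}}"

text \<open>
  A rate 1 Poisson process is given by its successive marks, whose spacings (the first one counted
  from time \<open>0\<close>) are independent mean 1 exponential variables.
\<close>

definition marks_environment ::
    "'a measure \<Rightarrow> nat \<Rightarrow> (nat \<Rightarrow> nat) \<Rightarrow> (nat \<Rightarrow> nat \<Rightarrow> nat \<Rightarrow> 'a \<Rightarrow> real)
      \<Rightarrow> (nat \<Rightarrow> nat \<Rightarrow> 'a \<Rightarrow> real) \<Rightarrow> (nat \<Rightarrow> nat \<Rightarrow> 'a \<Rightarrow> nat) \<Rightarrow> bool" where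
  "marks_environment P k M \<sigma> T U \<longleftrightarrow>
     prob_space P \<and>
     prob_space.indep_vars P (\<lambda>_. borel) (driver_var \<sigma> T U) (drivers k) \<and>
     (\<forall>l\<in>{1..k}. \<forall>x\<ge>1. \<forall>\<omega>\<in>space P. \<sigma> l x 0 \<omega> = 0) \<and>
     (\<forall>l\<in>{1..k}. \<forall>x\<ge>1. \<forall>i.
        distributed P lborel (\<lambda>\<omega>. \<sigma> l x (Suc i) \<omega> - \<sigma> l x i \<omega>) (exponential_density 1)) \<and>
     (\<forall>l\<in>{1..k}. \<forall>n. distributed P lborel (T l n) (exponential_density 1)) \<and>
     (\<forall>l\<in>{2..k}. \<forall>n. distr P (count_space UNIV) (U l n) = measure_pmf (pmf_of_set {1..M l}))"

end

theory Submission
  imports Defs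
begin

text \<open>
  Both processes are jump paths: they run through states \<open>J\<^sub>0, J\<^sub>1, \<dots>\<close> and spend a holding time
  \<open>H\<^sub>n\<close> in \<open>J\<^sub>n\<close>.  The law of such a path is determined by the probabilities of the events
  \<open>\<forall>m\<le>n. J\<^sub>m = x\<^sub>m \<and> s\<^sub>m < H\<^sub>m\<close> (\<open>skeleton_distr_unique\<close>).  For the trap model these are given, so
  the task is to find the two sequences for the marks process and to compute these probabilities.

  Level \<open>l + 1\<close> visits, in increasing order, the marks of level \<open>l + 1\<close> and the times at which level
  \<open>l\<close> starts a new sojourn.  Think of one clock for each label \<open>y \<ge> 1\<close>, ringing at the marks of
  that label, and of a clock \<open>0\<close>, ringing whenever level \<open>l\<close> jumps.  The states of level \<open>l + 1\<close> can
  be read off from the order in which the clocks ring: a ring of clock \<open>y\<close> replaces the last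
  coordinate by \<open>y\<close> and keeps the ancestor, a ring of clock \<open>0\<close> moves the ancestor to the next state
  of level \<open>l\<close> and draws a uniform last coordinate.  This defines the sequence \<open>chain\<close>.  The clocks
  \<open>T\<close> of level \<open>l + 1\<close> enter only through the holding times \<open>\<gamma> (J\<^sub>n) T\<^sub>n\<close> and not through the states,
  hence the holding times are, given the states, independent and exponential with the right means;
  they are at the same time the spacings of clock \<open>0\<close> on the next level.  That the process
  constructed from the marks is the jump path with these states and holding times is
  \<open>marks_path_is_jump_path\<close>; it holds off a null set, on which the path need not depend measurably
  on the sample, and this is why the completion appears.

  It remains to find the law of the states.  Given the states of level \<open>l\<close>, the spacings of all
  clocks are independent exponentials; clock \<open>0\<close> has rate \<open>1 / \<gamma> l z\<close> while level \<open>l\<close> is in \<open>z\<close>, the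
  other \<open>M\<close> clocks have rate \<open>1\<close>.  By lack of memory, the times left on all clocks after a ring are
  again independent exponentials (\<open>regeneration\<close>), so the next ring belongs to each clock with
  probability proportional to its rate (\<open>prob_ring_order_eq\<close>).  For
  \<open>p = 1 / (1 + M \<gamma> l z)\<close> this is \<open>p\<close> for clock \<open>0\<close> and \<open>(1 - p) / M\<close> for each label.  So with
  probability \<open>1 - p\<close> only the last coordinate is resampled, and with probability \<open>p\<close> the ancestor
  makes a transition of level \<open>l\<close> as well.  The coin tossing dynamics satisfies the same recursion
  over the levels (\<open>pmf_jump_pmf_Suc\<close>), and \<open>law_of_states\<close> follows by induction; on the first level
  there is no clock \<open>0\<close> and the states are independent and uniform.
\<close>

section \<open>The order in which finitely many clocks ring\<close>

text \<open>
  \<open>D i m\<close> is the time between the rings \<open>m\<close> and \<open>m + 1\<close> of clock \<open>i\<close>, where ring \<open>0\<close> stands for the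
  start of the clock at time \<open>0\<close>.
\<close>

definition ring_time :: "(nat \<Rightarrow> nat \<Rightarrow> real) \<Rightarrow> nat \<Rightarrow> nat \<Rightarrow> real" where
  "ring_time D i m = (\<Sum>r<m. D i r)"

text \<open>
  The list \<open>ws\<close> names the clocks that have rung so far, so clock \<open>i\<close> is waiting for its ring number
  \<open>count_list ws i + 1\<close>.  Taking the least index among simultaneous rings makes the next clock a
  measurable function of the spacings without exception.
\<close>

definition next_clock :: "nat set \<Rightarrow> (nat \<Rightarrow> nat \<Rightarrow> real) \<Rightarrow> nat list \<Rightarrow> nat" where
  "next_clock I D ws =
     (LEAST i. i \<in> I \<and> (\<forall>j\<in>I. ring_time D i (Suc (count_list ws i)) \<le> ring_time D j (Suc (count_list ws j))))"

primrec ring_order :: "nat set \<Rightarrow> (nat \<Rightarrow> nat \<Rightarrow> real) \<Rightarrow> nat \<Rightarrow> nat list" where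
  "ring_order I D 0 = []"
| "ring_order I D (Suc n) = ring_order I D n @ [next_clock I D (ring_order I D n)]"

text \<open>
  The strict inequalities say that \<open>ws\<close> lists the first rings and that no ring among them coincides
  with a later one.  Hence the property holds for at most one list of each length, and the absence
  of ties can be deduced from the fact that the probabilities of all lists add up to \<open>1\<close>.
\<close>

definition rings_in_order :: "nat set \<Rightarrow> (nat \<Rightarrow> nat \<Rightarrow> real) \<Rightarrow> nat list \<Rightarrow> bool" where
  "rings_in_order I D ws \<longleftrightarrow> (\<forall>k<length ws. ws ! k \<in> I \<and> (\<forall>j\<in>I - {ws ! k}.
     ring_time D (ws ! k) (Suc (count_list (take k ws) (ws ! k))) < ring_time D j (Suc (count_list (take k ws) j))))"

lemma length_ring_order [simp]: "length (ring_order I D n) = n"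
  by (induction n) auto

lemma take_ring_order: "m \<le> n \<Longrightarrow> take m (ring_order I D n) = ring_order I D m"
  by (induction n) (auto simp: le_Suc_eq)

lemma ring_time_0 [simp]: "ring_time D i 0 = 0"
  by (simp add: ring_time_def)

lemma ring_time_Suc: "ring_time D i (Suc m) = ring_time D i m + D i m"
  by (simp add: ring_time_def)

lemma rings_in_order_Nil [simp]: "rings_in_order I D []"
  by (simp add: rings_in_order_def)

lemma rings_in_order_snoc:
  "rings_in_order I D (ws @ [i]) \<longleftrightarrow> rings_in_order I D ws \<and> i \<in> I \<and>
     (\<forall>j\<in>I - {i}. ring_time D i (Suc (count_list ws i)) < ring_time D j (Suc (count_list ws j)))"
  by (auto simp: rings_in_order_def nth_append less_Suc_eq)

lemma next_clock_mem:
  assumes "finite I" "I \<noteq> {}"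
  shows "next_clock I D ws \<in> I"
proof -
  let ?f = "\<lambda>i. ring_time D i (Suc (count_list ws i))"
  have "\<exists>i. i \<in> I \<and> (\<forall>j\<in>I. ?f i \<le> ?f j)"
    using ex_min_if_finite[of "?f ` I"] assms by (force simp: not_less)
  from LeastI_ex[OF this] show ?thesis
    by (simp add: next_clock_def)
qed

lemma next_clock_eqI:
  assumes "i \<in> I" "\<And>j. j \<in> I - {i} \<Longrightarrow> ring_time D i (Suc (count_list ws i)) < ring_time D j (Suc (count_list ws j))"
  shows "next_clock I D ws = i"
  unfolding next_clock_def
proof (rule Least_equality)
  show "i \<in> I \<and> (\<forall>j\<in>I. ring_time D i (Suc (count_list ws i)) \<le> ring_time D j (Suc (count_list ws j)))"
    using assms by (metis DiffI less_eq_real_def singletonD)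
  fix i' assume "i' \<in> I \<and> (\<forall>j\<in>I. ring_time D i' (Suc (count_list ws i')) \<le> ring_time D j (Suc (count_list ws j)))"
  then show "i \<le> i'"
    using assms by (metis DiffI linorder_not_less order.refl singletonD)
qed

lemma ring_order_unique:
  assumes "rings_in_order I D ws"
  shows "ring_order I D (length ws) = ws"
  using assms by (induction ws rule: rev_induct) (auto simp: rings_in_order_snoc intro!: next_clock_eqI)

lemma set_ring_order_subset:
  assumes "finite I" "I \<noteq> {}"
  shows "set (ring_order I D n) \<subseteq> I"
  using assms by (induction n) (auto simp: next_clock_mem)

text \<open>
  The first rings are decided by the spacings that have already started.  This allows random
  spacings to be replaced by deterministic ones on the event that the former agree with the latter
  up to the current count.
\<close>

lemma ring_order_eq_cong:
  assumes "\<And>i m. i \<in> I \<Longrightarrow> m \<le> count_list ws i \<Longrightarrow> D i m = D' i m"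
  shows "ring_order I D (length ws) = ws \<longleftrightarrow> ring_order I D' (length ws) = ws"
  using assms
proof (induction ws rule: rev_induct)
  case (snoc i ws)
  have "ring_time D j (Suc (count_list ws j)) = ring_time D' j (Suc (count_list ws j))" if "j \<in> I" for j
    unfolding ring_time_def using that snoc.prems[of j] by (intro sum.cong) auto
  then have "next_clock I D ws = next_clock I D' ws"
    unfolding next_clock_def by (metis (no_types, lifting))
  moreover have "ring_order I D (length ws) = ws \<longleftrightarrow> ring_order I D' (length ws) = ws"
    using snoc.prems by (intro snoc.IH) auto
  ultimately show ?case by auto
qed simp

lemma sum_count_list: "finite I \<Longrightarrow> set ws \<subseteq> I \<Longrightarrow> (\<Sum>i\<in>I. count_list ws i) = length ws"
proof (induction ws)
  case (Cons a ws)
  have "(\<Sum>i\<in>I. count_list (a # ws) i) = (\<Sum>i\<in>I. count_list ws i + (if a = i then 1 else 0))"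
    by (intro sum.cong) auto
  with Cons show ?case by (simp add: sum.distrib)
qed simp

text \<open>
  Time of ring number \<open>n\<close>, counted over all clocks.
\<close>

definition atom :: "nat set \<Rightarrow> (nat \<Rightarrow> nat \<Rightarrow> real) \<Rightarrow> nat \<Rightarrow> real" where
  "atom I D n = (let i = next_clock I D (ring_order I D n) in ring_time D i (Suc (count_list (ring_order I D n) i)))"

locale clocks =
  fixes I :: "nat set" and D :: "nat \<Rightarrow> nat \<Rightarrow> real"
  assumes finite_I: "finite I" and I_ne: "I \<noteq> {}"
    and D_pos: "\<And>i m. i \<in> I \<Longrightarrow> 0 < D i m"
    and no_ties: "\<And>n. rings_in_order I D (ring_order I D n)"
    and unbounded: "\<And>i b. i \<in> I \<Longrightarrow> \<exists>m. b < ring_time D i m"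
begin

abbreviation "W n \<equiv> ring_order I D n"
abbreviation "w n \<equiv> next_clock I D (ring_order I D n)"
abbreviation "N n i \<equiv> count_list (ring_order I D n) i"
abbreviation "\<tau> n \<equiv> atom I D n"

lemma w_mem: "w n \<in> I"
  by (simp add: next_clock_mem finite_I I_ne)

lemma ring_time_strict_mono: "i \<in> I \<Longrightarrow> m < m' \<Longrightarrow> ring_time D i m < ring_time D i m'"
  using D_pos by (auto simp: ring_time_def intro!: sum_strict_mono2 intro: less_imp_le)

lemma ring_time_less_iff: "i \<in> I \<Longrightarrow> ring_time D i m < ring_time D i m' \<longleftrightarrow> m < m'"
  using ring_time_strict_mono[of i m m'] ring_time_strict_mono[of i m' m]
  by (cases m m' rule: linorder_cases) auto

lemma atom_eq: "\<tau> n = ring_time D (w n) (Suc (N n (w n)))"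
  by (simp add: atom_def Let_def)

lemma atom_less: "j \<in> I \<Longrightarrow> j \<noteq> w n \<Longrightarrow> \<tau> n < ring_time D j (Suc (N n j))"
  using no_ties[of "Suc n"] by (simp add: rings_in_order_snoc atom_eq)

text \<open>
  The two claims are proved together: the next ring is later than ring \<open>n\<close> because the clock that
  rings next had not yet rung again at that time, and this in turn needs the times to increase.
\<close>

lemma atom_bounds_aux:
  "(\<forall>i\<in>I. ring_time D i (N (Suc n) i) \<le> \<tau> n \<and> \<tau> n < ring_time D i (Suc (N (Suc n) i))) \<and> (\<forall>m. n = Suc m \<longrightarrow> \<tau> m < \<tau> n)"
proof (induction n)
  case 0
  show ?case
  proof (intro conjI ballI allI impI)
    fix i assume i: "i \<in> I"
    show "ring_time D i (N (Suc 0) i) \<le> \<tau> 0"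
      using i D_pos w_mem[of 0] by (auto simp: atom_eq ring_time_def intro: less_imp_le)
    show "\<tau> 0 < ring_time D i (Suc (N (Suc 0) i))"
      using i atom_less[of i 0] ring_time_strict_mono[of i] by (auto simp: atom_eq)
  qed simp
next
  case (Suc n)
  have less: "\<tau> n < \<tau> (Suc n)"
    using Suc w_mem[of "Suc n"] unfolding atom_eq[of "Suc n"] by blast
  show ?case
  proof (intro conjI ballI allI impI)
    fix i assume i: "i \<in> I"
    show "ring_time D i (N (Suc (Suc n)) i) \<le> \<tau> (Suc n)"
    proof (cases "i = w (Suc n)")
      case False
      then have "N (Suc (Suc n)) i = N (Suc n) i" by auto
      then show ?thesis using Suc i less by fastforce
    qed (simp add: atom_eq)
    show "\<tau> (Suc n) < ring_time D i (Suc (N (Suc (Suc n)) i))"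
    proof (cases "i = w (Suc n)")
      case True
      then show ?thesis using ring_time_strict_mono[OF i] by (simp add: atom_eq)
    next
      case False
      then have "N (Suc (Suc n)) i = N (Suc n) i" by auto
      then show ?thesis using atom_less[OF i False] by simp
    qed
  next
    fix m assume "Suc n = Suc m"
    with less show "\<tau> m < \<tau> (Suc n)" by simp
  qed
qed

lemma ring_le_atom: "i \<in> I \<Longrightarrow> ring_time D i (N (Suc n) i) \<le> \<tau> n"
  and atom_less_ring: "i \<in> I \<Longrightarrow> \<tau> n < ring_time D i (Suc (N (Suc n) i))"
  using atom_bounds_aux by blast+

lemma strict_mono_atom: "strict_mono \<tau>"
  using atom_bounds_aux by (intro strict_monoI_Suc) blast

lemma atom_pos: "0 < \<tau> n"
  using ring_time_strict_mono[OF w_mem, of 0] by (simp add: atom_eq)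

text \<open>
  Each clock rings only finitely often before time \<open>b\<close>, and there are finitely many clocks.
\<close>

lemma atom_unbounded: "\<exists>n. b < \<tau> n"
proof -
  obtain K where K: "\<And>i. i \<in> I \<Longrightarrow> b < ring_time D i (K i)"
  proof -
    have "\<forall>i\<in>I. \<exists>m. b < ring_time D i m" using unbounded by blast
    from bchoice[OF this] show ?thesis using that by blast
  qed
  define n where "n = sum K I"
  have "\<exists>i\<in>I. K i \<le> N (Suc n) i"
  proof (rule ccontr)
    assume "\<not> ?thesis"
    then have "(\<Sum>i\<in>I. N (Suc n) i) \<le> sum K I"
      by (intro sum_mono) (auto simp: not_le intro: less_imp_le)
    moreover have "(\<Sum>i\<in>I. N (Suc n) i) = Suc n"
      using sum_count_list[OF finite_I set_ring_order_subset[OF finite_I I_ne], of D "Suc n"]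
      by (simp del: ring_order.simps)
    ultimately show False by (simp add: n_def)
  qed
  then obtain i where i: "i \<in> I" "K i \<le> N (Suc n) i" by blast
  have "b < ring_time D i (K i)" using K i by blast
  also have "\<dots> \<le> ring_time D i (N (Suc n) i)"
    using ring_time_less_iff[OF i(1)] i(2) by (meson not_le)
  also have "\<dots> \<le> \<tau> n" using ring_le_atom i by blast
  finally show ?thesis by blast
qed

text \<open>
  No ring is skipped: the overall ring times exceed any bound, so the count of clock \<open>i\<close> must pass
  \<open>m\<close> at some point.
\<close>

lemma ring_is_atom:
  assumes "i \<in> I"
  shows "\<exists>n. w n = i \<and> N n i = m \<and> \<tau> n = ring_time D i (Suc m)"
proof -
  obtain n where "ring_time D i (Suc m) < \<tau> n" using atom_unbounded by blast
  then have "ring_time D i (Suc m) < ring_time D i (Suc (N (Suc n) i))"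
    using atom_less_ring[OF assms, of n] by linarith
  then have "Suc m < Suc (N (Suc n) i)" unfolding ring_time_less_iff[OF assms] .
  then have ex: "\<exists>n. m < N (Suc n) i" by (intro exI[of _ n]) linarith
  define n0 where "n0 = (LEAST n. m < N (Suc n) i)"
  have 1: "m < N (Suc n0) i" using LeastI_ex[OF ex] by (simp add: n0_def)
  have 2: "N n0 i \<le> m"
  proof (cases n0)
    case (Suc n')
    then show ?thesis using not_less_Least[of n' "\<lambda>n. m < N (Suc n) i"] by (simp add: n0_def)
  qed simp
  have "w n0 = i" "N n0 i = m" using 1 2 by (auto split: if_splits)
  then show ?thesis using atom_eq[of n0] by (intro exI[of _ n0]) simp
qed

lemma range_atom: "range \<tau> = {ring_time D i (Suc m) | i m. i \<in> I}"
proof (intro equalityI subsetI)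
  fix t assume "t \<in> range \<tau>"
  then show "t \<in> {ring_time D i (Suc m) | i m. i \<in> I}" using atom_eq w_mem by blast
next
  fix t assume "t \<in> {ring_time D i (Suc m) | i m. i \<in> I}"
  then obtain i m where "i \<in> I" "t = ring_time D i (Suc m)" by blast
  then obtain n where "t = \<tau> n" using ring_is_atom[of i m] by metis
  then show "t \<in> range \<tau>" by blast
qed

lemma ring_time_inj:
  assumes "i \<in> I" "j \<in> I" "ring_time D i (Suc m) = ring_time D j (Suc m')"
  shows "i = j \<and> m = m'"
proof -
  obtain n where n: "w n = i" "N n i = m" "\<tau> n = ring_time D i (Suc m)"
    using ring_is_atom[OF assms(1), of m] by blast
  obtain n' where n': "w n' = j" "N n' j = m'" "\<tau> n' = ring_time D j (Suc m')"
    using ring_is_atom[OF assms(2), of m'] by blast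
  have "n = n'"
    by (rule strict_mono_eq[OF strict_mono_atom, THEN iffD1]) (simp only: n(3) n'(3) assms(3))
  then show ?thesis using n(1,2) n'(1,2) by metis
qed

end

section \<open>Paths with isolated jumps\<close>

text \<open>
  The index of the holding interval containing \<open>t\<close>, as it occurs in the definition of a jump path.
\<close>

definition sojourn :: "(nat \<Rightarrow> real) \<Rightarrow> real \<Rightarrow> nat" where
  "sojourn H t = (LEAST n. t < (\<Sum>m\<le>n. H m))"

definition holding_times :: "(nat \<Rightarrow> real) \<Rightarrow> bool" where
  "holding_times H \<longleftrightarrow> (\<forall>n. 0 < H n) \<and> (\<forall>b. \<exists>n. b < (\<Sum>m<n. H m))"

lemma jump_path_eq: "jump_path J H t = J (sojourn H t)"
  by (simp add: jump_path_def sojourn_def)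

lemma holding_times_strict_mono:
  assumes "holding_times H"
  shows "strict_mono (\<lambda>n. \<Sum>m<n. H m)"
  using assms by (intro strict_monoI_Suc) (simp add: holding_times_def)

lemma sojourn_eqI:
  assumes "holding_times H" "(\<Sum>m<n. H m) \<le> t" "t < (\<Sum>m<Suc n. H m)"
  shows "sojourn H t = n"
  unfolding sojourn_def
proof (rule Least_equality)
  show "t < (\<Sum>m\<le>n. H m)" using assms by (simp add: lessThan_Suc_atMost)
  fix n' assume "t < (\<Sum>m\<le>n'. H m)"
  then have "(\<Sum>m<n. H m) < (\<Sum>m<Suc n'. H m)"
    using assms by (simp add: lessThan_Suc_atMost)
  then have "n < Suc n'" by (simp only: strict_mono_less[OF holding_times_strict_mono[OF assms(1)]])
  then show "n \<le> n'" by simp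
qed

lemma sojourn_bounds:
  assumes "holding_times H" "0 \<le> t"
  shows "(\<Sum>m<sojourn H t. H m) \<le> t" "t < (\<Sum>m<Suc (sojourn H t). H m)"
proof -
  obtain n where "t < (\<Sum>m<n. H m)" using assms unfolding holding_times_def by blast
  then have "t < (\<Sum>m<Suc n. H m)"
    using assms(1) by (simp add: holding_times_def add_strict_increasing2 add.commute less_add_same_cancel2 order_less_trans[of t "sum H {..<n}"])
  then have "\<exists>n. t < (\<Sum>m\<le>n. H m)" by (auto simp only: lessThan_Suc_atMost)
  from LeastI_ex[OF this] show "t < (\<Sum>m<Suc (sojourn H t). H m)"
    by (simp add: sojourn_def lessThan_Suc_atMost)
  show "(\<Sum>m<sojourn H t. H m) \<le> t"
  proof (cases "sojourn H t")
    case (Suc n)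
    then show ?thesis using not_less_Least[of n "\<lambda>n. t < (\<Sum>m\<le>n. H m)"]
      by (simp add: sojourn_def lessThan_Suc_atMost)
  qed (use assms in simp)
qed

lemma sojourn_start:
  assumes "holding_times H"
  shows "sojourn H (\<Sum>m<n. H m) = n"
  using assms by (intro sojourn_eqI) (auto simp: holding_times_def)

text \<open>
  The mass of \<open>[0, r]\<close> increases by \<open>h n\<close> at \<open>r = a n\<close>.  It exceeds \<open>t\<close> for the first time at the atom
  whose index is that of the holding interval containing \<open>t\<close>.
\<close>

lemma right_inverse_atomic_measure:
  assumes a: "strict_mono a" "0 \<le> a 0" "\<And>b. \<exists>n. b < a n"
    and h: "holding_times h" "\<And>n. w (a n) = h n" and t: "0 \<le> t"
  shows "right_inverse (atomic_measure (range a) w) t = a (sojourn h t)"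
proof -
  have iff: "emeasure (atomic_measure (range a) w) {0..r} > ennreal t \<longleftrightarrow> a (sojourn h t) \<le> r" for r
  proof -
    define K where "K = (LEAST n. r < a n)"
    have "r < a K" using LeastI_ex[OF a(3)[of r]] by (simp add: K_def)
    have K: "a n \<le> r \<longleftrightarrow> n < K" for n
    proof
      assume "a n \<le> r"
      then have "a n < a K" using \<open>r < a K\<close> by simp
      then show "n < K" by (simp add: strict_mono_less[OF a(1)])
    next
      assume "n < K"
      then show "a n \<le> r" using not_less_Least[of n "\<lambda>n. r < a n"] by (simp add: K_def)
    qed
    have nonneg: "0 \<le> a n" for n
      using a(2) strict_mono_less_eq[OF a(1), of 0 n] by simp
    let ?f = "\<lambda>s. if s \<in> range a then ennreal (w s) else 0"
    have set: "{s \<in> {0..r}. 0 < ?f s} = a ` {..<K}"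
      using h by (auto simp: holding_times_def K nonneg strict_mono_eq[OF a(1)])
    have "emeasure (atomic_measure (range a) w) {0..r} = (\<Sum>s | s \<in> {0..r} \<and> 0 < ?f s. ?f s)"
      unfolding atomic_measure_def
      by (rule emeasure_point_measure) (auto simp only: set finite_imageI finite_lessThan)
    also have "\<dots> = (\<Sum>s\<in>a ` {..<K}. ?f s)" using set by simp
    also have "\<dots> = (\<Sum>n<K. ennreal (h n))"
      using a(1) h(2) by (subst sum.reindex) (auto intro: strict_mono_imp_inj_on inj_on_subset)
    also have "\<dots> = ennreal (\<Sum>n<K. h n)"
      using h(1) by (intro sum_ennreal) (auto simp: holding_times_def intro: less_imp_le)
    finally have "emeasure (atomic_measure (range a) w) {0..r} > ennreal t \<longleftrightarrow> t < (\<Sum>n<K. h n)"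
      using t by (simp add: ennreal_less_iff)
    also have "\<dots> \<longleftrightarrow> sojourn h t < K"
    proof
      assume "t < (\<Sum>n<K. h n)"
      then have "(\<Sum>m<sojourn h t. h m) < (\<Sum>n<K. h n)" using sojourn_bounds(1)[OF h(1) t] by simp
      then show "sojourn h t < K" by (simp only: strict_mono_less[OF holding_times_strict_mono[OF h(1)]])
    next
      assume "sojourn h t < K"
      then have "(\<Sum>m<Suc (sojourn h t). h m) \<le> (\<Sum>n<K. h n)"
        by (simp only: strict_mono_less_eq[OF holding_times_strict_mono[OF h(1)]] Suc_le_eq)
      then show "t < (\<Sum>n<K. h n)" using sojourn_bounds(2)[OF h(1) t] by simp
    qed
    finally show ?thesis by (simp add: K)
  qed
  have "0 \<le> a (sojourn h t)"
    using a(2) strict_mono_less_eq[OF a(1), of 0 "sojourn h t"] by simp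
  then have "{r. 0 \<le> r \<and> emeasure (atomic_measure (range a) w) {0..r} > ennreal t} = {a (sojourn h t)..}"
    by (auto simp: iff)
  then show ?thesis by (simp add: right_inverse_def)
qed

text \<open>
  An injective \<open>v\<close> takes different values on adjacent holding intervals, so these are exactly the
  maximal intervals of constancy.
\<close>

lemma left_ends_of_constancy_intervals:
  assumes h: "holding_times h" and v: "inj v" and f: "\<And>t. 0 \<le> t \<Longrightarrow> f t = v (sojourn h t)"
  shows "{a. \<exists>b. constancy_interval f a b} = range (\<lambda>n. \<Sum>m<n. h m)"
proof -
  let ?S = "\<lambda>n. \<Sum>m<n. h m"
  note mono = holding_times_strict_mono[OF h]
  have S0: "0 \<le> ?S n" for n using h by (intro sum_nonneg) (auto simp: holding_times_def intro: less_imp_le)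
  have bound: "?S (sojourn h a) \<le> a \<and> b \<le> ?S (Suc (sojourn h a))"
    if "0 \<le> a" "a < b" and const: "f constant_on {a..<b}" for a b
  proof
    show "?S (sojourn h a) \<le> a" using sojourn_bounds[OF h] that by blast
    show "b \<le> ?S (Suc (sojourn h a))"
    proof (rule ccontr)
      let ?s = "?S (Suc (sojourn h a))"
      assume "\<not> b \<le> ?s"
      moreover have "a < ?s" using sojourn_bounds[OF h] that by blast
      ultimately have "?s \<in> {a..<b}" "a \<in> {a..<b}" using that by auto
      then have "f ?s = f a" using const unfolding constant_on_def by metis
      moreover have "f ?s = v (Suc (sojourn h a))"
        by (simp only: f[OF S0] sojourn_start[OF h])
      ultimately have "v (Suc (sojourn h a)) = v (sojourn h a)"
        using f[OF that(1)] by (simp only:)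
      then have "Suc (sojourn h a) = sojourn h a" by (rule injD[OF v])
      then show False by simp
    qed
  qed
  have ivl: "f constant_on {?S n..<?S (Suc n)}" for n
    unfolding constant_on_def
  proof (intro exI[of _ "v n"] ballI)
    fix t assume t: "t \<in> {?S n..<?S (Suc n)}"
    then have "sojourn h t = n" by (intro sojourn_eqI[OF h]) auto
    moreover have "0 \<le> t" using t S0[of n] by simp
    ultimately show "f t = v n" using f by simp
  qed
  show ?thesis
  proof (intro equalityI subsetI)
    fix a assume "a \<in> {a. \<exists>b. constancy_interval f a b}"
    then obtain b where ab: "constancy_interval f a b" by blast
    then have "?S (sojourn h a) \<le> a \<and> b \<le> ?S (Suc (sojourn h a))"
      using bound unfolding constancy_interval_def by blast
    then have "?S (sojourn h a) = a"
      using ab S0 ivl unfolding constancy_interval_def by blast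
    then show "a \<in> range ?S" by (intro image_eqI[of _ _ "sojourn h a"]) simp_all
  next
    fix a assume "a \<in> range ?S"
    then obtain n where a: "a = ?S n" by blast
    have "constancy_interval f (?S n) (?S (Suc n))"
      unfolding constancy_interval_def
    proof (intro conjI allI impI)
      show "?S n < ?S (Suc n)" using h by (simp add: holding_times_def)
      fix a' b' assume *: "0 \<le> a' \<and> a' \<le> ?S n \<and> ?S (Suc n) \<le> b' \<and> f constant_on {a'..<b'}"
      with \<open>?S n < ?S (Suc n)\<close> have b: "?S (sojourn h a') \<le> a' \<and> b' \<le> ?S (Suc (sojourn h a'))"
        by (intro bound) auto
      have "?S (sojourn h a') \<le> ?S n" "?S (Suc n) \<le> ?S (Suc (sojourn h a'))" using b * by linarith+
      then have "sojourn h a' = n"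
        unfolding strict_mono_less_eq[OF mono] by simp
      with b * show "a' = ?S n" "b' = ?S (Suc n)" by auto
    qed (use S0 ivl in auto)
    then show "a \<in> {a. \<exists>b. constancy_interval f a b}" using a by blast
  qed
qed

lemma rank_range:
  assumes "strict_mono a"
  shows "rank (range a) (a n) = n"
proof -
  have "{x \<in> range a. x < a n} = a ` {..<n}"
    using assms by (auto simp: strict_mono_less)
  then show ?thesis
    using assms by (simp add: rank_def card_image strict_mono_imp_inj_on)
qed

text \<open>
  Otherwise the series would converge and its terms would tend to \<open>0\<close>.
\<close>

lemma partial_sums_unbounded:
  fixes D :: "nat \<Rightarrow> real"
  assumes "\<And>m. 0 \<le> D m" "0 < c" "\<exists>\<^sub>\<infinity>m. c < D m"
  shows "\<exists>n. b < (\<Sum>m<n. D m)"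
proof (rule ccontr)
  assume "\<not> ?thesis"
  then have "(\<Sum>m\<le>n. D m) \<le> b" for n
    by (metis lessThan_Suc_atMost not_less)
  then have "summable D" by (rule bounded_imp_summable[OF assms(1)])
  then have "eventually (\<lambda>m. D m < c) sequentially"
    using summable_LIMSEQ_zero assms(2) order_tendstoD(2) by blast
  then have "\<forall>\<^sub>\<infinity>m. \<not> c < D m"
    by (auto simp: cofinite_eq_sequentially elim: eventually_mono)
  with assms(3) show False by (simp add: frequently_def)
qed

section \<open>The marks construction as a jump path\<close>

text \<open>
  The clocks that drive level \<open>l + 1\<close>: one for each label and, unless \<open>l = 0\<close>, clock \<open>0\<close> for the jumps
  of level \<open>l\<close>.
\<close>

definition clock_set :: "(nat \<Rightarrow> nat) \<Rightarrow> nat \<Rightarrow> nat set" where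
  "clock_set M l = (if l = 0 then {1..M 1} else {0..M (Suc l)})"

text \<open>
  The spacings of clock \<open>0\<close> are the holding times of level \<open>l\<close>, whose states are \<open>C\<close>; those of the other
  clocks are the gaps between marks.
\<close>

definition durations ::
    "(nat \<Rightarrow> nat list \<Rightarrow> real) \<Rightarrow> nat \<Rightarrow> (nat \<Rightarrow> nat list) \<Rightarrow> (driver \<Rightarrow> real) \<Rightarrow> nat \<Rightarrow> nat \<Rightarrow> real" where
  "durations \<gamma> l C d i m = (if i = 0 then \<gamma> l (C m) * d (Clock l m) else d (Gap (Suc l) i m))"

text \<open>
  The states of level \<open>l\<close> as a function of a sample of the drivers.  State \<open>n\<close> of level \<open>l + 1\<close> is the one
  after \<open>n\<close> rings, since for \<open>l \<ge> 1\<close> the sojourn of level \<open>l\<close> that starts at time \<open>0\<close> provides an atom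
  before any ring.  On the first level there is no such atom and the first state is entered
  with the first ring, whence \<open>Suc n\<close>.
\<close>

primrec chain ::
    "(nat \<Rightarrow> nat) \<Rightarrow> (nat \<Rightarrow> nat list \<Rightarrow> real) \<Rightarrow> nat \<Rightarrow> (driver \<Rightarrow> real) \<Rightarrow> nat \<Rightarrow> nat list" where
  "chain M \<gamma> 0 d = (\<lambda>n. [])"
| "chain M \<gamma> (Suc l) d = (\<lambda>n.
     let C = chain M \<gamma> l d;
         ws = ring_order (clock_set M l) (durations \<gamma> l C d) (if l = 0 then Suc n else n);
         N = count_list ws 0
     in C N @ [if l \<noteq> 0 \<and> (ws = [] \<or> last ws = 0) then nat \<lfloor>d (Refresh (Suc l) N)\<rfloor> else last ws])"

lemma clock_set_simps [simp]: "clock_set M 0 = {1..M 1}" "0 < l \<Longrightarrow> clock_set M l = {0..M (Suc l)}"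
  by (auto simp: clock_set_def)

lemma finite_clock_set [simp]: "finite (clock_set M l)"
  by (simp add: clock_set_def)

lemma clock_set_nonempty: "1 \<le> M (Suc l) \<Longrightarrow> clock_set M l \<noteq> {}"
  by (auto simp: clock_set_def)

lemma snoc_in_tree:
  assumes "z \<in> tree M l" "y \<in> {1..M (Suc l)}"
  shows "z @ [y] \<in> tree M (Suc l)"
proof -
  have mem: "z ! m \<in> {1..M (Suc m)}" if "m < l" for m
    using assms(1) that by (auto simp: tree_def labels_def)
  have len: "length z = l" using assms(1) by (simp add: tree_def labels_def)
  have "(z @ [y]) ! m \<in> {1..M (Suc m)}" if "m < Suc l" for m
    using that mem[of m] assms(2) len by (cases "m = l") (auto simp: nth_append)
  then show ?thesis using len by (simp add: tree_def labels_def)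
qed

lemma tree_SucE:
  assumes "x \<in> tree M (Suc l)"
  obtains z y where "x = z @ [y]" "z \<in> tree M l" "y \<in> {1..M (Suc l)}"
proof -
  have len: "length x = Suc l" and mem: "\<And>m. m < Suc l \<Longrightarrow> x ! m \<in> {1..M (Suc m)}"
    using assms by (auto simp: tree_def labels_def)
  then obtain z y where x: "x = z @ [y]" by (cases x rule: rev_cases) auto
  have z: "z ! m \<in> {1..M (Suc m)}" if "m < l" for m
    using mem[of m] that len by (auto simp: x nth_append split: if_splits)
  have "z \<in> tree M l" "y \<in> {1..M (Suc l)}"
    using z mem[of l] len by (auto simp: x tree_def labels_def)
  with x show ?thesis using that by blast
qed

lemma tree_0 [simp]: "tree M 0 = {[]}"
  by (auto simp: tree_def labels_def)

lemma tree_Suc: "tree M (Suc l) = (\<lambda>(z, y). z @ [y]) ` (tree M l \<times> {1..M (Suc l)})"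
proof (intro equalityI subsetI)
  fix x assume "x \<in> tree M (Suc l)"
  then obtain z y where "x = z @ [y]" "z \<in> tree M l" "y \<in> {1..M (Suc l)}" by (rule tree_SucE)
  then show "x \<in> (\<lambda>(z, y). z @ [y]) ` (tree M l \<times> {1..M (Suc l)})"
    by (intro image_eqI[of _ _ "(z, y)"]) auto
next
  fix x assume "x \<in> (\<lambda>(z, y). z @ [y]) ` (tree M l \<times> {1..M (Suc l)})"
  then obtain z y where "x = z @ [y]" "z \<in> tree M l" "y \<in> {1..M (Suc l)}" by auto
  then show "x \<in> tree M (Suc l)" using snoc_in_tree by simp
qed

lemma finite_tree [simp]: "finite (tree M l)"
proof (induction l)
  case (Suc l)
  then show ?case unfolding tree_Suc by (intro finite_imageI finite_cartesian_product) auto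
qed simp

lemma chain_in_tree:
  assumes "\<And>j. j \<in> {1..l} \<Longrightarrow> 1 \<le> M j"
    and "\<And>j n. j \<in> {2..l} \<Longrightarrow> nat \<lfloor>d (Refresh j n)\<rfloor> \<in> {1..M j}"
  shows "chain M \<gamma> l d n \<in> tree M l"
  using assms
proof (induction l arbitrary: n)
  case (Suc l)
  define C where "C = chain M \<gamma> l d"
  define ws where "ws = ring_order (clock_set M l) (durations \<gamma> l C d) (if l = 0 then Suc n else n)"
  let ?N = "count_list ws 0"
  have ws: "set ws \<subseteq> clock_set M l"
    using Suc.prems(1)[of "Suc l"] unfolding ws_def
    by (intro set_ring_order_subset clock_set_nonempty) auto
  have "(if l \<noteq> 0 \<and> (ws = [] \<or> last ws = 0) then nat \<lfloor>d (Refresh (Suc l) ?N)\<rfloor> else last ws) \<in> {1..M (Suc l)}"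
  proof (cases "l \<noteq> 0 \<and> (ws = [] \<or> last ws = 0)")
    case True
    then show ?thesis using Suc.prems(2)[of "Suc l"] by auto
  next
    case False
    have "length ws = (if l = 0 then Suc n else n)" unfolding ws_def by simp
    with False have "ws \<noteq> []" by (cases "l = 0") auto
    then have "last ws \<in> clock_set M l" using ws by auto
    with False \<open>ws \<noteq> []\<close> show ?thesis by (cases "l = 0") auto
  qed
  moreover have "C ?N \<in> tree M l" unfolding C_def using Suc by auto
  ultimately show ?case
    unfolding chain.simps Let_def C_def[symmetric] ws_def[symmetric] by (intro snoc_in_tree)
qed simp

lemma tree_lower_bound:
  assumes "\<And>x. x \<in> tree M l \<Longrightarrow> 0 < \<gamma> l x"
  obtains c :: real where "0 < c" "\<And>x. x \<in> tree M l \<Longrightarrow> c \<le> \<gamma> l x"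
proof
  let ?c = "Min (insert 1 (\<gamma> l ` tree M l))"
  show "0 < ?c" using assms by auto
  show "?c \<le> \<gamma> l x" if "x \<in> tree M l" for x using that by auto
qed

text \<open>
  The samples on which the construction shows no degeneracy.  Infinitely many spacings larger than
  \<open>1\<close> give unbounded sums even after multiplication with values of \<open>\<gamma>\<close>, because these are bounded
  away from \<open>0\<close> on the finite set of states.
\<close>

locale regular_sample =
  fixes M :: "nat \<Rightarrow> nat" and \<gamma> :: "nat \<Rightarrow> nat list \<Rightarrow> real" and k :: nat and d :: "driver \<Rightarrow> real"
    and \<sigma> :: "nat \<Rightarrow> nat \<Rightarrow> nat \<Rightarrow> real" and T :: "nat \<Rightarrow> nat \<Rightarrow> real" and U :: "nat \<Rightarrow> nat \<Rightarrow> nat"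
  assumes M_pos: "\<And>j. j \<in> {1..k} \<Longrightarrow> 1 \<le> M j"
    and \<gamma>_pos: "\<And>j x. j \<in> {1..k} \<Longrightarrow> x \<in> tree M j \<Longrightarrow> 0 < \<gamma> j x"
    and \<sigma>: "\<And>l x i. l \<in> {1..k} \<Longrightarrow> 1 \<le> x \<Longrightarrow> \<sigma> l x i = (\<Sum>m<i. d (Gap l x m))"
    and T: "\<And>l n. l \<in> {1..k} \<Longrightarrow> T l n = d (Clock l n)"
    and U: "\<And>l n. l \<in> {2..k} \<Longrightarrow> real (U l n) = d (Refresh l n)"
    and U_mem: "\<And>l n. l \<in> {2..k} \<Longrightarrow> U l n \<in> {1..M l}"
    and gap_pos: "\<And>l x n. l \<in> {1..k} \<Longrightarrow> 1 \<le> x \<Longrightarrow> 0 < d (Gap l x n)"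
    and clock_pos: "\<And>l n. l \<in> {1..k} \<Longrightarrow> 0 < d (Clock l n)"
    and gap_recurrent: "\<And>l x. l \<in> {1..k} \<Longrightarrow> 1 \<le> x \<Longrightarrow> \<exists>\<^sub>\<infinity>n. 1 < d (Gap l x n)"
    and clock_recurrent: "\<And>l. l \<in> {1..k} \<Longrightarrow> \<exists>\<^sub>\<infinity>n. 1 < d (Clock l n)"
    and no_ties: "\<And>l n. l < k \<Longrightarrow>
      rings_in_order (clock_set M l) (durations \<gamma> l (chain M \<gamma> l d) d)
        (ring_order (clock_set M l) (durations \<gamma> l (chain M \<gamma> l d) d) n)"
begin

abbreviation "XY \<equiv> marks_path M \<gamma> \<sigma> T U"
abbreviation "states l \<equiv> chain M \<gamma> l d"

definition hold :: "nat \<Rightarrow> nat \<Rightarrow> real" where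
  "hold l n = \<gamma> l (states l n) * d (Clock l n)"

lemma Refresh_eq: "l \<in> {2..k} \<Longrightarrow> nat \<lfloor>d (Refresh l n)\<rfloor> = U l n"
  using U[of l n, symmetric] by simp

lemma states_in_tree: "l \<le> k \<Longrightarrow> states l n \<in> tree M l"
  using M_pos U_mem by (intro chain_in_tree) (auto simp: Refresh_eq)

lemma holding_times_hold:
  assumes "l \<in> {1..k}"
  shows "holding_times (hold l)"
proof -
  obtain c where c: "0 < c" "\<And>x. x \<in> tree M l \<Longrightarrow> c \<le> \<gamma> l x"
    using tree_lower_bound[of M l \<gamma>] \<gamma>_pos[OF assms] by blast
  have ge: "c * d (Clock l n) \<le> hold l n" for n
    using c(2)[OF states_in_tree, of n] clock_pos[OF assms, of n] assms
    by (auto simp: hold_def intro!: mult_right_mono)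
  have pos: "0 < hold l n" for n
    using ge[of n] mult_pos_pos[OF c(1) clock_pos[OF assms, of n]] by linarith
  have "c < hold l n" if "1 < d (Clock l n)" for n
    using ge[of n] mult_strict_left_mono[OF that c(1)] by linarith
  then have "\<exists>\<^sub>\<infinity>n. c < hold l n"
    using frequently_mono[OF _ clock_recurrent[OF assms], of "\<lambda>n. c < hold l n"] by blast
  then show ?thesis
    using pos partial_sums_unbounded[OF _ c(1)] by (auto simp: holding_times_def less_imp_le)
qed

lemma clocks_level:
  assumes "l < k"
  shows "clocks (clock_set M l) (durations \<gamma> l (states l) d)"
proof
  show "clock_set M l \<noteq> {}" using M_pos[of "Suc l"] assms by (intro clock_set_nonempty) auto
  fix i assume i: "i \<in> clock_set M l"
  show "0 < durations \<gamma> l (states l) d i m" for m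
  proof (cases "i = 0")
    case True
    then have "l \<in> {1..k}" using i assms by (cases "l = 0") auto
    with holding_times_hold[of l] True show ?thesis by (simp add: durations_def hold_def holding_times_def)
  next
    case False
    then show ?thesis using gap_pos[of "Suc l" i] assms by (simp add: durations_def)
  qed
  show "\<exists>m. b < ring_time (durations \<gamma> l (states l) d) i m" for b
  proof (cases "i = 0")
    case True
    then have "l \<in> {1..k}" using i assms by (cases "l = 0") auto
    with holding_times_hold[of l] True show ?thesis
      by (simp add: durations_def hold_def holding_times_def ring_time_def)
  next
    case False
    have "\<exists>n. b < (\<Sum>m<n. d (Gap (Suc l) i m))"
      using gap_recurrent[of "Suc l" i] gap_pos[of "Suc l" i] assms False
      by (intro partial_sums_unbounded[where c = 1]) (auto intro: less_imp_le)
    then show ?thesis using False by (simp add: durations_def ring_time_def)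
  qed
qed (use no_ties[OF assms] in auto)


text \<open>
  The atoms of the measure of level \<open>l + 1\<close> in increasing order.  For \<open>l \<ge> 1\<close> they comprise, apart from
  the rings, the starting point \<open>0\<close> of the first sojourn of level \<open>l\<close>.
\<close>

definition atom_at :: "nat \<Rightarrow> nat \<Rightarrow> real" where
  "atom_at l n = (let \<tau> = atom (clock_set M l) (durations \<gamma> l (states l) d) in
     if l = 0 then \<tau> n else if n = 0 then 0 else \<tau> (n - 1))"

lemma atom_at_props:
  assumes "l < k"
  shows "strict_mono (atom_at l)" "0 \<le> atom_at l 0" "\<exists>n. b < atom_at l n"
proof -
  interpret clocks "clock_set M l" "durations \<gamma> l (states l) d" by (rule clocks_level[OF assms])
  show "strict_mono (atom_at l)"
  proof (intro strict_monoI_Suc)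
    fix n
    have "\<tau> n < \<tau> (Suc n)" "n \<noteq> 0 \<Longrightarrow> \<tau> (n - 1) < \<tau> n"
      by (simp_all add: strict_mono_less[OF strict_mono_atom])
    then show "atom_at l n < atom_at l (Suc n)"
      using atom_pos[of n] unfolding atom_at_def Let_def
      by (cases "n = 0"; cases "l = 0") (simp_all only: if_True if_False diff_Suc_1 nat.distinct simp_thms)
  qed
  show "0 \<le> atom_at l 0" using atom_pos[of 0] by (auto simp: atom_at_def Let_def)
  obtain n where "b < \<tau> n" using atom_unbounded by blast
  then have "b < atom_at l (if l = 0 then n else Suc n)" by (auto simp: atom_at_def Let_def)
  then show "\<exists>n. b < atom_at l n" by blast
qed

lemma ring_time_gap: "l < k \<Longrightarrow> 1 \<le> x \<Longrightarrow> ring_time (durations \<gamma> l C d) x m = \<sigma> (Suc l) x m"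
  using \<sigma>[of "Suc l" x m] by (simp add: ring_time_def durations_def)

lemma ring_time_clock: "ring_time (durations \<gamma> l (states l) d) 0 m = (\<Sum>n<m. hold l n)"
  by (simp add: ring_time_def durations_def hold_def)

lemma mark_set_eq:
  assumes "l < k"
  shows "mark_set M \<sigma> (Suc l) = {ring_time (durations \<gamma> l (states l) d) x (Suc m) | x m. x \<in> {1..M (Suc l)}}"
    (is "?A = ?B")
proof (intro equalityI subsetI)
  fix s assume "s \<in> ?A"
  then obtain x i where *: "s = \<sigma> (Suc l) x i" "x \<in> {1..M (Suc l)}" "1 \<le> i"
    by (auto simp: mark_set_def)
  moreover obtain m where "i = Suc m" using * by (cases i) auto
  ultimately have "s = ring_time (durations \<gamma> l (states l) d) x (Suc m)"
    using ring_time_gap[OF assms, of x "states l" i] by auto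
  with * show "s \<in> ?B" by blast
next
  fix s assume "s \<in> ?B"
  then obtain x m where *: "s = ring_time (durations \<gamma> l (states l) d) x (Suc m)" "x \<in> {1..M (Suc l)}"
    by blast
  then have "s = \<sigma> (Suc l) x (Suc m)" using ring_time_gap[OF assms, of x "states l" "Suc m"] by auto
  with * show "s \<in> ?A" unfolding mark_set_def by force
qed

lemma label_of_mark:
  assumes l: "l < k" and x: "x \<in> {1..M (Suc l)}"
    and s: "s = ring_time (durations \<gamma> l (states l) d) x (Suc m)"
  shows "label M \<sigma> U (Suc l) R s = x"
proof -
  interpret clocks "clock_set M l" "durations \<gamma> l (states l) d" by (rule clocks_level[OF l])
  have mem: "y \<in> clock_set M l" if "y \<in> {1..M (Suc l)}" for y
    using that by (cases "l = 0") auto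
  have "(LEAST y. y \<in> {1..M (Suc l)} \<and> (\<exists>i\<ge>1. s = \<sigma> (Suc l) y i)) = x"
  proof (rule Least_equality)
    show "x \<in> {1..M (Suc l)} \<and> (\<exists>i\<ge>1. s = \<sigma> (Suc l) x i)"
      using s x ring_time_gap[OF l, of x "states l" "Suc m"] by (auto intro!: exI[of _ "Suc m"])
    fix y assume y: "y \<in> {1..M (Suc l)} \<and> (\<exists>i\<ge>1. s = \<sigma> (Suc l) y i)"
    then obtain i where "i \<ge> 1" "s = \<sigma> (Suc l) y i" by blast
    moreover obtain m' where "i = Suc m'" using \<open>i \<ge> 1\<close> by (cases i) auto
    ultimately have "s = ring_time (durations \<gamma> l (states l) d) y (Suc m')"
      using ring_time_gap[OF l, of y "states l" i] y by auto
    then have "x = y" using ring_time_inj[OF mem mem, of x y m m'] x y s by auto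
    then show "x \<le> y" by simp
  qed
  moreover have "s \<in> mark_set M \<sigma> (Suc l)" using mark_set_eq[OF l] s x by blast
  ultimately show ?thesis by (simp add: label_def)
qed

lemma first_level:
  assumes "0 < k"
  shows "mark_set M \<sigma> 1 = range (atom_at 0)"
    and "[label M \<sigma> U 1 R (atom_at 0 n)] = states 1 n"
proof -
  interpret clocks "clock_set M 0" "durations \<gamma> 0 (states 0) d" by (rule clocks_level[OF assms])
  have a: "atom_at 0 = \<tau>" by (auto simp: atom_at_def Let_def)
  show "mark_set M \<sigma> 1 = range (atom_at 0)"
    unfolding a range_atom using mark_set_eq[OF assms] by simp
  have mem: "w n \<in> {1..M 1}" using w_mem[of n] by simp
  have "label M \<sigma> U (Suc 0) R (\<tau> n) = w n"
    using mem by (intro label_of_mark[OF assms _ atom_eq]) simp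
  with mem show "[label M \<sigma> U 1 R (atom_at 0 n)] = states 1 n"
    by (simp add: a Let_def)
qed

text \<open>
  Up to the \<open>n\<close>-th atom clock \<open>0\<close> has rung as often as level \<open>l\<close> has jumped, so the number of its rings
  tells the current state of level \<open>l\<close>.  The same number is the rank of the atom among the starting
  points of sojourns when the atom is such a point, and selects the right refresh variable.
\<close>

lemma higher_level:
  assumes l: "l < k" "1 \<le> l" and Y: "inj Y"
    and XY: "\<And>t. 0 \<le> t \<Longrightarrow> XY l t = (states l (sojourn (hold l) t), Y (sojourn (hold l) t))"
  defines "R \<equiv> refresh_set (Suc l) (XY l)"
  shows "mark_set M \<sigma> (Suc l) \<union> R = range (atom_at l)"
    and "fst (XY l (atom_at l n)) @ [label M \<sigma> U (Suc l) R (atom_at l n)] = states (Suc l) n"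
proof -
  let ?D = "durations \<gamma> l (states l) d"
  interpret clocks "clock_set M l" ?D by (rule clocks_level[OF l(1)])
  have h: "holding_times (hold l)" using l by (intro holding_times_hold) auto
  have "inj (\<lambda>n. (states l n, Y n))" using Y by (auto simp: inj_def)
  then have "R = range (\<lambda>n. \<Sum>m<n. hold l m)"
    unfolding R_def refresh_set_def using l XY by (simp add: left_ends_of_constancy_intervals[OF h])
  then have R: "R = range (ring_time ?D 0)" by (simp add: ring_time_clock)
  have a0: "atom_at l 0 = 0" and aSuc: "atom_at l (Suc q) = \<tau> q" for q
    using l by (auto simp: atom_at_def Let_def)
  have zero: "0 \<in> clock_set M l" using l by simp
  have split: "{ring_time ?D i (Suc m) | i m. i \<in> clock_set M l}
      = {ring_time ?D x (Suc m) | x m. x \<in> {1..M (Suc l)}} \<union> range (\<lambda>m. ring_time ?D 0 (Suc m))"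
    (is "?L = ?M \<union> ?C")
  proof (intro equalityI subsetI)
    fix s assume "s \<in> ?L"
    then obtain i m where "s = ring_time ?D i (Suc m)" "i \<in> clock_set M l" by blast
    then show "s \<in> ?M \<union> ?C" using l by (cases "i = 0") auto
  next
    fix s assume "s \<in> ?M \<union> ?C"
    then show "s \<in> ?L"
    proof
      assume "s \<in> ?M"
      then obtain x m where "s = ring_time ?D x (Suc m)" "x \<in> {1..M (Suc l)}" by blast
      moreover from this have "x \<in> clock_set M l" using l by simp
      ultimately show ?thesis by blast
    qed (use zero in blast)
  qed
  have range_a: "range (atom_at l) = insert 0 (range \<tau>)"
    by (subst UNIV_nat_eq) (simp add: image_image a0 aSuc)
  have range_0: "range (ring_time ?D 0) = insert 0 (range (\<lambda>m. ring_time ?D 0 (Suc m)))"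
    by (subst UNIV_nat_eq) (simp only: image_insert image_image ring_time_0)
  show "mark_set M \<sigma> (Suc l) \<union> R = range (atom_at l)"
    unfolding range_a range_atom split R mark_set_eq[OF l(1)] range_0 by simp
  have rank: "rank R (ring_time ?D 0 m) = m" for m
    unfolding R using zero ring_time_strict_mono by (intro rank_range strict_monoI)
  \<comment> \<open>rings of different clocks are not simultaneous, so starting points of sojourns are
    labelled by refresh variables\<close>
  have not_mark: "ring_time ?D 0 m \<notin> mark_set M \<sigma> (Suc l)" for m
  proof
    assume "ring_time ?D 0 m \<in> mark_set M \<sigma> (Suc l)"
    then obtain x m' where x: "x \<in> {1..M (Suc l)}" "ring_time ?D 0 m = ring_time ?D x (Suc m')"
      unfolding mark_set_eq[OF l(1)] by blast
    have xI: "x \<in> clock_set M l" using x l by simp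
    show False
    proof (cases m)
      case 0
      then show False using x ring_time_strict_mono[OF xI, of 0 "Suc m'"] by simp
    next
      case (Suc q)
      then show False using x ring_time_inj[OF zero xI, of q m'] by simp
    qed
  qed
  have label_clock: "label M \<sigma> U (Suc l) R (ring_time ?D 0 m) = U (Suc l) m" for m
    using not_mark by (simp add: label_def rank)
  have Ref: "nat \<lfloor>d (Refresh (Suc l) m)\<rfloor> = U (Suc l) m" for m
    using l by (intro Refresh_eq) auto
  have index: "sojourn (hold l) (atom_at l n) = N n 0"
  proof (rule sojourn_eqI[OF h])
    show "(\<Sum>m<N n 0. hold l m) \<le> atom_at l n"
      using ring_le_atom[OF zero] by (cases n) (simp_all add: a0 aSuc ring_time_clock del: ring_order.simps(2))
    show "atom_at l n < (\<Sum>m<Suc (N n 0). hold l m)"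
    proof (cases n)
      case 0
      then show ?thesis using h by (simp add: a0 holding_times_def)
    next
      case (Suc q)
      then show ?thesis using atom_less_ring[OF zero, of q]
        by (simp only: aSuc ring_time_clock)
    qed
  qed
  have nonneg: "0 \<le> atom_at l n"
    using atom_at_props(1,2)[OF l(1)] strict_mono_less_eq[of "atom_at l" 0 n] by simp
  have fst: "fst (XY l (atom_at l n)) = states l (N n 0)"
    using XY[OF nonneg] index by simp
  have lab: "label M \<sigma> U (Suc l) R (atom_at l n)
      = (if W n = [] \<or> last (W n) = 0 then U (Suc l) (N n 0) else last (W n))"
  proof (cases n)
    case 0
    then show ?thesis using label_clock[of 0] by (simp add: a0)
  next
    case (Suc q)
    show ?thesis
    proof (cases "w q = 0")
      case True
      then have "\<tau> q = ring_time ?D 0 (N n 0)" using atom_eq[of q] Suc by simp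
      then show ?thesis using True Suc label_clock by (simp add: aSuc)
    next
      case False
      then have "w q \<in> {1..M (Suc l)}" using w_mem[of q] l by auto
      then have "label M \<sigma> U (Suc l) R (\<tau> q) = w q"
        by (rule label_of_mark[OF l(1) _ atom_eq])
      then show ?thesis using False Suc by (simp add: aSuc)
    qed
  qed
  show "fst (XY l (atom_at l n)) @ [label M \<sigma> U (Suc l) R (atom_at l n)] = states (Suc l) n"
    unfolding fst lab using l by (simp add: Let_def Ref)
qed

text \<open>
  The second component of the path records the position of the current atom and is therefore
  injective in the index of the sojourn.  This is what identifies the constancy intervals on the
  next level even when a jump leaves the state unchanged.
\<close>

lemma marks_path_Suc:
  assumes "l < k" and A: "mark_set M \<sigma> (Suc l) \<union> refresh_set (Suc l) (XY l) = range (atom_at l)"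
    and st: "\<And>n. fst (XY l (atom_at l n)) @
      [label M \<sigma> U (Suc l) (refresh_set (Suc l) (XY l)) (atom_at l n)] = states (Suc l) n"
  shows "\<exists>Y. inj Y \<and> (\<forall>t\<ge>0. XY (Suc l) t = (states (Suc l) (sojourn (hold (Suc l)) t), Y (sojourn (hold (Suc l)) t)))"
proof -
  note a = atom_at_props[OF assms(1)]
  let ?\<xi> = "label M \<sigma> U (Suc l) (refresh_set (Suc l) (XY l))"
  let ?w = "\<lambda>s. \<gamma> (Suc l) (fst (XY l s) @ [?\<xi> s]) * T (Suc l) (rank (range (atom_at l)) s)"
  let ?Y = "\<lambda>n. snd (XY l (atom_at l n)) @ [atom_at l n]"
  have h: "holding_times (hold (Suc l))" using assms(1) by (intro holding_times_hold) auto
  have w: "?w (atom_at l n) = hold (Suc l) n" for n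
    using assms(1) by (simp add: st rank_range[OF a(1)] hold_def T del: chain.simps)
  have inv: "right_inverse (atomic_measure (range (atom_at l)) ?w) t = atom_at l (sojourn (hold (Suc l)) t)"
    if "0 \<le> t" for t
    by (rule right_inverse_atomic_measure[OF a h w that])
  have "inj ?Y" using a(1) by (auto simp: inj_def strict_mono_eq)
  moreover have "XY (Suc l) t = (states (Suc l) (sojourn (hold (Suc l)) t), ?Y (sojourn (hold (Suc l)) t))"
    if "0 \<le> t" for t
    by (simp only: marks_path.simps Let_def A inv[OF that] st)
  ultimately show ?thesis by blast
qed

lemma marks_path_eq:
  assumes "l \<in> {1..k}"
  shows "\<exists>Y. inj Y \<and> (\<forall>t\<ge>0. XY l t = (states l (sojourn (hold l) t), Y (sojourn (hold l) t)))"
  using assms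
proof (induction l)
  case (Suc l)
  show ?case
  proof (cases "l = 0")
    case True
    have "refresh_set 1 (XY 0) = {}" by (simp add: refresh_set_def)
    then show ?thesis
      using marks_path_Suc[of 0] first_level Suc.prems True by (simp del: chain.simps(2))
  next
    case False
    then obtain Y where "inj Y" "\<And>t. 0 \<le> t \<Longrightarrow> XY l t = (states l (sojourn (hold l) t), Y (sojourn (hold l) t))"
      using Suc by force
    then show ?thesis
      using higher_level[of l Y] Suc.prems False by (intro marks_path_Suc) auto
  qed
qed simp

theorem marks_path_is_jump_path:
  assumes "1 \<le> k" "0 \<le> t"
  shows "fst (XY k t) = jump_path (states k) (\<lambda>n. \<gamma> k (states k n) * d (Clock k n)) t"
proof -
  have "fst (XY k t) = states k (sojourn (hold k) t)"
    using marks_path_eq[of k] assms by force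
  then show ?thesis by (simp add: jump_path_eq hold_def[abs_def])
qed

end

section \<open>Lack of memory of independent exponential clocks\<close>

abbreviation exp_measure :: "real \<Rightarrow> real measure" where
  "exp_measure l \<equiv> density lborel (exponential_density l)"

lemma prob_space_exp_measure: "0 < l \<Longrightarrow> prob_space (exp_measure l)"
  by (rule prob_space_exponential_density)

text \<open>
  Lack of memory as an identity of measures: conditioned on being larger than \<open>s\<close>, the excess over
  \<open>s\<close> is again exponential.
\<close>

lemma exp_measure_memoryless:
  assumes l: "0 < l" and s: "0 \<le> s" and A[measurable]: "A \<in> sets borel"
  shows "emeasure (exp_measure l) {v. s < v \<and> v - s \<in> A} = ennreal (exp (- (s * l))) * emeasure (exp_measure l) A"
proof -
  let ?g = "\<lambda>v. ennreal (exponential_density l v) * indicator {v. s < v \<and> v - s \<in> A} v"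
  have [measurable]: "{v. s < v \<and> v - s \<in> A} \<in> sets borel"
  proof -
    have "{v. s < v \<and> v - s \<in> A} = {s<..} \<inter> (\<lambda>v. v - s) -` A" by auto
    moreover have "(\<lambda>v. v - s) -` A \<in> sets borel"
      using measurable_sets[of "\<lambda>v. v - s" borel borel A] by simp
    ultimately show ?thesis by simp
  qed
  have "emeasure (exp_measure l) {v. s < v \<and> v - s \<in> A} = (\<integral>\<^sup>+v. ?g v \<partial>lborel)"
    by (subst emeasure_density) auto
  also have "\<dots> = (\<integral>\<^sup>+u. ?g (s + 1 * u) \<partial>lborel)"
    by (subst nn_integral_real_affine[where c = 1 and t = s]) auto
  also have "\<dots> = (\<integral>\<^sup>+u. ennreal (exp (- (s * l))) * (ennreal (exponential_density l u) * indicator A u) \<partial>lborel)"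
  proof (rule nn_integral_cong_AE, use AE_lborel_singleton[of 0] in eventually_elim)
    fix u :: real assume "u \<noteq> 0"
    show "?g (s + 1 * u) = ennreal (exp (- (s * l))) * (ennreal (exponential_density l u) * indicator A u)"
    proof (cases "u > 0")
      case True
      then have "exponential_density l (s + u) = exp (- (s * l)) * exponential_density l u"
        using s by (simp add: exponential_density_def algebra_simps flip: exp_add)
      with True show ?thesis
        by (auto simp: indicator_def ennreal_mult' simp del: erlang_density_def)
    next
      case False
      with \<open>u \<noteq> 0\<close> show ?thesis by (simp add: indicator_def exponential_density_def)
    qed
  qed
  also have "\<dots> = ennreal (exp (- (s * l))) * emeasure (exp_measure l) A"
    by (subst nn_integral_cmult) (auto simp: emeasure_density)
  finally show ?thesis .
qed

lemma AE_exp_measure_nonneg: "AE s in exp_measure l. 0 \<le> s"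
  by (auto simp: AE_density exponential_density_def)

lemma nn_integral_exp_measure_exp:
  assumes "0 < l" "0 \<le> R"
  shows "(\<integral>\<^sup>+s. ennreal (exp (- (s * R))) \<partial>exp_measure l) = ennreal (l / (l + R))"
proof -
  interpret prob_space "exp_measure (l + R)" using assms by (intro prob_space_exp_measure) auto
  have "(\<integral>\<^sup>+s. ennreal (exp (- (s * R))) \<partial>exp_measure l)
      = (\<integral>\<^sup>+s. ennreal (exponential_density l s) * ennreal (exp (- (s * R))) \<partial>lborel)"
    by (subst nn_integral_density) auto
  also have "\<dots> = (\<integral>\<^sup>+s. ennreal (l / (l + R)) * ennreal (exponential_density (l + R) s) \<partial>lborel)"
  proof (rule nn_integral_cong)
    fix s :: real
    have "exponential_density l s * exp (- (s * R)) = l / (l + R) * exponential_density (l + R) s"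
    proof -
      have "l / (l + R) * ((l + R) * e) = l * e" for e using assms by simp
      then show ?thesis
        by (simp add: exponential_density_def distrib_left mult.assoc flip: exp_add)
    qed
    moreover have "0 \<le> exponential_density l s" "0 \<le> l / (l + R)"
      using assms by (auto intro: exponential_density_nonneg)
    ultimately show "ennreal (exponential_density l s) * ennreal (exp (- (s * R)))
        = ennreal (l / (l + R)) * ennreal (exponential_density (l + R) s)"
      by (metis ennreal_mult')
  qed
  also have "\<dots> = ennreal (l / (l + R)) * emeasure (exp_measure (l + R)) UNIV"
    by (subst nn_integral_cmult) (auto simp: emeasure_density)
  also have "emeasure (exp_measure (l + R)) UNIV = 1" using emeasure_space_1 by simp
  finally show ?thesis by simp
qed

text \<open>
  Shifts the origin of time to the first ring, which is supposed to be that of clock \<open>i\<close>: this clock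
  proceeds to its next spacing, the others have used up a part of their current one.
\<close>

definition restart :: "nat set \<Rightarrow> nat \<Rightarrow> (nat \<times> nat \<Rightarrow> real) \<Rightarrow> nat \<times> nat \<Rightarrow> real" where
  "restart I i E = (\<lambda>(j, m)\<in>I \<times> UNIV.
     if j = i then E (i, Suc m) else if m = 0 then E (j, 0) - E (i, 0) else E (j, m))"

definition clock_measure :: "nat set \<Rightarrow> (nat \<Rightarrow> nat \<Rightarrow> real) \<Rightarrow> (nat \<times> nat \<Rightarrow> real) measure" where
  "clock_measure I r = (\<Pi>\<^sub>M k\<in>I \<times> UNIV. exp_measure (case k of (j, m) \<Rightarrow> r j m))"

definition rate_after_ring :: "nat \<Rightarrow> (nat \<Rightarrow> nat \<Rightarrow> real) \<Rightarrow> nat \<Rightarrow> nat \<Rightarrow> real" where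
  "rate_after_ring i r j m = (if j = i then r j (Suc m) else r j m)"

text \<open>
  If clock \<open>i\<close> rings first, the restarted clocks are independent and exponential again, and
  independent of the event that clock \<open>i\<close> came first.  Given that clock \<open>i\<close> rings at time \<open>s\<close>, the
  others have probability \<open>exp (- s R)\<close> of ringing later, where \<open>R\<close> is the sum of their rates, and by lack
  of memory what is left of them is distributed as at the start.  Integrating over \<open>s\<close> gives
  \<open>r i 0 / (r i 0 + R)\<close>.
\<close>

lemma regeneration:
  assumes I: "finite I" "i \<in> I" and r: "\<And>j m. 0 < r j m"
    and B: "B \<in> sets (clock_measure I (rate_after_ring i r))"
  shows "emeasure (clock_measure I r)
      {E \<in> space (clock_measure I r). (\<forall>j\<in>I - {i}. E (i, 0) < E (j, 0)) \<and> restart I i E \<in> B}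
    = ennreal (r i 0 / (\<Sum>j\<in>I. r j 0)) * emeasure (clock_measure I (rate_after_ring i r)) B"
proof -
  let ?K = "I \<times> (UNIV :: nat set)"
  let ?X = "\<lambda>k. exp_measure (case k of (j, m) \<Rightarrow> r j m)"
  let ?X' = "\<lambda>k. exp_measure (case k of (j, m) \<Rightarrow> rate_after_ring i r j m)"
  define \<mu> where "\<mu> = clock_measure I r"
  define \<mu>' where "\<mu>' = clock_measure I (rate_after_ring i r)"
  define c where "c = r i 0 / (\<Sum>j\<in>I. r j 0)"
  define S where "S = {E \<in> space \<mu>. \<forall>j\<in>I - {i}. E (i, 0) < E (j, 0)}"
  define R where "R = (\<Sum>j\<in>I - {i}. r j 0)"
  have r': "0 < rate_after_ring i r j m" for j m using r by (simp add: rate_after_ring_def)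
  interpret X: product_prob_space ?X ?K
    by (intro product_prob_spaceI prob_space_exp_measure) (auto simp: r)
  interpret X': product_prob_space ?X' ?K
    by (intro product_prob_spaceI prob_space_exp_measure) (auto simp: r')
  have sets_mu [measurable_cong]: "sets \<mu> = sets (\<Pi>\<^sub>M k\<in>?K. borel)" "sets \<mu>' = sets (\<Pi>\<^sub>M k\<in>?K. borel)"
    unfolding \<mu>_def \<mu>'_def clock_measure_def by (auto intro!: sets_PiM_cong)
  have restart_meas [measurable]: "restart I i \<in> \<mu> \<rightarrow>\<^sub>M (\<Pi>\<^sub>M k\<in>?K. borel)"
    unfolding restart_def
  proof (rule measurable_restrict)
    fix k assume "k \<in> ?K"
    then obtain j m where k: "k = (j, m)" "j \<in> I" by auto
    have [measurable]: "(\<lambda>E. E (j', m')) \<in> borel_measurable \<mu>" if "j' \<in> I" for j' m'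
      using that by (subst measurable_cong_sets[OF sets_mu(1) refl]) (auto intro!: measurable_component_singleton)
    show "(\<lambda>E. case k of (j, m) \<Rightarrow> if j = i then E (i, Suc m) else if m = 0 then E (j, 0) - E (i, 0) else E (j, m))
        \<in> borel_measurable \<mu>"
      using I k by auto
  qed
  have comp [measurable]: "(\<lambda>E. E (j', m')) \<in> borel_measurable \<mu>" if "j' \<in> I" for j' m'
    using that by (subst measurable_cong_sets[OF sets_mu(1) refl]) (auto intro!: measurable_component_singleton)
  have S [measurable]: "S \<in> sets \<mu>"
    unfolding S_def using I
    by (intro sets.sets_Collect_finite_All borel_measurable_less comp) auto
  define \<nu> where "\<nu> = distr (density \<mu> (indicator S)) (\<Pi>\<^sub>M k\<in>?K. borel) (restart I i)"
  have \<nu>: "emeasure \<nu> A = emeasure \<mu> {E \<in> space \<mu>. (\<forall>j\<in>I - {i}. E (i, 0) < E (j, 0)) \<and> restart I i E \<in> A}"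
    if A: "A \<in> sets (\<Pi>\<^sub>M k\<in>?K. borel)" for A
  proof -
    have "restart I i -` A \<inter> space \<mu> \<in> sets \<mu>" using measurable_sets[OF restart_meas A] .
    then have "emeasure \<nu> A = emeasure \<mu> (S \<inter> (restart I i -` A \<inter> space \<mu>))"
      using A unfolding \<nu>_def
      by (subst emeasure_distr) (auto simp: emeasure_restricted)
    also have "S \<inter> (restart I i -` A \<inter> space \<mu>) =
        {E \<in> space \<mu>. (\<forall>j\<in>I - {i}. E (i, 0) < E (j, 0)) \<and> restart I i E \<in> A}"
      by (auto simp: S_def)
    finally show ?thesis .
  qed
  have "scale_measure (ennreal c) \<mu>' = \<nu>"
  proof (rule measure_eqI_PiM_infinite[where I = ?K and M = "\<lambda>_. borel"])
    show "finite_measure (scale_measure (ennreal c) \<mu>')"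
      by (rule finite_measureI)
        (simp add: \<mu>'_def clock_measure_def space_scale_measure X'.emeasure_space_1)
    fix A J assume J: "finite J" "J \<subseteq> ?K" and A: "\<And>k. k \<in> J \<Longrightarrow> A k \<in> sets (borel :: real measure)"
    \<comment> \<open>the first coordinates of all clocks are added, since they occur in the condition that
      clock \<open>i\<close> rings first\<close>
    define A' where "A' k = (if k \<in> J then A k else UNIV)" for k
    define J' where "J' = J \<union> I \<times> {0}"
    have J': "finite J'" "J' \<subseteq> ?K" and A' [measurable]: "A' k \<in> sets borel" for k
      using J I A by (auto simp: J'_def A'_def)
    have emb: "prod_emb ?K (\<lambda>_. borel) J (Pi\<^sub>E J A) = {E \<in> extensional ?K. \<forall>k\<in>J'. E k \<in> A' k}"
    proof (rule set_eqI)
      fix E :: "nat \<times> nat \<Rightarrow> real"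
      have "E \<in> prod_emb ?K (\<lambda>_. borel) J (Pi\<^sub>E J A) \<longleftrightarrow> E \<in> extensional ?K \<and> (\<forall>k\<in>J. E k \<in> A k)"
        by (simp add: prod_emb_def space_PiM PiE_iff) blast
      moreover have "(\<forall>k\<in>J. E k \<in> A k) \<longleftrightarrow> (\<forall>k\<in>J'. E k \<in> A' k)"
        by (auto simp: A'_def J'_def)
      ultimately show "E \<in> prod_emb ?K (\<lambda>_. borel) J (Pi\<^sub>E J A)
          \<longleftrightarrow> E \<in> {E \<in> extensional ?K. \<forall>k\<in>J'. E k \<in> A' k}"
        by simp
    qed
    have 1: "emeasure \<mu>' (prod_emb ?K (\<lambda>_. borel) J (Pi\<^sub>E J A)) = (\<Prod>k\<in>J'. emeasure (?X' k) (A' k))"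
    proof -
      have "emeasure \<mu>' (prod_emb ?K (\<lambda>_. borel) J (Pi\<^sub>E J A))
          = emeasure (PiM ?K ?X') {E \<in> space (PiM ?K ?X'). \<forall>k\<in>J'. E k \<in> A' k}"
        unfolding emb \<mu>'_def clock_measure_def by (simp add: space_PiM PiE_def)
      also have "\<dots> = (\<Prod>k\<in>J'. emeasure (?X' k) (A' k))"
        using J' by (intro X'.emeasure_PiM_Collect) auto
      finally show ?thesis .
    qed
    \<comment> \<open>the coordinate of the original sample from which coordinate \<open>k\<close> of the restarted sample
      is made; the spacing \<open>(i, 0)\<close> of the first ring is left out\<close>
    define g where "g k = (case k of (j, m) \<Rightarrow> if j = i then (i, Suc m) else (j, m))" for k :: "nat \<times> nat"
    have inj: "inj g" by (auto simp: inj_def g_def split: if_splits)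
    define K' where "K' = ?K - {(i, 0)}"
    have K: "?K = insert (i, 0) K'" using I by (auto simp: K'_def)
    have gK: "g k \<in> K'" if "k \<in> ?K" for k using that I by (auto simp: g_def K'_def split: if_splits)
    have rg: "?X (g k) = ?X' k" for k by (auto simp: g_def rate_after_ring_def split: prod.split)
    \<comment> \<open>the condition on that coordinate when the first ring happens at time \<open>s\<close>\<close>
    define C where "C s k = (if fst k \<noteq> i \<and> snd k = 0 then {v. s < v \<and> v - s \<in> A' k} else A' k)"
      for s :: real and k :: "nat \<times> nat"
    have event: "(\<forall>j\<in>I - {i}. E (i, 0) < E (j, 0)) \<and> restart I i E \<in> prod_emb ?K (\<lambda>_. borel) J (Pi\<^sub>E J A)
        \<longleftrightarrow> (\<forall>k\<in>J'. E (g k) \<in> C (E (i, 0)) k)" for E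
    proof -
      have "restart I i E \<in> extensional ?K" by (simp add: restart_def)
      then have "?thesis \<longleftrightarrow> (((\<forall>j\<in>I - {i}. E (i, 0) < E (j, 0)) \<and> (\<forall>k\<in>J'. restart I i E k \<in> A' k))
        \<longleftrightarrow> (\<forall>k\<in>J'. E (g k) \<in> C (E (i, 0)) k))"
        unfolding emb by simp
      also have "\<dots>"
      proof
        assume *: "(\<forall>j\<in>I - {i}. E (i, 0) < E (j, 0)) \<and> (\<forall>k\<in>J'. restart I i E k \<in> A' k)"
        show "\<forall>k\<in>J'. E (g k) \<in> C (E (i, 0)) k"
        proof
          fix k assume k: "k \<in> J'"
          then obtain j m where "k = (j, m)" "j \<in> I" using J' by auto
          then show "E (g k) \<in> C (E (i, 0)) k"
            using * bspec[OF conjunct2[OF *] k] by (auto simp: restart_def g_def C_def split: if_splits)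
        qed
      next
        assume *: "\<forall>k\<in>J'. E (g k) \<in> C (E (i, 0)) k"
        show "(\<forall>j\<in>I - {i}. E (i, 0) < E (j, 0)) \<and> (\<forall>k\<in>J'. restart I i E k \<in> A' k)"
        proof (intro conjI ballI)
          fix j assume "j \<in> I - {i}"
          then show "E (i, 0) < E (j, 0)"
            using bspec[OF *, of "(j, 0)"] by (auto simp: J'_def g_def C_def)
        next
          fix k assume k: "k \<in> J'"
          then obtain j m where "k = (j, m)" "j \<in> I" using J' by auto
          then show "restart I i E k \<in> A' k"
            using bspec[OF * k] by (auto simp: restart_def g_def C_def split: if_splits)
        qed
      qed
      finally show ?thesis by simp
    qed
    have C_meas: "C s k \<in> sets borel" for s k
    proof -
      have "{v. s < v \<and> v - s \<in> A' k} = {s<..} \<inter> (\<lambda>v. v - s) -` A' k" by auto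
      moreover have "(\<lambda>v. v - s) -` A' k \<in> sets borel"
        using measurable_sets[of "\<lambda>v. v - s" borel borel "A' k"] by simp
      ultimately show ?thesis by (simp add: C_def)
    qed
    let ?Ev = "{E \<in> space (PiM ?K ?X). \<forall>k\<in>J'. E (g k) \<in> C (E (i, 0)) k}"
    have Ev: "?Ev \<in> sets (PiM ?K ?X)"
    proof -
      have [measurable]: "(\<lambda>E. E (j', m')) \<in> borel_measurable (PiM ?K ?X)" if "j' \<in> I" for j' m'
        using comp[OF that] unfolding \<mu>_def clock_measure_def .
      have "{E \<in> space (PiM ?K ?X). E (g k) \<in> C (E (i, 0)) k} \<in> sets (PiM ?K ?X)" if k: "k \<in> J'" for k
      proof -
        obtain j m where jm: "k = (j, m)" "j \<in> I" using k J' by auto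
        show ?thesis
          using I jm unfolding g_def C_def by (cases "j = i"; cases "m = 0"; simp; measurable)
      qed
      then show ?thesis using J' by (intro sets.sets_Collect_finite_All) auto
    qed
    interpret K': prob_space "PiM K' ?X"
      by (intro prob_space_PiM prob_space_exp_measure) (auto simp: r)
    have upd: "(\<lambda>(x, X). X((i, 0) := x)) \<in> ?X (i, 0) \<Otimes>\<^sub>M PiM K' ?X \<rightarrow>\<^sub>M PiM (insert (i, 0) K') ?X"
      by measurable
    have "emeasure \<nu> (prod_emb ?K (\<lambda>_. borel) J (Pi\<^sub>E J A)) = emeasure (PiM ?K ?X) ?Ev"
      using J A by (subst \<nu>) (auto intro!: sets_PiM_I simp: event \<mu>_def clock_measure_def)
    also have "\<dots> = emeasure (distr (?X (i, 0) \<Otimes>\<^sub>M PiM K' ?X) (PiM (insert (i, 0) K') ?X) (\<lambda>(x, X). X((i, 0) := x))) ?Ev"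
      unfolding K by (subst distr_pair_PiM_eq_PiM) (auto intro!: prob_space_exp_measure simp: r)
    also have "\<dots> = emeasure (?X (i, 0) \<Otimes>\<^sub>M PiM K' ?X)
        ((\<lambda>(x, X). X((i, 0) := x)) -` ?Ev \<inter> space (?X (i, 0) \<Otimes>\<^sub>M PiM K' ?X))"
      using Ev upd unfolding K by (intro emeasure_distr) auto
    also have "\<dots> = (\<integral>\<^sup>+s. emeasure (PiM K' ?X)
        (Pair s -` ((\<lambda>(x, X). X((i, 0) := x)) -` ?Ev \<inter> space (?X (i, 0) \<Otimes>\<^sub>M PiM K' ?X))) \<partial>?X (i, 0))"
      using Ev upd unfolding K by (intro K'.emeasure_pair_measure_alt measurable_sets[OF upd]) blast
    also have "\<dots> = (\<integral>\<^sup>+s. (\<Prod>k\<in>J'. emeasure (?X' k) (C s k)) \<partial>?X (i, 0))"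
    proof (rule nn_integral_cong)
      fix s :: real
      have "Pair s -` ((\<lambda>(x, X). X((i, 0) := x)) -` ?Ev \<inter> space (?X (i, 0) \<Otimes>\<^sub>M PiM K' ?X))
          = {X \<in> space (PiM K' ?X). \<forall>k\<in>J'. X (g k) \<in> C s k}" (is "?l = ?r")
      proof -
        have ne: "g k \<noteq> (i, 0)" if "k \<in> J'" for k using gK[of k] that J' by (auto simp: K'_def)
        have "X((i, 0) := s) \<in> space (PiM ?K ?X)" if "X \<in> space (PiM K' ?X)" for X
          using that unfolding K by (auto simp: space_PiM PiE_iff extensional_def)
        with ne show ?thesis by (auto simp: space_pair_measure)
      qed
      also have "\<dots> = {X \<in> space (PiM K' ?X). \<forall>k\<in>g ` J'. X k \<in> C s (the_inv g k)}"
        using inj by (simp add: the_inv_f_f)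
      also have "emeasure (PiM K' ?X) \<dots> = (\<Prod>k\<in>g ` J'. emeasure (?X k) (C s (the_inv g k)))"
      proof -
        interpret XK: product_prob_space ?X K'
          by (intro product_prob_spaceI prob_space_exp_measure) (auto simp: r)
        show ?thesis using J' gK C_meas by (intro XK.emeasure_PiM_Collect) auto
      qed
      also have "\<dots> = (\<Prod>k\<in>J'. emeasure (?X' k) (C s k))"
        using inj by (subst prod.reindex) (auto simp: the_inv_f_f rg inj_on_def inj_def)
      finally show "emeasure (PiM K' ?X) ?l = (\<Prod>k\<in>J'. emeasure (?X' k) (C s k))" .
    qed
    also have "\<dots> = (\<integral>\<^sup>+s. ennreal (exp (- (s * R))) * (\<Prod>k\<in>J'. emeasure (?X' k) (A' k)) \<partial>?X (i, 0))"
    proof (rule nn_integral_cong_AE)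
      have ae: "AE s in ?X (i, 0). 0 \<le> s" by (simp only: prod.case AE_exp_measure_nonneg)
      show "AE s in ?X (i, 0). (\<Prod>k\<in>J'. emeasure (?X' k) (C s k)) =
          ennreal (exp (- (s * R))) * (\<Prod>k\<in>J'. emeasure (?X' k) (A' k))"
        using ae
      proof eventually_elim
        fix s :: real assume s: "0 \<le> s"
        let ?e = "\<lambda>k. if fst k \<noteq> i \<and> snd k = 0 then ennreal (exp (- (s * r (fst k) 0))) else 1"
        have "(\<Prod>k\<in>J'. emeasure (?X' k) (C s k)) = (\<Prod>k\<in>J'. ?e k * emeasure (?X' k) (A' k))"
          using r s by (intro prod.cong) (auto simp: C_def rate_after_ring_def exp_measure_memoryless)
        also have "\<dots> = (\<Prod>k\<in>J'. ?e k) * (\<Prod>k\<in>J'. emeasure (?X' k) (A' k))"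
          by (rule prod.distrib)
        also have "(\<Prod>k\<in>J'. ?e k) = (\<Prod>k\<in>(I - {i}) \<times> {0::nat}. ennreal (exp (- (s * r (fst k) 0))))"
          using J' by (intro prod.mono_neutral_cong_right) (auto simp: J'_def)
        also have "\<dots> = (\<Prod>j\<in>I - {i}. ennreal (exp (- (s * r j 0))))"
          by (rule prod.reindex_bij_witness[of _ "\<lambda>j. (j, 0)" fst]) auto
        also have "\<dots> = ennreal (exp (- (s * R)))"
          using I by (simp add: prod_ennreal R_def exp_sum[symmetric] sum_distrib_left sum_negf)
        finally show "(\<Prod>k\<in>J'. emeasure (?X' k) (C s k)) =
          ennreal (exp (- (s * R))) * (\<Prod>k\<in>J'. emeasure (?X' k) (A' k))" .
      qed
    qed
    also have "\<dots> = ennreal (r i 0 / (r i 0 + R)) * (\<Prod>k\<in>J'. emeasure (?X' k) (A' k))"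
      using r by (subst nn_integral_multc) (auto simp: nn_integral_exp_measure_exp R_def sum_nonneg less_imp_le)
    also have "r i 0 / (r i 0 + R) = c"
      using I by (simp add: c_def R_def sum.remove)
    finally show "emeasure (scale_measure (ennreal c) \<mu>') (prod_emb ?K (\<lambda>_. borel) J (Pi\<^sub>E J A))
        = emeasure \<nu> (prod_emb ?K (\<lambda>_. borel) J (Pi\<^sub>E J A))"
      by (simp add: 1)
  qed (auto simp: sets_mu \<nu>_def)
  then have "emeasure \<nu> B = ennreal c * emeasure \<mu>' B"
    by (metis emeasure_scale_measure)
  with \<nu>[of B] B show ?thesis
    by (simp add: sets_mu \<mu>'_def[symmetric] \<mu>_def[symmetric] c_def)
qed

section \<open>The distribution of the ring order\<close>

text \<open>
  Probability that the clocks ring in the order \<open>ws\<close> when \<open>r j m\<close> is the rate of spacing \<open>m\<close> of clock \<open>j\<close>: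
  at each ring the clocks compete with the rates of their current spacings.
\<close>

definition order_prob :: "nat set \<Rightarrow> (nat \<Rightarrow> nat \<Rightarrow> real) \<Rightarrow> nat list \<Rightarrow> real" where
  "order_prob I r ws = (\<Prod>k<length ws. r (ws ! k) (count_list (take k ws) (ws ! k))
     / (\<Sum>j\<in>I. r j (count_list (take k ws) j)))"

lemma order_prob_Nil [simp]: "order_prob I r [] = 1"
  by (simp add: order_prob_def)

lemma order_prob_snoc:
  "order_prob I r (ws @ [i]) = order_prob I r ws * (r i (count_list ws i) / (\<Sum>j\<in>I. r j (count_list ws j)))"
  by (simp add: order_prob_def nth_append)

lemma order_prob_Cons:
  "order_prob I r (i # ws) = r i 0 / (\<Sum>j\<in>I. r j 0) * order_prob I (rate_after_ring i r) ws"
proof -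
  have "rate_after_ring i r j (count_list vs j) = r j (count_list (i # vs) j)" for j vs
    by (simp add: rate_after_ring_def)
  then show ?thesis
    unfolding order_prob_def list.size(4) add_Suc_right add_0_right prod.lessThan_Suc_shift
    by (simp del: count_list.simps(2))
qed

lemma order_prob_cong:
  assumes "set ws \<subseteq> I" "\<And>j m. j \<in> I \<Longrightarrow> m \<le> count_list ws j \<Longrightarrow> r j m = r' j m"
  shows "order_prob I r ws = order_prob I r' ws"
proof -
  have le: "count_list (take k ws) j \<le> count_list ws j" for k j
    by (metis append_take_drop_id count_list_append le_add1)
  have eq: "r j (count_list (take k ws) j) = r' j (count_list (take k ws) j)" if "j \<in> I" for j k
    using that le by (rule assms(2))
  show ?thesis unfolding order_prob_def
  proof (intro prod.cong refl)
    fix k assume "k \<in> {..<length ws}"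
    then have "ws ! k \<in> I" using assms(1) by auto
    with eq show "r (ws ! k) (count_list (take k ws) (ws ! k)) / (\<Sum>j\<in>I. r j (count_list (take k ws) j))
      = r' (ws ! k) (count_list (take k ws) (ws ! k)) / (\<Sum>j\<in>I. r' j (count_list (take k ws) j))"
      by simp
  qed
qed

lemma order_prob_nonneg: "(\<And>j m. 0 < r j m) \<Longrightarrow> 0 \<le> order_prob I r ws"
  unfolding order_prob_def by (intro prod_nonneg ballI divide_nonneg_nonneg sum_nonneg) (simp_all add: less_imp_le)

lemma sum_lists_snoc:
  "(\<Sum>vs | set vs \<subseteq> I \<and> length vs = Suc n. g vs) = (\<Sum>ws | set ws \<subseteq> I \<and> length ws = n. \<Sum>i\<in>I. g (ws @ [i]))"
proof -
  let ?L = "\<lambda>n. {ws. set ws \<subseteq> I \<and> length ws = n}"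
  have L: "?L (Suc n) = (\<lambda>(ws, i). ws @ [i]) ` (?L n \<times> I)"
  proof (intro equalityI subsetI)
    fix vs assume "vs \<in> ?L (Suc n)"
    then obtain ws i where "vs = ws @ [i]" "set ws \<subseteq> I" "length ws = n" "i \<in> I"
      by (cases vs rule: rev_cases) auto
    then show "vs \<in> (\<lambda>(ws, i). ws @ [i]) ` (?L n \<times> I)"
      by (intro image_eqI[of _ _ "(ws, i)"]) auto
  qed auto
  have "(\<Sum>vs\<in>?L (Suc n). g vs) = (\<Sum>(ws, i)\<in>?L n \<times> I. g (ws @ [i]))"
    unfolding L by (subst sum.reindex) (auto simp: inj_on_def intro!: sum.cong)
  then show ?thesis by (simp add: sum.cartesian_product)
qed

lemma sum_order_prob:
  assumes "finite I" "I \<noteq> {}" "\<And>j m. 0 < r j m"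
  shows "(\<Sum>ws | set ws \<subseteq> I \<and> length ws = n. order_prob I r ws) = 1"
proof (induction n)
  case 0
  have "{ws. set ws \<subseteq> I \<and> length ws = 0} = {[]}" by auto
  then show ?case by simp
next
  case (Suc n)
  let ?L = "\<lambda>n. {ws. set ws \<subseteq> I \<and> length ws = n}"
  have pos: "0 < (\<Sum>j\<in>I. r j (count_list ws j))" for ws
    using assms by (intro sum_pos) auto
  have "(\<Sum>vs\<in>?L (Suc n). order_prob I r vs) = (\<Sum>ws\<in>?L n. \<Sum>i\<in>I. order_prob I r (ws @ [i]))"
    by (rule sum_lists_snoc)
  also have "\<dots> = (\<Sum>ws\<in>?L n. order_prob I r ws)"
  proof (intro sum.cong refl)
    fix ws
    have "(\<Sum>i\<in>I. order_prob I r (ws @ [i]))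
        = order_prob I r ws * ((\<Sum>i\<in>I. r i (count_list ws i)) / (\<Sum>j\<in>I. r j (count_list ws j)))"
      by (simp only: order_prob_snoc sum_distrib_left[symmetric] sum_divide_distrib[symmetric])
    also have "\<dots> = order_prob I r ws" using pos[of ws] by simp
    finally show "(\<Sum>i\<in>I. order_prob I r (ws @ [i])) = order_prob I r ws" .
  qed
  finally show ?case using Suc by simp
qed

lemma rings_in_order_cong:
  assumes "\<And>j m. j \<in> I \<Longrightarrow> D j m = D' j m"
  shows "rings_in_order I D ws \<longleftrightarrow> rings_in_order I D' ws"
proof -
  have "ring_time D j m = ring_time D' j m" if "j \<in> I" for j m
    using assms that by (simp add: ring_time_def)
  then have *: "(i \<in> I \<and> (\<forall>j\<in>I - {i}. ring_time D i (f i) < ring_time D j (f j)))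
      = (i \<in> I \<and> (\<forall>j\<in>I - {i}. ring_time D' i (f i) < ring_time D' j (f j)))" for i f
    by auto
  show ?thesis
    unfolding rings_in_order_def using *[of "ws ! k" "\<lambda>j. Suc (count_list (take k ws) j)" for k] by (simp only: )
qed

lemma ring_time_restart:
  assumes "i \<in> I" "j \<in> I"
  shows "ring_time (\<lambda>j m. restart I i E (j, m)) j (Suc m)
    = ring_time (\<lambda>j m. E (j, m)) j (if j = i then Suc (Suc m) else Suc m) - E (i, 0)"
proof (induction m)
  case 0
  then show ?case using assms by (simp add: ring_time_def restart_def)
next
  case (Suc m)
  have "restart I i E (j, Suc m) = (if j = i then E (j, Suc (Suc m)) else E (j, Suc m))"
    using assms by (simp add: restart_def)
  with Suc show ?case
    by (cases "j = i") (simp_all add: ring_time_Suc[of D j "Suc m" for D j] ring_time_Suc[of D j "Suc (Suc m)" for D j])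
qed

text \<open>
  Subtracting the time of the first ring from all later ones does not affect their order.
\<close>

lemma rings_in_order_Cons:
  assumes "i \<in> I"
  shows "rings_in_order I (\<lambda>j m. E (j, m)) (i # ws) \<longleftrightarrow>
    (\<forall>j\<in>I - {i}. E (i, 0) < E (j, 0)) \<and> rings_in_order I (\<lambda>j m. restart I i E (j, m)) ws"
  (is "rings_in_order I ?D _ \<longleftrightarrow> _")
proof (induction ws rule: rev_induct)
  case Nil
  show ?case using assms by (auto simp: rings_in_order_def ring_time_def)
next
  case (snoc a ws)
  have 1: "rings_in_order I ?D (i # ws @ [a]) \<longleftrightarrow> rings_in_order I ?D (i # ws) \<and> a \<in> I \<and>
      (\<forall>j\<in>I - {a}. ring_time ?D a (Suc (count_list (i # ws) a)) < ring_time ?D j (Suc (count_list (i # ws) j)))"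
    using rings_in_order_snoc[of I ?D "i # ws" a] by (simp only: append_Cons)
  have "ring_time ?D j (Suc (count_list (i # ws) j))
      = ring_time (\<lambda>j m. restart I i E (j, m)) j (Suc (count_list ws j)) + E (i, 0)" if "j \<in> I" for j
    using ring_time_restart[OF assms that, of E "count_list ws j"] by simp
  then have 2: "(\<forall>j\<in>I - {a}. ring_time ?D a (Suc (count_list (i # ws) a)) < ring_time ?D j (Suc (count_list (i # ws) j)))
      \<longleftrightarrow> (\<forall>j\<in>I - {a}. ring_time (\<lambda>j m. restart I i E (j, m)) a (Suc (count_list ws a))
        < ring_time (\<lambda>j m. restart I i E (j, m)) j (Suc (count_list ws j)))" if "a \<in> I"
    using that by (intro ball_cong refl) (simp del: count_list.simps)
  show ?case
  proof (cases "a \<in> I")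
    case True
    show ?thesis unfolding 1 snoc.IH rings_in_order_snoc 2[OF True] by (simp only: conj_assoc)
  qed (simp add: 1 rings_in_order_snoc del: count_list.simps)
qed

lemma Collect_eq_sets: "f \<in> N \<rightarrow>\<^sub>M count_space UNIV \<Longrightarrow> {x \<in> space N. f x = a} \<in> sets N"
  using measurable_sets[of f N "count_space UNIV" "{a}"] by (simp add: vimage_def Int_def conj_commute)

lemma ring_time_measurable:
  "(\<And>m. (\<lambda>\<omega>. D \<omega> i m) \<in> borel_measurable M) \<Longrightarrow> (\<lambda>\<omega>. ring_time (D \<omega>) i n) \<in> borel_measurable M"
  by (simp add: ring_time_def)

lemma rings_in_order_measurable:
  assumes I: "finite I" and D: "\<And>i m. i \<in> I \<Longrightarrow> (\<lambda>\<omega>. D \<omega> i m) \<in> borel_measurable M"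
  shows "{\<omega> \<in> space M. rings_in_order I (D \<omega>) ws} \<in> sets M"
proof -
  have "{\<omega> \<in> space M. ws ! k \<in> I \<and> (\<forall>j\<in>I - {ws ! k}.
      ring_time (D \<omega>) (ws ! k) (Suc (count_list (take k ws) (ws ! k)))
        < ring_time (D \<omega>) j (Suc (count_list (take k ws) j)))} \<in> sets M" for k
  proof (cases "ws ! k \<in> I")
    case True
    then have "{\<omega> \<in> space M. \<forall>j\<in>I - {ws ! k}.
      ring_time (D \<omega>) (ws ! k) (Suc (count_list (take k ws) (ws ! k)))
        < ring_time (D \<omega>) j (Suc (count_list (take k ws) j))} \<in> sets M"
      using I by (intro sets.sets_Collect_finite_All borel_measurable_less ring_time_measurable D) auto
    with True show ?thesis by simp
  qed simp
  then have "{\<omega> \<in> space M. \<forall>k\<in>{..<length ws}. ws ! k \<in> I \<and> (\<forall>j\<in>I - {ws ! k}.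
      ring_time (D \<omega>) (ws ! k) (Suc (count_list (take k ws) (ws ! k)))
        < ring_time (D \<omega>) j (Suc (count_list (take k ws) j)))} \<in> sets M"
    by (intro sets.sets_Collect_finite_All) auto
  then show ?thesis unfolding rings_in_order_def by (simp only: Ball_def lessThan_iff)
qed

lemma ring_order_measurable:
  assumes I: "finite I" and D: "\<And>i m. i \<in> I \<Longrightarrow> (\<lambda>\<omega>. D \<omega> i m) \<in> borel_measurable M"
  shows "(\<lambda>\<omega>. ring_order I (D \<omega>) n) \<in> M \<rightarrow>\<^sub>M count_space UNIV"
proof (induction n)
  case (Suc n)
  have next_clock: "(\<lambda>\<omega>. next_clock I (D \<omega>) ws) \<in> M \<rightarrow>\<^sub>M count_space UNIV" for ws
    unfolding next_clock_def
  proof (rule measurable_Least)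
    fix i
    have "{\<omega> \<in> space M. i \<in> I \<and> (\<forall>j\<in>I. ring_time (D \<omega>) i (Suc (count_list ws i))
        \<le> ring_time (D \<omega>) j (Suc (count_list ws j)))} \<in> sets M"
    proof (cases "i \<in> I")
      case True
      then have "{\<omega> \<in> space M. \<forall>j\<in>I. ring_time (D \<omega>) i (Suc (count_list ws i))
          \<le> ring_time (D \<omega>) j (Suc (count_list ws j))} \<in> sets M"
        using I by (intro sets.sets_Collect_finite_All borel_measurable_le ring_time_measurable D) auto
      with True show ?thesis by simp
    qed simp
    then show "(\<lambda>\<omega>. i \<in> I \<and> (\<forall>j\<in>I. ring_time (D \<omega>) i (Suc (count_list ws i))
        \<le> ring_time (D \<omega>) j (Suc (count_list ws j)))) \<in> M \<rightarrow>\<^sub>M count_space UNIV"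
      by (simp add: pred_def)
  qed
  have "(\<lambda>\<omega>. ws @ [next_clock I (D \<omega>) ws]) \<in> M \<rightarrow>\<^sub>M count_space UNIV" for ws
    using measurable_compose[OF next_clock[of ws], of "\<lambda>i. ws @ [i]"] by simp
  from measurable_compose_countable[OF this Suc] show ?case by simp
qed simp

lemma sets_clock_measure: "sets (clock_measure I r) = sets (\<Pi>\<^sub>M k\<in>I \<times> UNIV. borel)"
  unfolding clock_measure_def by (intro sets_PiM_cong) auto

lemma clock_measurable: "j \<in> I \<Longrightarrow> (\<lambda>E. E (j, m)) \<in> borel_measurable (clock_measure I r)"
  by (subst measurable_cong_sets[OF sets_clock_measure refl])
     (auto intro!: measurable_component_singleton)

text \<open>
  Induction from the first ring on; after it the restarted clocks have the rates
  \<open>rate_after_ring i r\<close>.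
\<close>

lemma emeasure_rings_in_order:
  assumes I: "finite I" and r: "\<And>j m. 0 < r j m" and ws: "set ws \<subseteq> I"
  shows "emeasure (clock_measure I r) {E \<in> space (clock_measure I r). rings_in_order I (\<lambda>j m. E (j, m)) ws}
    = ennreal (order_prob I r ws)"
  using r ws
proof (induction ws arbitrary: r)
  case Nil
  interpret prob_space "clock_measure I r"
    unfolding clock_measure_def by (intro prob_space_PiM prob_space_exp_measure) (auto simp: Nil)
  show ?case by (simp add: emeasure_space_1)
next
  case (Cons i ws)
  then have i: "i \<in> I" and ws: "set ws \<subseteq> I" by auto
  let ?r = "rate_after_ring i r"
  let ?B = "{E \<in> space (clock_measure I ?r). rings_in_order I (\<lambda>j m. E (j, m)) ws}"
  have r': "0 < ?r j m" for j m using Cons.prems(1) by (simp add: rate_after_ring_def)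
  have B: "?B \<in> sets (clock_measure I ?r)"
    by (intro rings_in_order_measurable I clock_measurable)
  have space: "space (clock_measure I r') = extensional (I \<times> UNIV)" for r' :: "nat \<Rightarrow> nat \<Rightarrow> real"
    by (auto simp: clock_measure_def space_PiM PiE_def)
  have ext: "restart I i E \<in> extensional (I \<times> UNIV)" for E by (simp add: restart_def)
  have "{E \<in> space (clock_measure I r). rings_in_order I (\<lambda>j m. E (j, m)) (i # ws)}
      = {E \<in> space (clock_measure I r). (\<forall>j\<in>I - {i}. E (i, 0) < E (j, 0)) \<and> restart I i E \<in> ?B}"
    by (simp only: rings_in_order_Cons[OF i] space mem_Collect_eq ext simp_thms)
  also have "emeasure (clock_measure I r) \<dots> = ennreal (r i 0 / (\<Sum>j\<in>I. r j 0)) * emeasure (clock_measure I ?r) ?B"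
    by (rule regeneration[OF I i Cons.prems(1) B])
  also have "\<dots> = ennreal (r i 0 / (\<Sum>j\<in>I. r j 0)) * ennreal (order_prob I ?r ws)"
    by (simp only: Cons.IH[OF r' ws])
  also have "\<dots> = ennreal (order_prob I r (i # ws))"
    unfolding order_prob_Cons by (rule ennreal_mult''[symmetric]) (rule order_prob_nonneg[OF r'])
  finally show ?case .
qed

context prob_space
begin

lemma prob_rings_in_order:
  assumes I: "finite I" "I \<noteq> {}" and r: "\<And>j m. 0 < r j m"
    and indep: "indep_vars (\<lambda>_. borel) (\<lambda>(j, m). X j m) (I \<times> UNIV)"
    and X: "\<And>j m. j \<in> I \<Longrightarrow> distributed M lborel (X j m) (exponential_density (r j m))"
    and ws: "set ws \<subseteq> I"
  shows "prob {\<omega> \<in> space M. rings_in_order I (\<lambda>j m. X j m \<omega>) ws} = order_prob I r ws"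
proof -
  let ?K = "I \<times> (UNIV :: nat set)"
  let ?X = "\<lambda>k \<omega>. case k of (j, m) \<Rightarrow> X j m \<omega>"
  let ?f = "\<lambda>\<omega>. \<lambda>k\<in>?K. ?X k \<omega>"
  let ?A = "{E \<in> space (clock_measure I r). rings_in_order I (\<lambda>j m. E (j, m)) ws}"
  have X_meas: "X j m \<in> borel_measurable M" if "j \<in> I" for j m
    using distributed_measurable[OF X[OF that]] by simp
  have "(\<lambda>(j, m). X j m) = ?X" by (auto simp: fun_eq_iff)
  then have "distr M (\<Pi>\<^sub>M k\<in>?K. borel) ?f = (\<Pi>\<^sub>M k\<in>?K. distr M borel (?X k))"
    using indep I X_meas by (subst indep_vars_iff_distr_eq_PiM'[symmetric]) auto
  also have "\<dots> = clock_measure I r"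
    unfolding clock_measure_def
  proof (intro PiM_cong refl)
    fix k assume "k \<in> ?K"
    then obtain j m where k: "k = (j, m)" "j \<in> I" by auto
    have "distr M borel (X j m) = distr M lborel (X j m)" by (intro distr_cong) auto
    also have "\<dots> = exp_measure (r j m)" by (rule distributed_distr_eq_density[OF X[OF k(2)]])
    finally show "distr M borel (?X k) = exp_measure (case k of (j, m) \<Rightarrow> r j m)" by (simp add: k)
  qed
  finally have distr: "distr M (\<Pi>\<^sub>M k\<in>?K. borel) ?f = clock_measure I r" .
  have f: "?f \<in> M \<rightarrow>\<^sub>M (\<Pi>\<^sub>M k\<in>?K. borel)"
    using X_meas by (intro measurable_restrict) auto
  have A: "?A \<in> sets (\<Pi>\<^sub>M k\<in>?K. borel)"
  proof -
    have "?A = {E \<in> space (\<Pi>\<^sub>M k\<in>?K. borel). rings_in_order I (\<lambda>j m. E (j, m)) ws}"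
      by (auto simp: clock_measure_def space_PiM)
    also have "\<dots> \<in> sets (\<Pi>\<^sub>M k\<in>?K. borel)"
      by (intro rings_in_order_measurable I) (auto intro!: measurable_component_singleton)
    finally show ?thesis .
  qed
  have "ennreal (order_prob I r ws) = emeasure (distr M (\<Pi>\<^sub>M k\<in>?K. borel) ?f) ?A"
    unfolding distr by (rule emeasure_rings_in_order[OF I(1) r ws, symmetric])
  also have "\<dots> = emeasure M (?f -` ?A \<inter> space M)"
    by (rule emeasure_distr[OF f A])
  also have "?f -` ?A \<inter> space M = {\<omega> \<in> space M. rings_in_order I (\<lambda>j m. X j m \<omega>) ws}"
  proof -
    have "rings_in_order I (\<lambda>j m. ?f \<omega> (j, m)) ws \<longleftrightarrow> rings_in_order I (\<lambda>j m. X j m \<omega>) ws" for \<omega>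
      by (rule rings_in_order_cong) auto
    then show ?thesis by (auto simp: clock_measure_def space_PiM)
  qed
  finally show ?thesis
    using order_prob_nonneg[of r I ws] r by (simp add: emeasure_eq_measure)
qed

text \<open>
  The events that the clocks ring strictly in the order \<open>ws\<close> are disjoint for different lists of the
  same length, and their probabilities add up to \<open>1\<close>.
\<close>

lemma AE_no_ties:
  assumes I: "finite I" "I \<noteq> {}" and r: "\<And>j m. 0 < r j m"
    and indep: "indep_vars (\<lambda>_. borel) (\<lambda>(j, m). X j m) (I \<times> UNIV)"
    and X: "\<And>j m. j \<in> I \<Longrightarrow> distributed M lborel (X j m) (exponential_density (r j m))"
  shows "AE \<omega> in M. rings_in_order I (\<lambda>j m. X j m \<omega>) (ring_order I (\<lambda>j m. X j m \<omega>) n)"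
proof -
  let ?L = "{ws. set ws \<subseteq> I \<and> length ws = n}"
  let ?A = "\<lambda>ws. {\<omega> \<in> space M. rings_in_order I (\<lambda>j m. X j m \<omega>) ws}"
  have X_meas: "X j m \<in> borel_measurable M" if "j \<in> I" for j m
    using distributed_measurable[OF X[OF that]] by simp
  have A: "?A ws \<in> events" for ws by (intro rings_in_order_measurable I X_meas)
  have fin: "finite ?L" using finite_lists_length_eq[OF I(1)] by simp
  have disj: "disjoint_family_on ?A ?L"
    unfolding disjoint_family_on_def
  proof (intro ballI impI equalityI subsetI)
    fix vs ws \<omega> assume "vs \<in> ?L" "ws \<in> ?L" "vs \<noteq> ws" "\<omega> \<in> ?A vs \<inter> ?A ws"
    then have "ring_order I (\<lambda>j m. X j m \<omega>) n = vs" "ring_order I (\<lambda>j m. X j m \<omega>) n = ws"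
      using ring_order_unique[of I "\<lambda>j m. X j m \<omega>" vs] ring_order_unique[of I "\<lambda>j m. X j m \<omega>" ws]
      by auto
    with \<open>vs \<noteq> ws\<close> show "\<omega> \<in> {}" by simp
  qed simp
  have "prob (\<Union>ws\<in>?L. ?A ws) = (\<Sum>ws\<in>?L. prob (?A ws))"
    using A disj fin by (intro finite_measure_finite_Union) auto
  also have "\<dots> = (\<Sum>ws\<in>?L. order_prob I r ws)"
    by (intro sum.cong refl prob_rings_in_order[OF I r indep X]) auto
  also have "\<dots> = 1" by (rule sum_order_prob[OF I r])
  finally have "AE \<omega> in M. \<omega> \<in> (\<Union>ws\<in>?L. ?A ws)"
    using A fin by (intro AE_prob_1) auto
  then show ?thesis
  proof eventually_elim
    case (elim \<omega>)
    then obtain ws where "length ws = n" "rings_in_order I (\<lambda>j m. X j m \<omega>) ws" by blast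
    then show ?case using ring_order_unique by metis
  qed
qed

lemma prob_ring_order_eq:
  assumes I: "finite I" "I \<noteq> {}" and r: "\<And>j m. 0 < r j m"
    and indep: "indep_vars (\<lambda>_. borel) (\<lambda>(j, m). X j m) (I \<times> UNIV)"
    and X: "\<And>j m. j \<in> I \<Longrightarrow> distributed M lborel (X j m) (exponential_density (r j m))"
    and ws: "set ws \<subseteq> I"
  shows "prob {\<omega> \<in> space M. ring_order I (\<lambda>j m. X j m \<omega>) (length ws) = ws} = order_prob I r ws"
proof -
  have X_meas: "X j m \<in> borel_measurable M" if "j \<in> I" for j m
    using distributed_measurable[OF X[OF that]] by simp
  have "(\<lambda>\<omega>. ring_order I (\<lambda>j m. X j m \<omega>) (length ws)) \<in> M \<rightarrow>\<^sub>M count_space UNIV"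
    by (intro ring_order_measurable I X_meas)
  then have "{\<omega> \<in> space M. ring_order I (\<lambda>j m. X j m \<omega>) (length ws) = ws} \<in> events"
    by (rule Collect_eq_sets)
  moreover have "{\<omega> \<in> space M. rings_in_order I (\<lambda>j m. X j m \<omega>) ws} \<in> events"
    by (intro rings_in_order_measurable I X_meas)
  moreover have "AE \<omega> in M. \<omega> \<in> {\<omega> \<in> space M. ring_order I (\<lambda>j m. X j m \<omega>) (length ws) = ws}
      \<longleftrightarrow> \<omega> \<in> {\<omega> \<in> space M. rings_in_order I (\<lambda>j m. X j m \<omega>) ws}"
  proof -
    have "AE \<omega> in M. rings_in_order I (\<lambda>j m. X j m \<omega>) (ring_order I (\<lambda>j m. X j m \<omega>) (length ws))"
      by (rule AE_no_ties[OF I r indep X])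
    then show ?thesis
    proof eventually_elim
      case (elim \<omega>)
      then show ?case
        using ring_order_unique[of I "\<lambda>j m. X j m \<omega>" ws] by auto
    qed
  qed
  ultimately have "prob {\<omega> \<in> space M. ring_order I (\<lambda>j m. X j m \<omega>) (length ws) = ws}
      = prob {\<omega> \<in> space M. rings_in_order I (\<lambda>j m. X j m \<omega>) ws}"
    by (intro finite_measure_eq_AE) auto
  also have "\<dots> = order_prob I r ws" by (rule prob_rings_in_order[OF I r indep X ws])
  finally show ?thesis .
qed

end

section \<open>Transition probabilities of the trap model\<close>

lemma labels_self: "labels M i i = {[]}"
  by (auto simp: labels_def)

lemma labels_Suc:
  assumes "i \<le> k"
  shows "labels M i (Suc k) = (\<lambda>(z, y). z @ [y]) ` (labels M i k \<times> {1..M (Suc k)})"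
proof (intro equalityI subsetI)
  fix x assume "x \<in> labels M i (Suc k)"
  then have len: "length x = Suc (k - i)" and mem: "\<And>m. m < Suc (k - i) \<Longrightarrow> x ! m \<in> {1..M (Suc (i + m))}"
    using assms by (auto simp: labels_def Suc_diff_le)
  then obtain z y where x: "x = z @ [y]" by (cases x rule: rev_cases) auto
  have "z ! m \<in> {1..M (Suc (i + m))}" if "m < k - i" for m
    using mem[of m] that len by (auto simp: x nth_append split: if_splits)
  then have "z \<in> labels M i k" using len by (simp add: labels_def x)
  moreover have "y \<in> {1..M (Suc k)}" using mem[of "k - i"] len assms by (simp add: x nth_append)
  ultimately show "x \<in> (\<lambda>(z, y). z @ [y]) ` (labels M i k \<times> {1..M (Suc k)})"
    using x by (intro image_eqI[of _ _ "(z, y)"]) auto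
next
  fix x assume "x \<in> (\<lambda>(z, y). z @ [y]) ` (labels M i k \<times> {1..M (Suc k)})"
  then obtain z y where x: "x = z @ [y]" "z \<in> labels M i k" "y \<in> {1..M (Suc k)}" by auto
  then have len: "length z = k - i" by (simp add: labels_def)
  have "x ! m \<in> {1..M (Suc (i + m))}" if "m < Suc k - i" for m
  proof (cases "m = k - i")
    case True
    then show ?thesis using x len assms by (simp add: nth_append)
  next
    case False
    then have "m < k - i" using that assms by linarith
    then show ?thesis using x len by (simp add: labels_def nth_append)
  qed
  then show "x \<in> labels M i (Suc k)" using len assms x by (simp add: labels_def Suc_diff_le)
qed

lemma labels_card:
  assumes "i \<le> k"
  shows "finite (labels M i k) \<and> card (labels M i k) = (\<Prod>j\<in>{i<..k}. M j)"
  using assms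
proof (induction k rule: dec_induct)
  case base
  then show ?case by (simp add: labels_self)
next
  case (step k)
  have "inj_on (\<lambda>(z, y). z @ [y]) (labels M i k \<times> {1..M (Suc k)})" by (auto simp: inj_on_def)
  moreover have "{i<..Suc k} = insert (Suc k) {i<..k}" using step by auto
  ultimately show ?case using step
    by (simp add: labels_Suc card_image card_cartesian_product mult.commute)
qed

lemma card_tree_pos:
  assumes "\<And>j. j \<in> {1..l} \<Longrightarrow> 1 \<le> M j"
  shows "0 < card (tree M l)"
proof -
  have "0 < M j" if "j \<in> {0<..l}" for j using assms[of j] that by simp
  then have "0 < (\<Prod>j\<in>{0<..l}. M j)" by (rule prod_pos)
  then show ?thesis using labels_card[of 0 l M] by (simp add: tree_def)
qed

lemma card_tree_Suc: "card (tree M (Suc l)) = card (tree M l) * M (Suc l)"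
proof -
  have "{0<..Suc l} = insert (Suc l) {0<..l}" by auto
  then show ?thesis using labels_card[of 0 l M] labels_card[of 0 "Suc l" M] by (simp add: tree_def)
qed

text \<open>
  A coin result \<open>i\<close> can lead from \<open>x\<close> to \<open>x'\<close> only if the two have the same ancestor in generation \<open>i\<close>, and
  then each of the equally likely completions is as good as another.
\<close>

lemma pmf_jump_pmf:
  assumes k: "1 \<le> k" and M: "\<And>j. j \<in> {1..k} \<Longrightarrow> 1 \<le> M j"
    and p: "\<And>j. j \<in> {1..<k} \<Longrightarrow> p j (take j x) \<in> {0<..<1}"
    and x: "x \<in> tree M k" "x' \<in> tree M k"
  shows "pmf (jump_pmf M p k x) x' = (\<Sum>i<k. coin_prob p k x i *
     (if take i x = take i x' then 1 / real (\<Prod>j\<in>{i<..k}. M j) else 0))"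
proof -
  have coin: "pmf (coin_pmf p k x) i = (if i < k then coin_prob p k x i else 0)" for i
    using pmf_coin_pmf[where p = p and x = x, OF k p] by blast
  have len: "length x = k" "length x' = k" using x by (auto simp: tree_def labels_def)
  have inner: "pmf (map_pmf (\<lambda>z. take i x @ z) (pmf_of_set (labels M i k))) x'
      = (if take i x = take i x' then 1 / real (\<Prod>j\<in>{i<..k}. M j) else 0)" if i: "i < k" for i
  proof -
    have L: "finite (labels M i k)" "card (labels M i k) = (\<Prod>j\<in>{i<..k}. M j)"
      using labels_card[of i k M] i by auto
    have "0 < (\<Prod>j\<in>{i<..k}. M j)" using M by (intro prod_pos) (fastforce simp: Suc_le_eq)
    then have ne: "labels M i k \<noteq> {}" using L by (metis card.empty less_irrefl)
    show ?thesis
    proof (cases "take i x = take i x'")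
      case True
      then have "x' = take i x @ drop i x'" by (metis append_take_drop_id)
      moreover have "drop i x' \<in> labels M i k"
        using x(2) i by (auto simp: tree_def labels_def)
      moreover have "pmf (map_pmf (\<lambda>z. take i x @ z) (pmf_of_set (labels M i k))) (take i x @ drop i x')
          = pmf (pmf_of_set (labels M i k)) (drop i x')"
        by (rule pmf_map_inj') (simp add: inj_def)
      ultimately show ?thesis using True L ne by (metis (no_types, lifting) pmf_of_set indicator_simps(1))
    next
      case False
      have "x' \<notin> (\<lambda>z. take i x @ z) ` set_pmf (pmf_of_set (labels M i k))"
      proof
        assume "x' \<in> (\<lambda>z. take i x @ z) ` set_pmf (pmf_of_set (labels M i k))"
        then obtain z where "x' = take i x @ z" by blast
        then have "take i x' = take i x" using len i by simp
        with False show False by simp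
      qed
      then show ?thesis using False by (simp add: pmf_map_outside)
    qed
  qed
  have "pmf (jump_pmf M p k x) x' = (\<Sum>i<k. pmf (map_pmf (\<lambda>z. take i x @ z) (pmf_of_set (labels M i k))) x'
      * pmf (coin_pmf p k x) i)"
    unfolding jump_pmf_def pmf_bind
  proof (rule integral_measure_pmf_real)
    fix i assume "i \<in> set_pmf (coin_pmf p k x)"
    then show "i \<in> {..<k}" using coin[of i] by (auto simp: set_pmf_iff split: if_splits)
  qed simp
  also have "\<dots> = (\<Sum>i<k. coin_prob p k x i *
     (if take i x = take i x' then 1 / real (\<Prod>j\<in>{i<..k}. M j) else 0))"
    by (intro sum.cong refl) (simp only: inner coin lessThan_iff if_True mult.commute)
  finally show ?thesis .
qed

lemma pmf_jump_pmf_1: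
  assumes "1 \<le> M 1" "x \<in> tree M 1" "x' \<in> tree M 1"
  shows "pmf (jump_pmf M p 1 x) x' = 1 / M 1"
proof -
  have "{0<..<Suc 0} = {}" "{0<..Suc 0} = {Suc 0}" by auto
  then show ?thesis
    using assms by (subst pmf_jump_pmf) (auto simp: coin_prob_def activation_def)
qed

text \<open>
  The coin of level \<open>l\<close> is tossed first.  If it says to stay, only the last coordinate is resampled;
  otherwise the coins of the lower levels decide as they do for the tree with \<open>l\<close> levels.  In
  both cases the last coordinate is uniform.
\<close>

lemma pmf_jump_pmf_Suc:
  assumes l: "1 \<le> l" and M: "\<And>j. j \<in> {1..Suc l} \<Longrightarrow> 1 \<le> M j"
    and p: "\<And>j u. j \<in> {1..l} \<Longrightarrow> u \<in> tree M j \<Longrightarrow> p j u \<in> {0<..<1}"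
    and z: "z \<in> tree M l" "z' \<in> tree M l" and y: "y \<in> {1..M (Suc l)}" "y' \<in> {1..M (Suc l)}"
  shows "pmf (jump_pmf M p (Suc l) (z @ [y])) (z' @ [y'])
    = (p l z * pmf (jump_pmf M p l z) z' + (if z = z' then 1 - p l z else 0)) / M (Suc l)"
proof -
  have len: "length z = l" "length z' = l" using z by (auto simp: tree_def labels_def)
  have take: "take j z \<in> tree M j" if "j \<le> l" for j
    using z(1) that by (auto simp: tree_def labels_def)
  let ?x = "z @ [y]" and ?x' = "z' @ [y']"
  have p1: "p j (take j z) \<in> {0<..<1}" if "j \<in> {1..<l}" for j
    using p[of j] take[of j] that by auto
  have p2: "p j (take j ?x) \<in> {0<..<1}" if "j \<in> {1..<Suc l}" for j
    using p[of j] take[of j] that len by auto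
  have act: "activation p j ?x = activation p j z" if "j \<le> l" for j
    using that len by (simp add: activation_def)
  have coin: "coin_prob p (Suc l) ?x i = p l z * coin_prob p l z i" if "i < l" for i
  proof -
    have "{i<..<Suc l} = insert l {i<..<l}" using that by auto
    moreover have "activation p l z = p l z" using l len by (simp add: activation_def)
    moreover have "(\<Prod>j\<in>{i<..<l}. activation p j ?x) = (\<Prod>j\<in>{i<..<l}. activation p j z)"
      by (intro prod.cong refl) (simp add: act)
    ultimately show ?thesis using that by (simp add: coin_prob_def act)
  qed
  have coin_l: "coin_prob p (Suc l) ?x l = 1 - p l z"
  proof -
    have "{l<..<Suc l} = {}" by auto
    then show ?thesis using l len by (simp add: coin_prob_def activation_def)
  qed
  have ivl: "(\<Prod>j\<in>{i<..Suc l}. M j) = (\<Prod>j\<in>{i<..l}. M j) * M (Suc l)" if "i < l" for i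
  proof -
    have "{i<..Suc l} = insert (Suc l) {i<..l}" using that by auto
    then show ?thesis by simp
  qed
  have ivl_l: "(\<Prod>j\<in>{l<..Suc l}. M j) = M (Suc l)"
  proof -
    have "{l<..Suc l} = {Suc l}" by auto
    then show ?thesis by simp
  qed
  let ?m = "\<lambda>i. if take i z = take i z' then 1 / real (\<Prod>j\<in>{i<..l}. M j) else 0"
  have "pmf (jump_pmf M p (Suc l) ?x) ?x' = (\<Sum>i<Suc l. coin_prob p (Suc l) ?x i *
     (if take i ?x = take i ?x' then 1 / real (\<Prod>j\<in>{i<..Suc l}. M j) else 0))"
    using p2 y z M by (intro pmf_jump_pmf snoc_in_tree) auto
  also have "\<dots> = (\<Sum>i<l. p l z * (coin_prob p l z i * ?m i) / M (Suc l))
      + (if z = z' then 1 - p l z else 0) / M (Suc l)"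
    unfolding sum.lessThan_Suc
  proof (intro arg_cong2[where f = "(+)"] sum.cong refl)
    fix i assume "i \<in> {..<l}"
    then show "coin_prob p (Suc l) ?x i * (if take i ?x = take i ?x' then 1 / real (\<Prod>j\<in>{i<..Suc l}. M j) else 0)
        = p l z * (coin_prob p l z i * ?m i) / M (Suc l)"
      using len by (simp add: coin ivl)
  next
    show "coin_prob p (Suc l) ?x l * (if take l ?x = take l ?x' then 1 / real (\<Prod>j\<in>{l<..Suc l}. M j) else 0)
        = (if z = z' then 1 - p l z else 0) / M (Suc l)"
      using len by (simp add: coin_l ivl_l)
  qed
  also have "(\<Sum>i<l. p l z * (coin_prob p l z i * ?m i) / M (Suc l))
      = p l z * (\<Sum>i<l. coin_prob p l z i * ?m i) / M (Suc l)"
    by (simp only: sum_divide_distrib[symmetric] sum_distrib_left[symmetric])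
  also have "(\<Sum>i<l. coin_prob p l z i * ?m i) = pmf (jump_pmf M p l z) z'"
    using p1 z l M by (intro pmf_jump_pmf[symmetric]) auto
  finally show ?thesis by (simp add: add_divide_distrib)
qed

section \<open>What a ring order reveals about the level below\<close>

text \<open>
  Suppose that the states of level \<open>l + 1\<close> are \<open>z m @ [y m]\<close>.  Together with the ring order \<open>ws\<close> they
  determine the states of level \<open>l\<close> and the refresh variables used so far: these are the entries of
  \<open>z\<close> and of \<open>y\<close> at time \<open>0\<close> and after each ring of clock \<open>0\<close>.
\<close>

definition refresh_trace :: "(nat \<Rightarrow> 'a) \<Rightarrow> nat list \<Rightarrow> 'a list" where
  "refresh_trace f ws = f 0 # map (\<lambda>q. f (Suc q)) (filter (\<lambda>q. ws ! q = 0) [0..<length ws])"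

text \<open>
  A ring of a clock other than \<open>0\<close> must leave the ancestor unchanged and set the last coordinate to its
  own number.
\<close>

definition consistent :: "(nat \<Rightarrow> 'a) \<Rightarrow> (nat \<Rightarrow> nat) \<Rightarrow> nat list \<Rightarrow> bool" where
  "consistent z y ws \<longleftrightarrow> (\<forall>q<length ws. ws ! q \<noteq> 0 \<longrightarrow> z (Suc q) = z q \<and> ws ! q = y (Suc q))"

lemma trace_Nil [simp]: "refresh_trace f [] = [f 0]"
  by (simp add: refresh_trace_def)

lemma trace_snoc: "refresh_trace f (ws @ [i]) = refresh_trace f ws @ (if i = 0 then [f (Suc (length ws))] else [])"
proof -
  have "filter (\<lambda>q. (ws @ [i]) ! q = 0) [0..<length ws] = filter (\<lambda>q. ws ! q = 0) [0..<length ws]"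
    by (intro filter_cong) (auto simp: nth_append)
  then show ?thesis by (simp add: refresh_trace_def)
qed

lemma consistent_Nil [simp]: "consistent z y []"
  by (simp add: consistent_def)

lemma consistent_snoc:
  "consistent z y (ws @ [i]) \<longleftrightarrow> consistent z y ws \<and>
     (i \<noteq> 0 \<longrightarrow> z (Suc (length ws)) = z (length ws) \<and> i = y (Suc (length ws)))"
  by (auto simp: consistent_def nth_append less_Suc_eq)

lemma length_trace: "length (refresh_trace f ws) = Suc (count_list ws 0)"
  by (induction ws rule: rev_induct) (auto simp: trace_snoc)

lemma trace_last:
  "consistent z y ws \<Longrightarrow> refresh_trace z ws ! count_list ws 0 = z (length ws)"
  by (induction ws rule: rev_induct) (auto simp: trace_snoc consistent_snoc nth_append length_trace)

lemma set_trace: "set (refresh_trace f ws) \<subseteq> f ` {..length ws}"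
  by (auto simp: refresh_trace_def)

lemma reconstruct:
  fixes C :: "nat \<Rightarrow> nat list" and U :: "nat \<Rightarrow> nat"
  shows "(\<forall>m\<le>length ws. C (count_list (take m ws) 0) @
      [if take m ws = [] \<or> last (take m ws) = 0 then U (count_list (take m ws) 0) else last (take m ws)]
        = z m @ [y m])
    \<longleftrightarrow> consistent z y ws \<and> (\<forall>j\<le>count_list ws 0. C j = refresh_trace z ws ! j \<and> U j = refresh_trace y ws ! j)"
  (is "?lhs ws \<longleftrightarrow> ?rhs ws")
proof (induction ws rule: rev_induct)
  case (snoc i ws)
  let ?n = "length ws" and ?N = "count_list ws 0"
  have "?lhs (ws @ [i]) \<longleftrightarrow> ?lhs ws \<and> C (count_list (ws @ [i]) 0) @
      [if i = 0 then U (count_list (ws @ [i]) 0) else i] = z (Suc ?n) @ [y (Suc ?n)]"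
  proof -
    have split: "(\<forall>m\<le>length (ws @ [i]). P m) \<longleftrightarrow> (\<forall>m\<le>?n. P m) \<and> P (Suc ?n)" for P
      by (auto simp: le_Suc_eq)
    show ?thesis unfolding split by simp
  qed
  also have "\<dots> \<longleftrightarrow> ?rhs ws \<and> C (count_list (ws @ [i]) 0) @
      [if i = 0 then U (count_list (ws @ [i]) 0) else i] = z (Suc ?n) @ [y (Suc ?n)]"
    using snoc by (simp only:)
  also have "\<dots> \<longleftrightarrow> ?rhs (ws @ [i])"
  proof (cases "i = 0")
    case True
    have split: "(\<forall>j\<le>count_list (ws @ [0]) 0. P j) \<longleftrightarrow> (\<forall>j\<le>?N. P j) \<and> P (Suc ?N)" for P
      by (auto simp: le_Suc_eq)
    have nth: "refresh_trace f (ws @ [0]) ! j = refresh_trace f ws ! j" if "j \<le> ?N" for f :: "nat \<Rightarrow> 'b" and j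
      using that by (simp add: trace_snoc nth_append length_trace)
    have nth': "refresh_trace f (ws @ [0]) ! Suc ?N = f (Suc ?n)" for f :: "nat \<Rightarrow> 'b"
      by (simp add: trace_snoc nth_append length_trace)
    show ?thesis
      unfolding True split consistent_snoc by (auto simp: nth nth')
  next
    case False
    then show ?thesis
      using trace_last[of z y ws] by (auto simp: consistent_snoc trace_snoc)
  qed
  finally show ?case .
qed simp

section \<open>Independence of the levels, and the first level\<close>

lemma ring_order_cong:
  assumes "\<And>i m. i \<in> I \<Longrightarrow> D i m = D' i m"
  shows "ring_order I D n = ring_order I D' n"
proof (induction n)
  case (Suc n)
  have "next_clock I D ws = next_clock I D' ws" for ws
  proof -
    have "ring_time D j m = ring_time D' j m" if "j \<in> I" for j m
      using assms that by (simp add: ring_time_def)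
    then have "(i \<in> I \<and> (\<forall>j\<in>I. ring_time D i (Suc (count_list ws i)) \<le> ring_time D j (Suc (count_list ws j))))
      = (i \<in> I \<and> (\<forall>j\<in>I. ring_time D' i (Suc (count_list ws i)) \<le> ring_time D' j (Suc (count_list ws j))))" for i
      by auto
    then show ?thesis by (simp only: next_clock_def)
  qed
  with Suc show ?case by simp
qed simp

text \<open>
  The drivers that the states of level \<open>l\<close> depend on.  The variables \<open>Clock l n\<close> are not among them, which
  makes the holding times of level \<open>l\<close> conditionally independent of its states.
\<close>

definition chain_drivers :: "nat \<Rightarrow> driver set" where
  "chain_drivers l = {Gap j x i | j x i. j \<in> {1..l} \<and> 1 \<le> x} \<union> {Clock j n | j n. j \<in> {1..<l}} \<union>
     {Refresh j n | j n. j \<in> {2..l}}"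

lemma chain_drivers_mono: "chain_drivers l \<subseteq> chain_drivers (Suc l)"
  by (auto simp: chain_drivers_def)

lemma chain_cong:
  assumes "\<And>r. r \<in> chain_drivers l \<Longrightarrow> d r = d' r"
  shows "chain M \<gamma> l d = chain M \<gamma> l d'"
  using assms
proof (induction l)
  case (Suc l)
  have C: "chain M \<gamma> l d = chain M \<gamma> l d'"
    using chain_drivers_mono Suc.prems by (intro Suc.IH) blast
  have D: "durations \<gamma> l (chain M \<gamma> l d') d i m = durations \<gamma> l (chain M \<gamma> l d') d' i m"
    if "i \<in> clock_set M l" for i m
    using that Suc.prems[of "Clock l m"] Suc.prems[of "Gap (Suc l) i m"]
    by (cases "l = 0"; cases "i = 0") (auto simp: durations_def chain_drivers_def)
  have U: "d (Refresh (Suc l) n) = d' (Refresh (Suc l) n)" if "l \<noteq> 0" for n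
    using that Suc.prems[of "Refresh (Suc l) n"] by (auto simp: chain_drivers_def)
  have W: "ring_order (clock_set M l) (durations \<gamma> l (chain M \<gamma> l d') d) n
      = ring_order (clock_set M l) (durations \<gamma> l (chain M \<gamma> l d') d') n" for n
    by (rule ring_order_cong) (rule D)
  have "(if l \<noteq> 0 \<and> b then nat \<lfloor>d (Refresh (Suc l) n)\<rfloor> else y)
      = (if l \<noteq> 0 \<and> b then nat \<lfloor>d' (Refresh (Suc l) n)\<rfloor> else y)" for b n y
    using U by simp
  then show ?case
    unfolding chain.simps Let_def C W by (simp only:)
qed simp

lemma chain_measurable:
  assumes "\<And>r. r \<in> chain_drivers l \<Longrightarrow> X r \<in> borel_measurable N"
  shows "(\<lambda>\<omega>. chain M \<gamma> l (\<lambda>r. X r \<omega>) n) \<in> N \<rightarrow>\<^sub>M count_space UNIV"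
  using assms
proof (induction l arbitrary: n)
  case (Suc l)
  let ?C = "\<lambda>\<omega>. chain M \<gamma> l (\<lambda>r. X r \<omega>)"
  have C: "(\<lambda>\<omega>. ?C \<omega> m) \<in> N \<rightarrow>\<^sub>M count_space UNIV" for m
    using chain_drivers_mono[of l] Suc.prems by (intro Suc.IH) blast
  have D: "(\<lambda>\<omega>. durations \<gamma> l (?C \<omega>) (\<lambda>r. X r \<omega>) i m) \<in> borel_measurable N"
    if i: "i \<in> clock_set M l" for i m
  proof (cases "i = 0")
    case True
    then have "l \<noteq> 0" using i by (cases "l = 0") auto
    then have "X (Clock l m) \<in> borel_measurable N" by (intro Suc.prems) (auto simp: chain_drivers_def)
    moreover have "(\<lambda>\<omega>. \<gamma> l (?C \<omega> m)) \<in> borel_measurable N"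
      by (rule measurable_compose[OF C]) simp
    ultimately show ?thesis using True by (simp add: durations_def)
  next
    case False
    then have "X (Gap (Suc l) i m) \<in> borel_measurable N" by (intro Suc.prems) (auto simp: chain_drivers_def)
    with False show ?thesis by (simp add: durations_def)
  qed
  have W: "(\<lambda>\<omega>. ring_order (clock_set M l) (durations \<gamma> l (?C \<omega>) (\<lambda>r. X r \<omega>)) n') \<in> N \<rightarrow>\<^sub>M count_space UNIV" for n'
    by (rule ring_order_measurable[OF finite_clock_set D])
  have out: "(\<lambda>\<omega>. ?C \<omega> m @ [if l \<noteq> 0 \<and> b then nat \<lfloor>X (Refresh (Suc l) m) \<omega>\<rfloor> else y]) \<in> N \<rightarrow>\<^sub>M count_space UNIV"
    for m b y
  proof (cases "l \<noteq> 0 \<and> b")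
    case True
    then have "X (Refresh (Suc l) m) \<in> borel_measurable N" by (intro Suc.prems) (auto simp: chain_drivers_def)
    then have U: "(\<lambda>\<omega>. nat \<lfloor>X (Refresh (Suc l) m) \<omega>\<rfloor>) \<in> N \<rightarrow>\<^sub>M count_space UNIV"
      by measurable
    have "(\<lambda>\<omega>. ?C \<omega> m @ [u]) \<in> N \<rightarrow>\<^sub>M count_space UNIV" for u
      by (rule measurable_compose[OF C]) simp
    from measurable_compose_countable[OF this U] True show ?thesis by simp
  next
    case False
    have "(\<lambda>\<omega>. ?C \<omega> m @ [y]) \<in> N \<rightarrow>\<^sub>M count_space UNIV"
      by (rule measurable_compose[OF C]) simp
    moreover have "(if l \<noteq> 0 \<and> b then u else y) = y" for u using False by auto
    ultimately show ?thesis by (simp only:)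
  qed
  show ?case
    unfolding chain.simps Let_def by (rule measurable_compose_countable[OF out W])
qed simp

lemma chain_prefix_sets:
  "{d \<in> space (PiM (chain_drivers l) (\<lambda>_. borel)). \<forall>m\<le>n. chain M \<gamma> l d m = x m}
    \<in> sets (PiM (chain_drivers l) (\<lambda>_. borel))"
proof -
  have "(\<lambda>d. chain M \<gamma> l (\<lambda>r. d r) m) \<in> PiM (chain_drivers l) (\<lambda>_. borel) \<rightarrow>\<^sub>M count_space UNIV" for m
    by (rule chain_measurable) (rule measurable_component_singleton)
  then have "{d \<in> space (PiM (chain_drivers l) (\<lambda>_. borel)). chain M \<gamma> l d m = x m}
      \<in> sets (PiM (chain_drivers l) (\<lambda>_. borel))" for m
    by (rule Collect_eq_sets)
  then have "{d \<in> space (PiM (chain_drivers l) (\<lambda>_. borel)). \<forall>m\<in>{..n}. chain M \<gamma> l d m = x m}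
      \<in> sets (PiM (chain_drivers l) (\<lambda>_. borel))"
    by (intro sets.sets_Collect_finite_All) auto
  then show ?thesis by (simp only: Ball_def atMost_iff)
qed

lemma (in prob_space) prob_blocks:
  assumes indep: "indep_vars (\<lambda>_. N) X I" and L: "finite L" "L \<noteq> {}"
    and K: "\<And>j. j \<in> L \<Longrightarrow> K j \<subseteq> I" "disjoint_family_on K L"
    and B: "\<And>j. j \<in> L \<Longrightarrow> B j \<in> sets (PiM (K j) (\<lambda>_. N))"
  shows "prob {\<omega> \<in> space M. \<forall>j\<in>L. (\<lambda>i\<in>K j. X i \<omega>) \<in> B j}
    = (\<Prod>j\<in>L. prob {\<omega> \<in> space M. (\<lambda>i\<in>K j. X i \<omega>) \<in> B j})"
proof -
  have "prob (\<Inter>j\<in>L. (\<lambda>\<omega>. \<lambda>i\<in>K j. X i \<omega>) -` B j \<inter> space M)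
      = (\<Prod>j\<in>L. prob ((\<lambda>\<omega>. \<lambda>i\<in>K j. X i \<omega>) -` B j \<inter> space M))"
    using L B by (intro indep_varsD[OF indep_vars_restrict[OF indep K]]) auto
  moreover have "(\<Inter>j\<in>L. (\<lambda>\<omega>. \<lambda>i\<in>K j. X i \<omega>) -` B j \<inter> space M)
      = {\<omega> \<in> space M. \<forall>j\<in>L. (\<lambda>i\<in>K j. X i \<omega>) \<in> B j}"
    using L by auto
  moreover have "(\<lambda>\<omega>. \<lambda>i\<in>K j. X i \<omega>) -` B j \<inter> space M = {\<omega> \<in> space M. (\<lambda>i\<in>K j. X i \<omega>) \<in> B j}" for j
    by auto
  ultimately show ?thesis by simp
qed

lemma (in prob_space) exponential_scale:
  assumes X: "distributed M lborel X (exponential_density 1)" and c: "0 < c"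
  shows "distributed M lborel (\<lambda>\<omega>. c * X \<omega>) (exponential_density (1 / c))"
proof (subst exponential_distributed_iff)
  have X': "X \<in> borel_measurable M" "\<And>a. 0 \<le> a \<Longrightarrow> \<P>(x in M. X x \<le> a) = 1 - exp (- a * 1)"
    using X exponential_distributed_iff[of 1 X] by auto
  have "\<P>(x in M. c * X x \<le> a) = 1 - exp (- a * (1 / c))" if "0 \<le> a" for a
  proof -
    have "(c * X x \<le> a) = (X x \<le> a / c)" for x
      using c by (simp add: pos_le_divide_eq mult.commute)
    then show ?thesis using X'(2)[of "a / c"] c that by simp
  qed
  then show "(\<lambda>\<omega>. c * X \<omega>) \<in> borel_measurable M \<and>
      (\<forall>a\<ge>0. \<P>(x in M. c * X x \<le> a) = 1 - exp (- a * (1 / c)))"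
    using X'(1) by simp
qed (use c in simp)

locale driver_space = prob_space P for P :: "'a measure" +
  fixes k :: nat and M :: "nat \<Rightarrow> nat" and \<gamma> p :: "nat \<Rightarrow> nat list \<Rightarrow> real" and X :: "driver \<Rightarrow> 'a \<Rightarrow> real"
  assumes M_pos: "\<And>j. j \<in> {1..k} \<Longrightarrow> 1 \<le> M j"
    and \<gamma>_pos: "\<And>j x. j \<in> {1..k} \<Longrightarrow> x \<in> tree M j \<Longrightarrow> 0 < \<gamma> j x"
    and p_eq: "\<And>j x. j \<in> {1..<k} \<Longrightarrow> x \<in> tree M j \<Longrightarrow> p j x = 1 / (1 + real (M (j + 1)) * \<gamma> j x)"
    and indep: "indep_vars (\<lambda>_. borel) X (drivers k)"
    and gap: "\<And>l x n. l \<in> {1..k} \<Longrightarrow> 1 \<le> x \<Longrightarrow> distributed P lborel (X (Gap l x n)) (exponential_density 1)"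
    and clock: "\<And>l n. l \<in> {1..k} \<Longrightarrow> distributed P lborel (X (Clock l n)) (exponential_density 1)"
    and refresh: "\<And>l n y. l \<in> {2..k} \<Longrightarrow> y \<in> {1..M l} \<Longrightarrow>
      prob {\<omega> \<in> space P. nat \<lfloor>X (Refresh l n) \<omega>\<rfloor> = y} = 1 / M l"
begin

abbreviation "states l \<omega> \<equiv> chain M \<gamma> l (\<lambda>r. X r \<omega>)"

lemma X_measurable: "r \<in> drivers k \<Longrightarrow> X r \<in> borel_measurable P"
  using indep by (simp add: indep_vars_def)

lemma chain_drivers_subset: "l \<le> k \<Longrightarrow> chain_drivers l \<subseteq> drivers k"
  by (auto simp: chain_drivers_def drivers_def)

lemma p_range: "j \<in> {1..<k} \<Longrightarrow> x \<in> tree M j \<Longrightarrow> p j x \<in> {0<..<1}"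
proof -
  assume j: "j \<in> {1..<k}" "x \<in> tree M j"
  then have "0 < real (M (j + 1)) * \<gamma> j x" using M_pos[of "j + 1"] \<gamma>_pos[of j x] by simp
  then show ?thesis using p_eq[OF j] by simp
qed

definition clock_driver :: "nat \<Rightarrow> nat \<times> nat \<Rightarrow> driver" where
  "clock_driver l = (\<lambda>(j, m). if j = 0 then Clock l m else Gap (Suc l) j m)"

text \<open>
  The rate of spacing \<open>m\<close> of clock \<open>j\<close> when the states of level \<open>l\<close> are \<open>c\<close>.
\<close>

definition rates :: "nat \<Rightarrow> (nat \<Rightarrow> nat list) \<Rightarrow> nat \<Rightarrow> nat \<Rightarrow> real" where
  "rates l c j m = (if j = 0 then 1 / \<gamma> l (c m) else 1)"

lemma durations_indep:
  assumes l: "l < k"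
  shows "indep_vars (\<lambda>_. borel) (\<lambda>(j, m) \<omega>. durations \<gamma> l c (\<lambda>r. X r \<omega>) j m) (clock_set M l \<times> UNIV)"
proof -
  let ?I = "clock_set M l \<times> (UNIV :: nat set)"
  let ?h = "clock_driver l"
  have h: "?h k' \<in> drivers k" if "k' \<in> ?I" for k'
    using that l by (cases "l = 0"; cases "fst k' = 0") (auto simp: clock_driver_def drivers_def)
  have disj: "disjoint_family_on (\<lambda>k'. {?h k'}) ?I"
    by (auto simp: disjoint_family_on_def clock_driver_def split: if_splits)
  have "indep_vars (\<lambda>k'. PiM {?h k'} (\<lambda>_. borel)) (\<lambda>k' \<omega>. \<lambda>i\<in>{?h k'}. X i \<omega>) ?I"
    using h disj by (intro indep_vars_restrict[OF indep]) auto
  then have "indep_vars (\<lambda>_. borel) (\<lambda>k' \<omega>. (if fst k' = 0 then \<gamma> l (c (snd k')) else 1) * (\<lambda>i\<in>{?h k'}. X i \<omega>) (?h k')) ?I"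
    by (rule indep_vars_compose2) (auto intro!: borel_measurable_times measurable_component_singleton)
  also have "(\<lambda>k' \<omega>. (if fst k' = 0 then \<gamma> l (c (snd k')) else 1) * (\<lambda>i\<in>{?h k'}. X i \<omega>) (?h k'))
      = (\<lambda>(j, m) \<omega>. durations \<gamma> l c (\<lambda>r. X r \<omega>) j m)"
    by (auto simp: fun_eq_iff durations_def clock_driver_def)
  finally show ?thesis .
qed

lemma durations_distributed:
  assumes "l < k" "j \<in> clock_set M l" and c: "\<And>m. l \<noteq> 0 \<Longrightarrow> c m \<in> tree M l"
  shows "distributed P lborel (\<lambda>\<omega>. durations \<gamma> l c (\<lambda>r. X r \<omega>) j m) (exponential_density (rates l c j m))"
proof (cases "j = 0")
  case True
  then have "l \<noteq> 0" using assms(2) by (cases "l = 0") auto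
  then have "0 < \<gamma> l (c m)" using \<gamma>_pos[OF _ c, of m] assms(1) by simp
  then show ?thesis
    using True \<open>l \<noteq> 0\<close> assms(1) exponential_scale[OF clock[of l m], of "\<gamma> l (c m)"]
    by (simp add: durations_def rates_def)
next
  case False
  then show ?thesis
    using gap[of "Suc l" j m] assms(1) by (simp add: durations_def rates_def)
qed

lemma rates_pos:
  assumes "l < k" and c: "\<And>m. l \<noteq> 0 \<Longrightarrow> c m \<in> tree M l"
  shows "0 < (if j \<in> clock_set M l then rates l c j m else 1)"
proof -
  have "0 < \<gamma> l (c m)" if "0 \<in> clock_set M l"
  proof -
    have "l \<noteq> 0" using that by (cases "l = 0") auto
    then show ?thesis using \<gamma>_pos[OF _ c] assms(1) by auto
  qed
  then show ?thesis by (auto simp: rates_def)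
qed

text \<open>
  With the states of the level below replaced by a fixed sequence \<open>c\<close>, the spacings are independent
  exponentials and the competition of clocks applies.
\<close>

lemma prob_ring_order_frozen:
  assumes "l < k" and c: "\<And>m. l \<noteq> 0 \<Longrightarrow> c m \<in> tree M l" and ws: "set ws \<subseteq> clock_set M l"
  shows "prob {\<omega> \<in> space P. ring_order (clock_set M l) (durations \<gamma> l c (\<lambda>r. X r \<omega>)) (length ws) = ws}
    = order_prob (clock_set M l) (rates l c) ws"
proof -
  let ?r = "\<lambda>j m. if j \<in> clock_set M l then rates l c j m else 1"
  have "prob {\<omega> \<in> space P. ring_order (clock_set M l) (\<lambda>j m. durations \<gamma> l c (\<lambda>r. X r \<omega>) j m) (length ws) = ws}
    = order_prob (clock_set M l) ?r ws"
  proof (rule prob_ring_order_eq[OF finite_clock_set _ _ _ _ ws])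
    show "clock_set M l \<noteq> {}" using M_pos[of "Suc l"] assms(1) by (intro clock_set_nonempty) auto
    show "0 < ?r j m" for j m by (rule rates_pos[OF assms(1) c])
    show "distributed P lborel (\<lambda>\<omega>. durations \<gamma> l c (\<lambda>r. X r \<omega>) j m) (exponential_density (?r j m))"
      if "j \<in> clock_set M l" for j m
      using durations_distributed[OF assms(1) that c] that by simp
  qed (rule durations_indep[OF assms(1)])
  also have "\<dots> = order_prob (clock_set M l) (rates l c) ws"
    using ws by (intro order_prob_cong) auto
  finally show ?thesis .
qed

lemma AE_no_ties_frozen:
  assumes "l < k" and c: "\<And>m. l \<noteq> 0 \<Longrightarrow> c m \<in> tree M l"
  shows "AE \<omega> in P. rings_in_order (clock_set M l) (durations \<gamma> l c (\<lambda>r. X r \<omega>))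
    (ring_order (clock_set M l) (durations \<gamma> l c (\<lambda>r. X r \<omega>)) n)"
proof -
  let ?r = "\<lambda>j m. if j \<in> clock_set M l then rates l c j m else 1"
  show ?thesis
  proof (rule AE_no_ties[OF finite_clock_set, where X = "\<lambda>j m \<omega>. durations \<gamma> l c (\<lambda>r. X r \<omega>) j m" and r = ?r])
    show "clock_set M l \<noteq> {}" using M_pos[of "Suc l"] assms(1) by (intro clock_set_nonempty) auto
    show "0 < ?r j m" for j m by (rule rates_pos[OF assms(1) c])
    show "distributed P lborel (\<lambda>\<omega>. durations \<gamma> l c (\<lambda>r. X r \<omega>) j m) (exponential_density (?r j m))"
      if "j \<in> clock_set M l" for j m
      using durations_distributed[OF assms(1) that c] that by simp
  qed (rule durations_indep[OF assms(1)])
qed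

text \<open>
  The probability with which the trap model on \<open>l\<close> levels, started uniformly, runs through
  \<open>x 0, \<dots>, x n\<close>.
\<close>

definition path_prob :: "nat \<Rightarrow> (nat \<Rightarrow> nat list) \<Rightarrow> nat \<Rightarrow> real" where
  "path_prob l x n = 1 / card (tree M l) * (\<Prod>m<n. pmf (jump_pmf M p l (x m)) (x (Suc m)))"

text \<open>
  All clocks of the first level have rate \<open>1\<close>, so each ring belongs to each label with the same
  probability, independently of the others.
\<close>

lemma law_of_states_1:
  assumes k: "1 \<le> k" and x: "\<And>m. m \<le> n \<Longrightarrow> x m \<in> tree M 1"
  shows "prob {\<omega> \<in> space P. \<forall>m\<le>n. states 1 \<omega> m = x m} = path_prob 1 x n"
proof -
  define ws where "ws = map (\<lambda>m. last (x m)) [0..<Suc n]"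
  define W where "W \<omega> = ring_order (clock_set M 0) (durations \<gamma> 0 (\<lambda>_. []) (\<lambda>r. X r \<omega>))" for \<omega>
  have len: "length ws = Suc n" by (simp add: ws_def)
  have xm: "last (x m) \<in> {1..M 1} \<and> x m = [last (x m)]" if "m \<le> n" for m
  proof -
    have "x m \<in> tree M (Suc 0)" using x[OF that] by simp
    then obtain z y where "x m = z @ [y]" "z \<in> tree M 0" "y \<in> {1..M (Suc 0)}" by (rule tree_SucE)
    then show ?thesis by simp
  qed
  have wsI: "set ws \<subseteq> clock_set M 0"
  proof
    fix a assume "a \<in> set ws"
    then obtain m where "m \<le> n" "a = last (x m)"
      by (auto simp: ws_def less_Suc_eq_le simp del: upt_Suc)
    then show "a \<in> clock_set M 0" using xm by simp
  qed
  have state: "states 1 \<omega> m = [last (W \<omega> (Suc m))]" for \<omega> m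
    unfolding One_nat_def chain.simps Let_def W_def by simp
  have lenW: "length (W \<omega> m) = m" for \<omega> m by (simp add: W_def)
  have "(\<forall>m\<le>n. states 1 \<omega> m = x m) \<longleftrightarrow> W \<omega> (length ws) = ws" for \<omega>
  proof -
    have nth: "W \<omega> (Suc n) ! m = last (W \<omega> (Suc m))" if "m \<le> n" for m
    proof -
      have "take (Suc m) (W \<omega> (Suc n)) = W \<omega> (Suc m)" using that unfolding W_def by (intro take_ring_order) simp
      moreover have "m < length (W \<omega> (Suc n))" using that by (simp add: W_def del: ring_order.simps)
      ultimately show ?thesis by (metis take_Suc_conv_app_nth last_snoc)
    qed
    have "(\<forall>m\<le>n. states 1 \<omega> m = x m) \<longleftrightarrow> (\<forall>m\<le>n. last (W \<omega> (Suc m)) = last (x m))"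
      unfolding state using xm by (metis last.simps)
    also have "\<dots> \<longleftrightarrow> (\<forall>m<Suc n. W \<omega> (Suc n) ! m = ws ! m)"
      by (auto simp: nth ws_def less_Suc_eq_le simp del: upt_Suc)
    also have "\<dots> \<longleftrightarrow> W \<omega> (Suc n) = ws"
      by (simp add: list_eq_iff_nth_eq len lenW)
    finally show ?thesis by (simp only: len)
  qed
  then have "prob {\<omega> \<in> space P. \<forall>m\<le>n. states 1 \<omega> m = x m} = prob {\<omega> \<in> space P. W \<omega> (length ws) = ws}"
    by simp
  also have "\<dots> = order_prob (clock_set M 0) (rates 0 (\<lambda>_. [])) ws"
    unfolding W_def using k wsI by (intro prob_ring_order_frozen) auto
  also have "\<dots> = order_prob {1..M 1} (\<lambda>_ _. 1) ws"
    unfolding clock_set_simps(1)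
  proof (rule order_prob_cong)
    show "set ws \<subseteq> {1..M 1}" using wsI by simp
  qed (auto simp: rates_def)
  also have "\<dots> = (1 / M 1) ^ Suc n"
    by (simp add: order_prob_def len del: power_Suc)
  also have "\<dots> = path_prob 1 x n"
  proof -
    have "(\<Prod>m<n. pmf (jump_pmf M p 1 (x m)) (x (Suc m))) = (\<Prod>m<n. 1 / M 1)"
      using x M_pos[of 1] k by (intro prod.cong refl pmf_jump_pmf_1) auto
    moreover have "card (tree M 1) = M 1" using card_tree_Suc[of M 0] by simp
    ultimately show ?thesis by (simp add: path_prob_def)
  qed
  finally show ?thesis .
qed

end

section \<open>The law of the states visited by the marks process\<close>

lemma rings_in_order_cong_counts:
  assumes "\<And>i m. i \<in> I \<Longrightarrow> m \<le> count_list ws i \<Longrightarrow> D i m = D' i m"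
  shows "rings_in_order I D ws \<longleftrightarrow> rings_in_order I D' ws"
  using assms
proof (induction ws rule: rev_induct)
  case (snoc i ws)
  have "ring_time D j (Suc (count_list ws j)) = ring_time D' j (Suc (count_list ws j))" if "j \<in> I" for j
    unfolding ring_time_def using that snoc.prems[of j] by (intro sum.cong) auto
  moreover have "rings_in_order I D ws \<longleftrightarrow> rings_in_order I D' ws"
    using snoc.prems by (intro snoc.IH) auto
  ultimately show ?case by (auto simp: rings_in_order_snoc)
qed simp

context driver_space
begin

text \<open>
  The drivers of the spacings on level \<open>l + 1\<close>, disjoint from \<open>chain_drivers l\<close> and from the refresh
  variables of level \<open>l + 1\<close>.
\<close>

definition mark_clocks :: "nat \<Rightarrow> driver set" where
  "mark_clocks l = range (Clock l) \<union> {Gap (Suc l) x i | x i. 1 \<le> x}"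

text \<open>
  States of level \<open>l\<close>, refresh variables and ring order depend on disjoint sets of drivers once the
  states that govern the spacings of clock \<open>0\<close> are fixed.
\<close>

lemma prob_prefix_factor:
  assumes l: "1 \<le> l" "l < k" and c: "\<And>m. c m \<in> tree M l" and u: "\<And>j. u j \<in> {1..M (Suc l)}"
    and ws: "set ws \<subseteq> clock_set M l"
  shows "prob {\<omega> \<in> space P. (\<forall>j\<le>N. states l \<omega> j = c j \<and> nat \<lfloor>X (Refresh (Suc l) j) \<omega>\<rfloor> = u j) \<and>
      ring_order (clock_set M l) (durations \<gamma> l c (\<lambda>r. X r \<omega>)) (length ws) = ws}
    = prob {\<omega> \<in> space P. \<forall>j\<le>N. states l \<omega> j = c j} * (1 / M (Suc l)) ^ Suc N *
      order_prob (clock_set M l) (rates l c) ws"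
proof -
  let ?I = "clock_set M l"
  \<comment> \<open>block \<open>0\<close> drives the states of level \<open>l\<close>, block \<open>1\<close> the spacings, and each further block
    consists of one refresh variable\<close>
  define K where "K j = (if j = 0 then chain_drivers l else if j = 1 then mark_clocks l else {Refresh (Suc l) (j - 2)})" for j
  define B where "B j = (if j = 0 then {d \<in> space (PiM (chain_drivers l) (\<lambda>_. borel)). \<forall>j\<le>N. chain M \<gamma> l d j = c j}
     else if j = 1 then {d \<in> space (PiM (mark_clocks l) (\<lambda>_. borel)). ring_order ?I (durations \<gamma> l c d) (length ws) = ws}
     else {d \<in> space (PiM {Refresh (Suc l) (j - 2)} (\<lambda>_. borel)). nat \<lfloor>d (Refresh (Suc l) (j - 2))\<rfloor> = u (j - 2)})"
    for j :: nat
  let ?R = "\<lambda>j \<omega>. \<lambda>i\<in>K j. X i \<omega>"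
  have R_space: "?R j \<omega> \<in> space (PiM (K j) (\<lambda>_. borel))" for j \<omega>
    by (auto simp: space_PiM)
  have 0: "?R 0 \<omega> \<in> B 0 \<longleftrightarrow> (\<forall>j\<le>N. states l \<omega> j = c j)" for \<omega>
  proof -
    have "chain M \<gamma> l (?R 0 \<omega>) = states l \<omega>" by (rule chain_cong) (simp add: K_def)
    moreover have R_space_0: "?R 0 \<omega> \<in> space (PiM (K 0) (\<lambda>_. borel))" by (rule R_space)
    ultimately show ?thesis using R_space_0 by (simp add: B_def K_def)
  qed
  have 1: "?R 1 \<omega> \<in> B 1 \<longleftrightarrow> ring_order ?I (durations \<gamma> l c (\<lambda>r. X r \<omega>)) (length ws) = ws" for \<omega>
  proof -
    have "ring_order ?I (durations \<gamma> l c (?R 1 \<omega>)) n = ring_order ?I (durations \<gamma> l c (\<lambda>r. X r \<omega>)) n" for n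
      by (rule ring_order_cong) (auto simp: durations_def K_def mark_clocks_def)
    moreover have R_space_1: "?R 1 \<omega> \<in> space (PiM (K 1) (\<lambda>_. borel))" by (rule R_space)
    ultimately show ?thesis using R_space_1 by (simp add: B_def K_def)
  qed
  have 2: "?R (Suc (Suc j)) \<omega> \<in> B (Suc (Suc j)) \<longleftrightarrow> nat \<lfloor>X (Refresh (Suc l) j) \<omega>\<rfloor> = u j" for j \<omega>
  proof -
    have "?R (Suc (Suc j)) \<omega> \<in> space (PiM (K (Suc (Suc j))) (\<lambda>_. borel))" by (rule R_space)
    then show ?thesis by (simp add: B_def K_def)
  qed
  have B: "B j \<in> sets (PiM (K j) (\<lambda>_. borel))" for j
  proof -
    consider "j = 0" | "j = 1" | i where "j = Suc (Suc i)"
      by (metis One_nat_def not0_implies_Suc)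
    then show ?thesis
    proof cases
      case 1
      show ?thesis unfolding 1 B_def K_def using chain_prefix_sets by (simp only: if_True refl)
    next
      case 2
      have "(\<lambda>d. durations \<gamma> l c d i m) \<in> borel_measurable (PiM (mark_clocks l) (\<lambda>_. borel))" if "i \<in> ?I" for i m
      proof (cases "i = 0")
        case True
        have "(\<lambda>d. d (Clock l m)) \<in> borel_measurable (PiM (mark_clocks l) (\<lambda>_. borel))"
          by (rule measurable_component_singleton) (simp add: mark_clocks_def)
        then have "(\<lambda>d. \<gamma> l (c m) * d (Clock l m)) \<in> borel_measurable (PiM (mark_clocks l) (\<lambda>_. borel))"
          by (intro borel_measurable_times borel_measurable_const)
        with True show ?thesis by (simp add: durations_def)
      next
        case False
        have "(\<lambda>d. d (Gap (Suc l) i m)) \<in> borel_measurable (PiM (mark_clocks l) (\<lambda>_. borel))"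
          by (rule measurable_component_singleton) (use False in \<open>simp add: mark_clocks_def\<close>)
        with False show ?thesis by (simp add: durations_def)
      qed
      then have "(\<lambda>d. ring_order ?I (durations \<gamma> l c d) (length ws)) \<in> PiM (mark_clocks l) (\<lambda>_. borel) \<rightarrow>\<^sub>M count_space UNIV"
        by (intro ring_order_measurable) auto
      then have "{d \<in> space (PiM (mark_clocks l) (\<lambda>_. borel)). ring_order ?I (durations \<gamma> l c d) (length ws) = ws}
          \<in> sets (PiM (mark_clocks l) (\<lambda>_. borel))"
        by (rule Collect_eq_sets)
      then show ?thesis
        unfolding 2 B_def K_def by (simp only: if_True if_False refl one_neq_zero)
    next
      case (3 i)
      have "(\<lambda>d. nat \<lfloor>d (Refresh (Suc l) i) :: real\<rfloor>) \<in> PiM {Refresh (Suc l) i} (\<lambda>_. borel) \<rightarrow>\<^sub>M count_space UNIV"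
      proof -
        have "(\<lambda>d. d (Refresh (Suc l) i)) \<in> borel_measurable (PiM {Refresh (Suc l) i} (\<lambda>_. borel))"
          by (rule measurable_component_singleton) simp
        then show ?thesis by measurable
      qed
      then have "{d \<in> space (PiM {Refresh (Suc l) i} (\<lambda>_. borel)). nat \<lfloor>d (Refresh (Suc l) i) :: real\<rfloor> = u i}
          \<in> sets (PiM {Refresh (Suc l) i} (\<lambda>_. borel))"
        by (rule Collect_eq_sets)
      then show ?thesis by (simp add: 3 B_def K_def)
    qed
  qed
  have split: "(\<forall>j\<in>{..Suc (Suc N)}. Q j) \<longleftrightarrow> Q 0 \<and> Q 1 \<and> (\<forall>j\<le>N. Q (Suc (Suc j)))" for Q
    unfolding atMost_Suc_eq_insert_0 by auto
  have "{\<omega> \<in> space P. (\<forall>j\<le>N. states l \<omega> j = c j \<and> nat \<lfloor>X (Refresh (Suc l) j) \<omega>\<rfloor> = u j) \<and>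
      ring_order ?I (durations \<gamma> l c (\<lambda>r. X r \<omega>)) (length ws) = ws}
    = {\<omega> \<in> space P. \<forall>j\<in>{..Suc (Suc N)}. ?R j \<omega> \<in> B j}"
    unfolding split 0 1 2 by blast
  also have "prob \<dots> = (\<Prod>j\<in>{..Suc (Suc N)}. prob {\<omega> \<in> space P. ?R j \<omega> \<in> B j})"
  proof (rule prob_blocks[OF indep])
    show "K j \<subseteq> drivers k" for j
      using chain_drivers_subset[of l] l by (auto simp: K_def mark_clocks_def drivers_def)
    show "disjoint_family_on K {..Suc (Suc N)}"
      by (auto simp: disjoint_family_on_def K_def chain_drivers_def mark_clocks_def split: if_splits)
  qed (use B in auto)
  also have "\<dots> = prob {\<omega> \<in> space P. ?R 0 \<omega> \<in> B 0} * (prob {\<omega> \<in> space P. ?R 1 \<omega> \<in> B 1} *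
      (\<Prod>j\<le>N. prob {\<omega> \<in> space P. ?R (Suc (Suc j)) \<omega> \<in> B (Suc (Suc j))}))"
    unfolding prod.atMost_Suc_shift One_nat_def by simp
  also have "(\<Prod>j\<le>N. prob {\<omega> \<in> space P. ?R (Suc (Suc j)) \<omega> \<in> B (Suc (Suc j))}) = (\<Prod>j\<le>N. 1 / M (Suc l))"
    unfolding 2 using l u by (intro prod.cong refl refresh) auto
  also have "prob {\<omega> \<in> space P. ?R 1 \<omega> \<in> B 1} = order_prob ?I (rates l c) ws"
    unfolding 1 using l c ws by (intro prob_ring_order_frozen) auto
  finally show ?thesis unfolding 0 by simp
qed

text \<open>
  The states of level \<open>l\<close> enforced by the ring order.  Continuing with \<open>z 0\<close> keeps the sequence in
  the tree, so that all rates are positive.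
\<close>

definition forced_states :: "(nat \<Rightarrow> nat list) \<Rightarrow> nat list \<Rightarrow> nat \<Rightarrow> nat list" where
  "forced_states z ws m = (if m \<le> count_list ws 0 then refresh_trace z ws ! m else z 0)"

text \<open>
  The probability that level \<open>l + 1\<close> runs through \<open>z m @ [y m]\<close> and the clocks ring in the order \<open>ws\<close>.
\<close>

definition weight :: "nat \<Rightarrow> (nat \<Rightarrow> nat list) \<Rightarrow> (nat \<Rightarrow> nat) \<Rightarrow> nat list \<Rightarrow> real" where
  "weight l z y ws = (if consistent z y ws then path_prob l (forced_states z ws) (count_list ws 0) *
      (1 / M (Suc l)) ^ Suc (count_list ws 0) * order_prob (clock_set M l) (rates l (forced_states z ws)) ws else 0)"

lemma forced_states_in_tree:
  assumes "\<And>m. z m \<in> tree M l"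
  shows "forced_states z ws m \<in> tree M l"
proof -
  have "refresh_trace z ws ! m \<in> set (refresh_trace z ws)" if "m \<le> count_list ws 0"
    using that by (intro nth_mem) (simp add: length_trace)
  then show ?thesis using set_trace[of z ws] assms by (auto simp: forced_states_def)
qed

lemma forced_states_snoc: "m \<le> count_list ws 0 \<Longrightarrow> forced_states z (ws @ [i]) m = forced_states z ws m"
  by (simp add: forced_states_def trace_snoc nth_append length_trace)

lemma order_prob_forced_snoc:
  assumes l: "1 \<le> l" and i: "i \<in> clock_set M l" and ws: "set ws \<subseteq> clock_set M l" and z: "consistent z y ws"
  shows "order_prob (clock_set M l) (rates l (forced_states z (ws @ [i]))) (ws @ [i])
    = order_prob (clock_set M l) (rates l (forced_states z ws)) ws *
      ((if i = 0 then 1 / \<gamma> l (z (length ws)) else 1) / (1 / \<gamma> l (z (length ws)) + M (Suc l)))"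
proof -
  let ?I = "clock_set M l" and ?r = "rates l (forced_states z (ws @ [i]))"
  have "order_prob ?I ?r ws = order_prob ?I (rates l (forced_states z ws)) ws"
    using ws by (intro order_prob_cong) (auto simp: rates_def forced_states_snoc)
  moreover have r: "?r j (count_list ws j) = (if j = 0 then 1 / \<gamma> l (z (length ws)) else 1)" for j
    using trace_last[OF z] by (simp add: rates_def forced_states_snoc) (simp add: forced_states_def)
  moreover have "(\<Sum>j\<in>?I. ?r j (count_list ws j)) = 1 / \<gamma> l (z (length ws)) + M (Suc l)"
  proof -
    have "?I = insert 0 {1..M (Suc l)}" using l by auto
    then show ?thesis unfolding r by simp
  qed
  ultimately show ?thesis by (simp add: order_prob_snoc)
qed

text \<open>
  This is where the choice of the activation parameters enters.  One further ring multiplies the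
  weight by the probability that the clock in question rings next.  For clock \<open>0\<close> this is \<open>p\<close>, and
  the lower transition probability and a factor \<open>1 / M\<close> for the refreshed label come in addition; for
  the one label that fits it is \<open>(1 - p) / M\<close>, provided that the ancestor does not change.
\<close>

lemma sum_weight_snoc:
  assumes l: "1 \<le> l" "l < k" and z: "\<And>m. z m \<in> tree M l" and y: "\<And>m. y m \<in> {1..M (Suc l)}"
    and ws: "set ws \<subseteq> clock_set M l"
  shows "(\<Sum>i\<in>clock_set M l. weight l z y (ws @ [i])) = weight l z y ws *
    pmf (jump_pmf M p (Suc l) (z (length ws) @ [y (length ws)])) (z (Suc (length ws)) @ [y (Suc (length ws))])"
proof (cases "consistent z y ws")
  case False
  then show ?thesis by (simp add: weight_def consistent_snoc)
next
  case True
  let ?n = "length ws" and ?N = "count_list ws 0" and ?m = "real (M (Suc l))"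
  let ?g = "\<gamma> l (z (length ws))" and ?J = "pmf (jump_pmf M p l (z (length ws))) (z (Suc (length ws)))"
  have g: "0 < ?g" using \<gamma>_pos[OF _ z] l by auto
  have m: "0 < ?m" using M_pos[of "Suc l"] l by simp
  have eqs: "1 / ?g / (1 / ?g + ?m) = p l (z ?n)" "1 / (1 / ?g + ?m) = (1 - p l (z ?n)) / ?m"
  proof -
    have p: "p l (z ?n) = 1 / (1 + ?m * ?g)" using p_eq[of l "z ?n"] l z by simp
    have pos': "0 < 1 + ?m * ?g" using g m by (simp add: add_pos_pos)
    show "1 / ?g / (1 / ?g + ?m) = p l (z ?n)" unfolding p using g by (simp add: field_simps)
    have "1 / (1 / ?g + ?m) = ?g / (1 + ?m * ?g)" using g by (simp add: field_simps)
    also have "\<dots> = ?m * ?g / (1 + ?m * ?g) / ?m" using m by simp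
    also have "?m * ?g / (1 + ?m * ?g) = 1 - 1 / (1 + ?m * ?g)"
      using pos' by (simp add: diff_divide_eq_iff del: of_nat_Suc)
    finally show "1 / (1 / ?g + ?m) = (1 - p l (z ?n)) / ?m" unfolding p .
  qed
  have zero: "weight l z y (ws @ [0]) = weight l z y ws * (?J / ?m * (1 / ?g / (1 / ?g + ?m)))"
  proof -
    have "path_prob l (forced_states z (ws @ [0])) (Suc ?N) = path_prob l (forced_states z ws) ?N * ?J"
    proof -
      have "forced_states z (ws @ [0]) (Suc ?N) = z (Suc ?n)"
        by (simp add: forced_states_def trace_snoc nth_append length_trace)
      moreover have "forced_states z (ws @ [0]) ?N = z ?n"
        using trace_last[OF True] by (simp add: forced_states_snoc) (simp add: forced_states_def)
      moreover have "(\<Prod>m<?N. pmf (jump_pmf M p l (forced_states z (ws @ [0]) m)) (forced_states z (ws @ [0]) (Suc m)))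
          = (\<Prod>m<?N. pmf (jump_pmf M p l (forced_states z ws m)) (forced_states z ws (Suc m)))"
        by (intro prod.cong refl) (simp add: forced_states_snoc)
      ultimately show ?thesis by (simp add: path_prob_def)
    qed
    moreover have "consistent z y (ws @ [0])" using True by (simp add: consistent_snoc)
    moreover have "0 \<in> clock_set M l" using l by simp
    moreover from this have "order_prob (clock_set M l) (rates l (forced_states z (ws @ [0]))) (ws @ [0])
        = order_prob (clock_set M l) (rates l (forced_states z ws)) ws * (1 / ?g / (1 / ?g + ?m))"
      using order_prob_forced_snoc[OF l(1) _ ws True, of 0]
      by (simp only: if_True refl simp_thms)
    moreover have "count_list (ws @ [0]) 0 = Suc ?N" by simp
    ultimately show ?thesis
      using True by (simp only: weight_def if_True power_Suc divide_inverse mult_1 mult_ac)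
  qed
  have path: "path_prob l (forced_states z (ws @ [i])) ?N = path_prob l (forced_states z ws) ?N" for i
    unfolding path_prob_def by (intro arg_cong2[where f = "(*)"] prod.cong refl) (simp add: forced_states_snoc)
  have pos: "weight l z y (ws @ [i]) =
      (if i = y (Suc ?n) then if z ?n = z (Suc ?n) then weight l z y ws * (1 / (1 / ?g + ?m)) else 0 else 0)"
    if i: "i \<in> {1..M (Suc l)}" for i
  proof -
    have "i \<noteq> 0" "i \<in> clock_set M l" using i l by auto
    then show ?thesis
      using True by (auto simp: weight_def consistent_snoc path order_prob_forced_snoc[OF l(1) _ ws True])
  qed
  have "(\<Sum>i\<in>clock_set M l. weight l z y (ws @ [i]))
      = weight l z y (ws @ [0]) + (\<Sum>i\<in>{1..M (Suc l)}. weight l z y (ws @ [i]))"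
  proof -
    have "clock_set M l = insert 0 {1..M (Suc l)}" using l by auto
    then show ?thesis by simp
  qed
  also have "(\<Sum>i\<in>{1..M (Suc l)}. weight l z y (ws @ [i]))
      = (if z ?n = z (Suc ?n) then weight l z y ws * (1 / (1 / ?g + ?m)) else 0)"
  proof -
    have "(\<Sum>i\<in>{1..M (Suc l)}. weight l z y (ws @ [i])) = (\<Sum>i\<in>{1..M (Suc l)}. if i = y (Suc ?n) then
        if z ?n = z (Suc ?n) then weight l z y ws * (1 / (1 / ?g + ?m)) else 0 else 0)"
      by (rule sum.cong[OF refl pos])
    also have "\<dots> = (if z ?n = z (Suc ?n) then weight l z y ws * (1 / (1 / ?g + ?m)) else 0)"
      using y[of "Suc ?n"] by (subst sum.delta) auto
    finally show ?thesis .
  qed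
  finally have "(\<Sum>i\<in>clock_set M l. weight l z y (ws @ [i])) = weight l z y ws *
      ((p l (z ?n) * ?J + (if z ?n = z (Suc ?n) then 1 - p l (z ?n) else 0)) / ?m)"
    unfolding zero eqs by (auto simp: add_divide_distrib distrib_left)
  also have "(p l (z ?n) * ?J + (if z ?n = z (Suc ?n) then 1 - p l (z ?n) else 0)) / ?m
      = pmf (jump_pmf M p (Suc l) (z ?n @ [y ?n])) (z (Suc ?n) @ [y (Suc ?n)])"
    using l z y M_pos p_range by (intro pmf_jump_pmf_Suc[symmetric]) auto
  finally show ?thesis .
qed

lemma sum_weight:
  assumes l: "1 \<le> l" "l < k" and z: "\<And>m. z m \<in> tree M l" and y: "\<And>m. y m \<in> {1..M (Suc l)}"
  shows "(\<Sum>ws | set ws \<subseteq> clock_set M l \<and> length ws = n. weight l z y ws)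
    = path_prob (Suc l) (\<lambda>m. z m @ [y m]) n"
proof (induction n)
  case 0
  have "{ws. set ws \<subseteq> clock_set M l \<and> length ws = 0} = {[]}" by auto
  then show ?case by (simp add: weight_def path_prob_def card_tree_Suc)
next
  case (Suc n)
  let ?I = "clock_set M l"
  let ?L = "\<lambda>n. {ws. set ws \<subseteq> ?I \<and> length ws = n}"
  have "(\<Sum>vs\<in>?L (Suc n). weight l z y vs) = (\<Sum>ws\<in>?L n. \<Sum>i\<in>?I. weight l z y (ws @ [i]))"
    by (rule sum_lists_snoc)
  also have "\<dots> = (\<Sum>ws\<in>?L n. weight l z y ws *
      pmf (jump_pmf M p (Suc l) (z n @ [y n])) (z (Suc n) @ [y (Suc n)]))"
    using sum_weight_snoc[OF l z y] by (intro sum.cong refl) auto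
  also have "\<dots> = path_prob (Suc l) (\<lambda>m. z m @ [y m]) n *
      pmf (jump_pmf M p (Suc l) (z n @ [y n])) (z (Suc n) @ [y (Suc n)])"
    by (simp only: sum_distrib_right[symmetric] Suc)
  finally show ?case by (simp add: path_prob_def)
qed

text \<open>
  The event is decomposed according to the ring order, each part having probability \<open>weight l z y ws\<close>.
\<close>

lemma law_of_states_Suc:
  assumes l: "1 \<le> l" "l < k" and z: "\<And>m. z m \<in> tree M l" and y: "\<And>m. y m \<in> {1..M (Suc l)}"
    and IH: "\<And>x n. (\<And>m. x m \<in> tree M l) \<Longrightarrow>
      prob {\<omega> \<in> space P. \<forall>m\<le>n. states l \<omega> m = x m} = path_prob l x n"
  shows "prob {\<omega> \<in> space P. \<forall>m\<le>n. states (Suc l) \<omega> m = z m @ [y m]} = path_prob (Suc l) (\<lambda>m. z m @ [y m]) n"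
proof -
  let ?I = "clock_set M l"
  let ?L = "{ws. set ws \<subseteq> ?I \<and> length ws = n}"
  define W where "W \<omega> = ring_order ?I (durations \<gamma> l (states l \<omega>) (\<lambda>r. X r \<omega>))" for \<omega>
  define E where "E ws = {\<omega> \<in> space P. (\<forall>m\<le>n. states (Suc l) \<omega> m = z m @ [y m]) \<and> W \<omega> n = ws}" for ws
  have I: "finite ?I" "?I \<noteq> {}" using l by auto
  have prob_E: "prob (E ws) = weight l z y ws" if ws: "ws \<in> ?L" for ws
  proof -
    let ?N = "count_list ws 0"
    have len: "length ws = n" using ws by simp
    have state: "states (Suc l) \<omega> m = states l \<omega> (count_list (W \<omega> m) 0) @
        [if W \<omega> m = [] \<or> last (W \<omega> m) = 0 then nat \<lfloor>X (Refresh (Suc l) (count_list (W \<omega> m) 0)) \<omega>\<rfloor> else last (W \<omega> m)]"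
      for \<omega> m
      using l by (simp only: chain.simps Let_def W_def) simp
    have "(\<forall>m\<le>n. states (Suc l) \<omega> m = z m @ [y m]) \<longleftrightarrow> consistent z y ws \<and>
        (\<forall>j\<le>?N. states l \<omega> j = refresh_trace z ws ! j \<and> nat \<lfloor>X (Refresh (Suc l) j) \<omega>\<rfloor> = refresh_trace y ws ! j)"
      if W: "W \<omega> n = ws" for \<omega>
    proof -
      have "W \<omega> m = take m ws" if "m \<le> length ws" for m
        using take_ring_order[of m n ?I] that W len unfolding W_def by metis
      then show ?thesis
        using reconstruct[of ws "states l \<omega>" "\<lambda>j. nat \<lfloor>X (Refresh (Suc l) j) \<omega>\<rfloor>" z y]
        by (simp only: state len cong: conj_cong imp_cong)
    qed
    then have E: "E ws = {\<omega> \<in> space P. consistent z y ws \<and>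
        (\<forall>j\<le>?N. states l \<omega> j = refresh_trace z ws ! j \<and> nat \<lfloor>X (Refresh (Suc l) j) \<omega>\<rfloor> = refresh_trace y ws ! j) \<and> W \<omega> n = ws}"
      unfolding E_def by blast
    show ?thesis
    proof (cases "consistent z y ws")
      case False
      then show ?thesis by (simp add: E weight_def)
    next
      case True
      define c where "c = forced_states z ws"
      define u where "u j = (if j \<le> ?N then refresh_trace y ws ! j else y 0)" for j
      have c: "c m \<in> tree M l" for m unfolding c_def using z by (rule forced_states_in_tree)
      have u: "u j \<in> {1..M (Suc l)}" for j
      proof -
        have "refresh_trace y ws ! j \<in> set (refresh_trace y ws)" if "j \<le> ?N"
          using that by (intro nth_mem) (simp add: length_trace)
        then show ?thesis using set_trace[of y ws] y by (auto simp: u_def)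
      qed
      have W: "W \<omega> n = ws \<longleftrightarrow> ring_order ?I (durations \<gamma> l c (\<lambda>r. X r \<omega>)) (length ws) = ws"
        if "\<forall>j\<le>?N. states l \<omega> j = c j" for \<omega>
        unfolding W_def len[symmetric] using that by (intro ring_order_eq_cong) (auto simp: durations_def)
      have "E ws = {\<omega> \<in> space P. (\<forall>j\<le>?N. states l \<omega> j = c j \<and> nat \<lfloor>X (Refresh (Suc l) j) \<omega>\<rfloor> = u j) \<and>
          ring_order ?I (durations \<gamma> l c (\<lambda>r. X r \<omega>)) (length ws) = ws}"
      proof -
        have "(\<forall>j\<le>?N. states l \<omega> j = refresh_trace z ws ! j \<and> nat \<lfloor>X (Refresh (Suc l) j) \<omega>\<rfloor> = refresh_trace y ws ! j)
          \<longleftrightarrow> (\<forall>j\<le>?N. states l \<omega> j = c j \<and> nat \<lfloor>X (Refresh (Suc l) j) \<omega>\<rfloor> = u j)" for \<omega>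
          by (simp add: c_def u_def forced_states_def cong: conj_cong imp_cong)
        then show ?thesis unfolding E using True W by blast
      qed
      then have "prob (E ws) = prob {\<omega> \<in> space P. \<forall>j\<le>?N. states l \<omega> j = c j} *
          (1 / M (Suc l)) ^ Suc ?N * order_prob ?I (rates l c) ws"
        using ws by (simp only:) (intro prob_prefix_factor l c u, simp)
      also have "\<dots> = weight l z y ws"
        using True by (simp only: IH[OF c]) (simp add: weight_def c_def)
      finally show ?thesis .
    qed
  qed
  have chain_drivers: "X r \<in> borel_measurable P" if "r \<in> chain_drivers (Suc l)" for r
    using chain_drivers_subset[of "Suc l"] that l by (intro X_measurable) auto
  have state_meas: "(\<lambda>\<omega>. states l' \<omega> m) \<in> P \<rightarrow>\<^sub>M count_space UNIV" if "l' \<le> k" for l' m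
    using chain_drivers_subset[OF that] by (intro chain_measurable X_measurable) auto
  have W_meas: "(\<lambda>\<omega>. W \<omega> n) \<in> P \<rightarrow>\<^sub>M count_space UNIV"
    unfolding W_def
  proof (rule ring_order_measurable[OF I(1)])
    fix i m
    show "(\<lambda>\<omega>. durations \<gamma> l (states l \<omega>) (\<lambda>r. X r \<omega>) i m) \<in> borel_measurable P" if i: "i \<in> ?I"
    proof (cases "i = 0")
      case True
      have "(\<lambda>\<omega>. \<gamma> l (states l \<omega> m)) \<in> borel_measurable P"
        using l by (intro measurable_compose[OF state_meas]) auto
      moreover have "X (Clock l m) \<in> borel_measurable P" using l by (intro chain_drivers) (auto simp: chain_drivers_def)
      ultimately show ?thesis using True by (simp add: durations_def)
    next
      case False
      then have "X (Gap (Suc l) i m) \<in> borel_measurable P" by (intro chain_drivers) (auto simp: chain_drivers_def)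
      with False show ?thesis by (simp add: durations_def)
    qed
  qed
  have E_meas: "E ws \<in> events" for ws
  proof -
    have "{\<omega> \<in> space P. states (Suc l) \<omega> m = z m @ [y m]} \<in> events" for m
      using l by (intro Collect_eq_sets state_meas) auto
    then have "{\<omega> \<in> space P. \<forall>m\<in>{..n}. states (Suc l) \<omega> m = z m @ [y m]} \<in> events"
      by (intro sets.sets_Collect_finite_All) auto
    moreover have "{\<omega> \<in> space P. W \<omega> n = ws} \<in> events"
      using W_meas by (rule Collect_eq_sets)
    ultimately
    have "{\<omega> \<in> space P. (\<forall>m\<in>{..n}. states (Suc l) \<omega> m = z m @ [y m]) \<and> W \<omega> n = ws} \<in> events"
      by (intro sets.sets_Collect_conj)
    then show ?thesis by (simp only: E_def Ball_def atMost_iff)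
  qed
  have "{\<omega> \<in> space P. \<forall>m\<le>n. states (Suc l) \<omega> m = z m @ [y m]} = (\<Union>ws\<in>?L. E ws)"
  proof -
    have "W \<omega> n \<in> ?L" for \<omega> using set_ring_order_subset[OF I] by (auto simp: W_def)
    then show ?thesis unfolding E_def by blast
  qed
  also have "prob \<dots> = (\<Sum>ws\<in>?L. prob (E ws))"
  proof (rule finite_measure_finite_Union)
    show "finite ?L" using finite_lists_length_eq[OF I(1)] by simp
    show "disjoint_family_on E ?L" by (auto simp: disjoint_family_on_def E_def)
  qed (use E_meas in auto)
  also have "\<dots> = path_prob (Suc l) (\<lambda>m. z m @ [y m]) n"
    using prob_E by (simp add: sum_weight[OF l z y, symmetric])
  finally show ?thesis .
qed

theorem law_of_states:
  assumes "l \<in> {1..k}" "\<And>m. x m \<in> tree M l"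
  shows "prob {\<omega> \<in> space P. \<forall>m\<le>n. states l \<omega> m = x m} = path_prob l x n"
  using assms
proof (induction l arbitrary: x n)
  case (Suc l)
  show ?case
  proof (cases "l = 0")
    case True
    then show ?thesis using law_of_states_1[of n x] Suc.prems by (simp del: chain.simps)
  next
    case False
    define z where "z m = butlast (x m)" for m
    define y where "y m = last (x m)" for m
    have "x m = z m @ [y m] \<and> z m \<in> tree M l \<and> y m \<in> {1..M (Suc l)}" for m
    proof -
      obtain z' y' where "x m = z' @ [y']" "z' \<in> tree M l" "y' \<in> {1..M (Suc l)}"
        using Suc.prems(2)[of m] by (rule tree_SucE)
      then show ?thesis by (simp add: z_def y_def)
    qed
    note zy = this
    then have "x = (\<lambda>m. z m @ [y m])" by blast
    then show ?thesis
      using law_of_states_Suc[of l z y n] zy Suc False by (simp del: chain.simps)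
  qed
qed simp

end

section \<open>A jump path is determined in law by its skeleton\<close>

definition skeleton_space :: "(nat \<Rightarrow> nat list \<times> real) measure" where
  "skeleton_space = (\<Pi>\<^sub>M n\<in>UNIV. count_space UNIV \<Otimes>\<^sub>M borel)"

definition cylinder :: "nat \<Rightarrow> (nat \<Rightarrow> nat list) \<Rightarrow> (nat \<Rightarrow> real) \<Rightarrow> (nat \<Rightarrow> nat list \<times> real) set" where
  "cylinder n x s = {y. \<forall>m\<le>n. fst (y m) = x m \<and> s m < snd (y m)}"

lemma space_skeleton_space [simp]: "space skeleton_space = UNIV"
  by (auto simp: skeleton_space_def space_PiM space_pair_measure)

lemma fst_measurable: "(\<lambda>y. fst (y n)) \<in> skeleton_space \<rightarrow>\<^sub>M count_space UNIV"
  and snd_measurable: "(\<lambda>y. snd (y n)) \<in> borel_measurable skeleton_space"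
proof -
  have "(\<lambda>y. y n) \<in> skeleton_space \<rightarrow>\<^sub>M count_space UNIV \<Otimes>\<^sub>M borel"
    unfolding skeleton_space_def by (rule measurable_component_singleton) simp
  then show "(\<lambda>y. fst (y n)) \<in> skeleton_space \<rightarrow>\<^sub>M count_space UNIV" "(\<lambda>y. snd (y n)) \<in> borel_measurable skeleton_space"
    by (auto intro: measurable_compose[OF _ measurable_fst] measurable_compose[OF _ measurable_snd])
qed

lemma cylinder_sets: "cylinder n x s \<in> sets skeleton_space"
proof -
  have "{y \<in> space skeleton_space. fst (y m) = x m \<and> s m < snd (y m)} \<in> sets skeleton_space" for m
  proof (rule sets.sets_Collect_conj)
    show "{y \<in> space skeleton_space. fst (y m) = x m} \<in> sets skeleton_space"
      using measurable_sets[OF fst_measurable, of "{x m}" m] by (simp add: vimage_def)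
    show "{y \<in> space skeleton_space. s m < snd (y m)} \<in> sets skeleton_space"
      using snd_measurable by (intro borel_measurable_less) auto
  qed
  then have "{y \<in> space skeleton_space. \<forall>m\<in>{..n}. fst (y m) = x m \<and> s m < snd (y m)} \<in> sets skeleton_space"
    by (intro sets.sets_Collect_finite_All) auto
  then show ?thesis by (simp add: cylinder_def Ball_def)
qed

text \<open>
  The state and the holding time at one index are measurable with respect to cylinders because the
  conditions at the smaller indices can be relaxed to countably many alternatives: any states,
  and lower bounds \<open>- r\<close> on the holding times.
\<close>

lemma sets_skeleton_space:
  "sets skeleton_space = sigma_sets UNIV (insert {} {cylinder n x s | n x s. True})"
proof (rule antisym)
  let ?E = "insert {} {cylinder n x s | n x s. True}"
  define S where "S = sigma UNIV ?E"
  have S: "sets S = sigma_sets UNIV ?E" "space S = UNIV" unfolding S_def by auto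
  have cyl: "cylinder n x s \<in> sets S" for n x s
    unfolding S by (rule sigma_sets.Basic) auto
  define D where "D m a b = {y :: nat \<Rightarrow> nat list \<times> real. fst (y m) = a \<and> b < snd (y m)}" for m a b
  have D: "D m a b \<in> sets S" for m a b
  proof -
    have "D m a b = (\<Union>(x, r)\<in>UNIV. cylinder m (\<lambda>i. if i = m then a else (x :: nat list list) ! i)
        (\<lambda>i. if i = m then b else - real r))" (is "_ = ?U")
    proof (intro equalityI subsetI)
      fix y assume y: "y \<in> D m a b"
      obtain r where r: "(\<Sum>i\<le>m. \<bar>snd (y i)\<bar>) < real r" using reals_Archimedean2 by blast
      have "- real r < snd (y i)" if "i \<le> m" for i
      proof -
        have "\<bar>snd (y i)\<bar> \<le> (\<Sum>i\<le>m. \<bar>snd (y i)\<bar>)" using that by (intro member_le_sum) auto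
        with r show ?thesis by linarith
      qed
      moreover have "map (\<lambda>i. fst (y i)) [0..<Suc m] ! i = fst (y i)" if "i \<le> m" for i
        using that by (subst nth_map) (auto simp del: upt_Suc)
      ultimately have "y \<in> cylinder m (\<lambda>i. if i = m then a else map (\<lambda>i. fst (y i)) [0..<Suc m] ! i)
          (\<lambda>i. if i = m then b else - real r)"
        using y by (auto simp: cylinder_def D_def simp del: upt_Suc)
      then show "y \<in> ?U" by blast
    qed (auto simp: cylinder_def D_def)
    also have "\<dots> \<in> sets S" by (intro sets.countable_UN') (auto intro: cyl)
    finally show ?thesis .
  qed
  have fst: "(\<lambda>y. fst (y m)) \<in> S \<rightarrow>\<^sub>M count_space UNIV" for m
  proof (subst measurable_count_space_eq2_countable, intro conjI ballI)
    fix a :: "nat list"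
    have "(\<lambda>y. fst (y m)) -` {a} \<inter> space S = (\<Union>r. D m a (- real r))"
    proof (intro equalityI subsetI)
      fix y assume y: "y \<in> (\<lambda>y. fst (y m)) -` {a} \<inter> space S"
      obtain r where "- snd (y m) < real r" using reals_Archimedean2 by blast
      with y have "y \<in> D m a (- real r)" by (simp add: D_def)
      then show "y \<in> (\<Union>r. D m a (- real r))" by blast
    qed (auto simp: D_def S)
    also have "\<dots> \<in> sets S" using D by (intro sets.countable_UN') auto
    finally show "(\<lambda>y. fst (y m)) -` {a} \<inter> space S \<in> sets S" .
  qed auto
  have snd: "(\<lambda>y. snd (y m)) \<in> borel_measurable S" for m
  proof (subst borel_measurable_iff_greater, intro allI)
    fix b
    have "{y \<in> space S. b < snd (y m)} = (\<Union>a. D m a b)" by (auto simp: D_def S)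
    also have "\<dots> \<in> sets S" using D by (intro sets.countable_UN') auto
    finally show "{y \<in> space S. b < snd (y m)} \<in> sets S" .
  qed
  have "(\<lambda>y. y) \<in> S \<rightarrow>\<^sub>M skeleton_space"
    unfolding skeleton_space_def
  proof (rule measurable_PiM_single')
    show "(\<lambda>y. y m) \<in> S \<rightarrow>\<^sub>M count_space UNIV \<Otimes>\<^sub>M borel" for m
      using measurable_Pair[OF fst snd, of m m] by simp
  qed (auto simp: space_pair_measure)
  then show "sets skeleton_space \<subseteq> sigma_sets UNIV ?E"
    using measurable_sets[of "\<lambda>y. y" S skeleton_space] by (auto simp: S)
  show "sigma_sets UNIV ?E \<subseteq> sets skeleton_space"
    using sets.sigma_sets_subset[of ?E skeleton_space] cylinder_sets by auto
qed

lemma Int_stable_cylinders: "Int_stable (insert {} {cylinder n x s | n x s. True})"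
proof (rule Int_stableI)
  let ?E = "insert {} {cylinder n x s | n x s. True}"
  have le: "cylinder n x s \<inter> cylinder n' x' s' \<in> ?E" if "n \<le> n'" for n x s n' x' s'
  proof (cases "\<forall>m\<le>n. x m = x' m")
    case True
    have "cylinder n x s \<inter> cylinder n' x' s' = cylinder n' x' (\<lambda>m. if m \<le> n then max (s m) (s' m) else s' m)"
      using that True by (auto simp: cylinder_def)
    then show ?thesis by blast
  next
    case False
    then have "cylinder n x s \<inter> cylinder n' x' s' = {}" using that by (force simp: cylinder_def)
    then show ?thesis by blast
  qed
  fix a b assume "a \<in> ?E" "b \<in> ?E"
  then consider "a = {} \<or> b = {}"
    | n x s n' x' s' where "a = cylinder n x s" "b = cylinder n' x' s'" by blast
  then show "a \<inter> b \<in> ?E"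
  proof cases
    case 2
    show ?thesis
    proof (cases "n \<le> n'")
      case False
      then show ?thesis using le[of n' n x' s' x s] 2 by (simp add: Int_commute)
    qed (use le 2 in simp)
  qed auto
qed

lemma path_functional_measurable:
  "(\<lambda>y. \<lambda>t\<in>{0..}. jump_path (\<lambda>n. fst (y n)) (\<lambda>n. snd (y n)) t) \<in> skeleton_space \<rightarrow>\<^sub>M path_space"
  unfolding path_space_def
proof (rule measurable_restrict)
  fix t :: real
  have "(\<lambda>y. LEAST n. t < (\<Sum>m\<le>n. snd (y m))) \<in> skeleton_space \<rightarrow>\<^sub>M count_space UNIV"
  proof (rule measurable_Least)
    fix n
    have "(\<lambda>y. \<Sum>m\<le>n. snd (y m)) \<in> borel_measurable skeleton_space"
      by (intro borel_measurable_sum snd_measurable)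
    then have "{y \<in> space skeleton_space. t < (\<Sum>m\<le>n. snd (y m))} \<in> sets skeleton_space"
      by (intro borel_measurable_less) auto
    then show "(\<lambda>y. t < (\<Sum>m\<le>n. snd (y m))) \<in> skeleton_space \<rightarrow>\<^sub>M count_space UNIV"
      by (simp add: pred_def)
  qed
  from measurable_compose_countable[OF fst_measurable this]
  show "(\<lambda>y. jump_path (\<lambda>n. fst (y n)) (\<lambda>n. snd (y n)) t) \<in> skeleton_space \<rightarrow>\<^sub>M count_space UNIV"
    by (simp add: jump_path_def)
qed

lemma distr_cong_AE:
  assumes "f \<in> M \<rightarrow>\<^sub>M N" "g \<in> M \<rightarrow>\<^sub>M N" "AE x in M. f x = g x"
  shows "distr M N f = distr M N g"
proof (rule measure_eqI)
  fix A assume "A \<in> sets (distr M N f)"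
  then have A: "A \<in> sets N" by simp
  have "emeasure M (f -` A \<inter> space M) = emeasure M (g -` A \<inter> space M)"
  proof (rule emeasure_eq_AE)
    show "AE x in M. x \<in> f -` A \<inter> space M \<longleftrightarrow> x \<in> g -` A \<inter> space M"
      using assms(3) by eventually_elim simp
  qed (use measurable_sets[OF assms(1) A] measurable_sets[OF assms(2) A] in blast)+
  then show "emeasure (distr M N f) A = emeasure (distr M N g) A"
    using assms A by (simp add: emeasure_distr)
qed simp

text \<open>
  The preimages of a set under the two functions differ by a subset of a null set.
\<close>

lemma measurable_completion_cong_AE:
  assumes g: "g \<in> M \<rightarrow>\<^sub>M N" and f: "\<And>x. x \<in> space M \<Longrightarrow> f x \<in> space N" and ae: "AE x in M. f x = g x"
  shows "f \<in> completion M \<rightarrow>\<^sub>M N"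
proof (rule measurableI)
  fix A assume A: "A \<in> sets N"
  have "AE x in completion M. x \<in> g -` A \<inter> space M \<longleftrightarrow> x \<in> f -` A \<inter> space (completion M)"
    using AE_completion[OF ae] by eventually_elim simp
  then show "f -` A \<inter> space (completion M) \<in> sets (completion M)"
  proof (rule completion.in_sets_AE)
    show "g -` A \<inter> space M \<in> sets (completion M)" using measurable_sets[OF g A] by simp
  qed blast
qed (use f in auto)

text \<open>
  A sequence of states \<open>J\<close> and holding times \<open>H\<close> whose finite-dimensional laws are known in the form
  in which they are given for the trap model, that is, for states in the tree \<open>S\<close> and nonnegative
  bounds.
\<close>

locale skeleton = prob_space Q for Q :: "'b measure" +
  fixes J :: "nat \<Rightarrow> 'b \<Rightarrow> nat list" and H :: "nat \<Rightarrow> 'b \<Rightarrow> real" and S :: "nat list set"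
    and f :: "nat \<Rightarrow> (nat \<Rightarrow> nat list) \<Rightarrow> (nat \<Rightarrow> real) \<Rightarrow> real"
  assumes finite_S: "finite S"
    and J: "\<And>n. J n \<in> Q \<rightarrow>\<^sub>M count_space UNIV" and H: "\<And>n. H n \<in> borel_measurable Q"
    and law: "\<And>n x s. (\<And>m. x m \<in> S) \<Longrightarrow> (\<And>m. 0 \<le> s m) \<Longrightarrow>
      prob {\<omega> \<in> space Q. \<forall>m\<le>n. J m \<omega> = x m \<and> s m < H m \<omega>} = f n x s"
begin

definition skel :: "'b \<Rightarrow> nat \<Rightarrow> nat list \<times> real" where
  "skel \<omega> n = (J n \<omega>, H n \<omega>)"

lemma skel_measurable: "skel \<in> Q \<rightarrow>\<^sub>M skeleton_space"
  unfolding skeleton_space_def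
proof (rule measurable_PiM_single')
  show "(\<lambda>\<omega>. skel \<omega> n) \<in> Q \<rightarrow>\<^sub>M count_space UNIV \<Otimes>\<^sub>M borel" for n
    unfolding skel_def using J H by (intro measurable_Pair) auto
qed (auto simp: space_pair_measure)

lemma event_eq: "{\<omega> \<in> space Q. \<forall>m\<le>n. J m \<omega> = x m \<and> s m < H m \<omega>} = skel -` cylinder n x s \<inter> space Q"
  by (auto simp: skel_def cylinder_def)

lemma event_sets: "{\<omega> \<in> space Q. \<forall>m\<le>n. J m \<omega> = x m \<and> s m < H m \<omega>} \<in> events"
  unfolding event_eq by (rule measurable_sets[OF skel_measurable cylinder_sets])

definition good :: "nat \<Rightarrow> 'b set" where
  "good n = {\<omega> \<in> space Q. \<forall>m\<le>n. J m \<omega> \<in> S \<and> 0 < H m \<omega>}"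

lemma good_eq: "good n = (\<Union>x\<in>PiE {..n} (\<lambda>_. S). {\<omega> \<in> space Q. \<forall>m\<le>n. J m \<omega> = x m \<and> 0 < H m \<omega>})"
proof (intro equalityI subsetI)
  fix \<omega> assume "\<omega> \<in> good n"
  then show "\<omega> \<in> (\<Union>x\<in>PiE {..n} (\<lambda>_. S). {\<omega> \<in> space Q. \<forall>m\<le>n. J m \<omega> = x m \<and> 0 < H m \<omega>})"
    by (intro UN_I[of "\<lambda>m\<in>{..n}. J m \<omega>"]) (auto simp: good_def)
next
  fix \<omega> assume "\<omega> \<in> (\<Union>x\<in>PiE {..n} (\<lambda>_. S). {\<omega> \<in> space Q. \<forall>m\<le>n. J m \<omega> = x m \<and> 0 < H m \<omega>})"
  then obtain x where x: "x \<in> PiE {..n} (\<lambda>_. S)" "\<omega> \<in> space Q" "\<forall>m\<le>n. J m \<omega> = x m \<and> 0 < H m \<omega>"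
    by blast
  have "x m \<in> S" if "m \<le> n" for m using PiE_mem[OF x(1), of m] that by simp
  with x(2,3) show "\<omega> \<in> good n" by (simp add: good_def)
qed

lemma good_sets: "good n \<in> events"
  unfolding good_eq by (intro sets.finite_UN finite_PiE finite_S event_sets) auto

text \<open>
  The probability of the regular event can be expressed through \<open>f\<close> alone.  Therefore it is \<open>1\<close> for every
  skeleton with the given \<open>f\<close> as soon as it is \<open>1\<close> for one of them.
\<close>

lemma prob_good:
  assumes "a \<in> S"
  shows "prob (good n) = (\<Sum>x\<in>PiE {..n} (\<lambda>_. S). f n (\<lambda>m. if m \<le> n then x m else a) (\<lambda>_. 0))"
proof -
  have "prob (good n) = (\<Sum>x\<in>PiE {..n} (\<lambda>_. S). prob {\<omega> \<in> space Q. \<forall>m\<le>n. J m \<omega> = x m \<and> 0 < H m \<omega>})"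
    unfolding good_eq
  proof (rule finite_measure_finite_Union)
    show "finite (PiE {..n} (\<lambda>_. S))" using finite_S by (intro finite_PiE) auto
    show "disjoint_family_on (\<lambda>x. {\<omega> \<in> space Q. \<forall>m\<le>n. J m \<omega> = x m \<and> 0 < H m \<omega>}) (PiE {..n} (\<lambda>_. S))"
      unfolding disjoint_family_on_def
    proof (intro ballI impI, rule ccontr)
      fix x x' assume x: "x \<in> PiE {..n} (\<lambda>_. S)" "x' \<in> PiE {..n} (\<lambda>_. S)" "x \<noteq> x'"
      assume "{\<omega> \<in> space Q. \<forall>m\<le>n. J m \<omega> = x m \<and> 0 < H m \<omega>} \<inter>
        {\<omega> \<in> space Q. \<forall>m\<le>n. J m \<omega> = x' m \<and> 0 < H m \<omega>} \<noteq> {}"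
      then have "x m = x' m" if "m \<in> {..n}" for m using that by auto
      then have "x = x'" using PiE_ext[OF x(1,2)] by blast
      with x show False by simp
    qed
  qed (intro image_subsetI event_sets)
  also have "\<dots> = (\<Sum>x\<in>PiE {..n} (\<lambda>_. S). f n (\<lambda>m. if m \<le> n then x m else a) (\<lambda>_. 0))"
  proof (rule sum.cong[OF refl])
    fix x assume x: "x \<in> PiE {..n} (\<lambda>_. S)"
    let ?x = "\<lambda>m. if m \<le> n then x m else a"
    have "?x m \<in> S" for m using PiE_mem[OF x, of m] assms by simp
    then have "prob {\<omega> \<in> space Q. \<forall>m\<le>n. J m \<omega> = ?x m \<and> 0 < H m \<omega>} = f n ?x (\<lambda>_. 0)"
      by (intro law) auto
    then show "prob {\<omega> \<in> space Q. \<forall>m\<le>n. J m \<omega> = x m \<and> 0 < H m \<omega>} = f n ?x (\<lambda>_. 0)"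
      by (simp cong: imp_cong conj_cong)
  qed
  finally show ?thesis .
qed

lemma prob_cylinder:
  assumes good: "\<And>n. prob (good n) = 1"
  shows "prob (skel -` cylinder n x s \<inter> space Q) =
    (if \<forall>m\<le>n. x m \<in> S then f n (\<lambda>m. if m \<le> n then x m else x 0) (\<lambda>m. max 0 (s m)) else 0)"
proof (cases "\<forall>m\<le>n. x m \<in> S")
  case True
  let ?x = "\<lambda>m. if m \<le> n then x m else x 0" and ?s = "\<lambda>m. max 0 (s m)"
  have "AE \<omega> in Q. \<omega> \<in> good n" using good by (intro AE_prob_1) auto
  then have "AE \<omega> in Q. \<omega> \<in> {\<omega> \<in> space Q. \<forall>m\<le>n. J m \<omega> = x m \<and> s m < H m \<omega>} \<longleftrightarrow>
      \<omega> \<in> {\<omega> \<in> space Q. \<forall>m\<le>n. J m \<omega> = ?x m \<and> ?s m < H m \<omega>}"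
  proof eventually_elim
    case (elim \<omega>)
    then have "(J m \<omega> = x m \<and> s m < H m \<omega>) = (J m \<omega> = ?x m \<and> ?s m < H m \<omega>)" if "m \<le> n" for m
      using that by (simp add: good_def)
    then show ?case by (simp cong: imp_cong)
  qed
  then have "prob (skel -` cylinder n x s \<inter> space Q) = prob {\<omega> \<in> space Q. \<forall>m\<le>n. J m \<omega> = ?x m \<and> ?s m < H m \<omega>}"
    unfolding event_eq[of n x s, symmetric] by (rule finite_measure_eq_AE) (rule event_sets)+
  also have "\<dots> = f n ?x ?s" using True by (intro law) auto
  finally show ?thesis using True by simp
next
  case False
  have "AE \<omega> in Q. \<omega> \<in> good n" using good by (intro AE_prob_1) auto
  then have "AE \<omega> in Q. \<omega> \<in> {\<omega> \<in> space Q. \<forall>m\<le>n. J m \<omega> = x m \<and> s m < H m \<omega>} \<longleftrightarrow> \<omega> \<in> {}"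
  proof eventually_elim
    case (elim \<omega>)
    obtain m where "m \<le> n" "x m \<notin> S" using False by blast
    moreover from elim this have "J m \<omega> \<in> S" by (simp add: good_def)
    ultimately show ?case by auto
  qed
  then have "prob (skel -` cylinder n x s \<inter> space Q) = prob {}"
    unfolding event_eq[of n x s, symmetric] by (rule finite_measure_eq_AE) (rule event_sets sets.empty_sets)+
  then show ?thesis unfolding if_not_P[OF False] by simp
qed

end

text \<open>
  Cylinders are stable under intersection and generate the \<open>\<sigma>\<close>-algebra.  Almost sure positivity of the
  holding times and membership of the states in \<open>S\<close> settle the cylinders about which \<open>f\<close> says
  nothing; both properties carry over from the first skeleton to the second.
\<close>

lemma skeleton_distr_unique:
  assumes 1: "skeleton Q1 J1 H1 S f" and 2: "skeleton Q2 J2 H2 S f"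
    and good: "\<And>n. AE \<omega> in Q1. J1 n \<omega> \<in> S \<and> 0 < H1 n \<omega>" and S: "a \<in> S"
  shows "distr Q1 skeleton_space (skeleton.skel J1 H1) = distr Q2 skeleton_space (skeleton.skel J2 H2)"
proof -
  interpret A: skeleton Q1 J1 H1 S f by fact
  interpret B: skeleton Q2 J2 H2 S f by fact
  have A: "measure Q1 (A.good n) = 1" for n
  proof -
    have "AE \<omega> in Q1. \<forall>m\<in>{..n}. J1 m \<omega> \<in> S \<and> 0 < H1 m \<omega>"
      using good by (intro AE_finite_allI) auto
    then have "AE \<omega> in Q1. \<omega> \<in> A.good n"
      using AE_space by eventually_elim (auto simp: A.good_def)
    then show ?thesis using A.prob_eq_1[OF A.good_sets] by simp
  qed
  then have B: "measure Q2 (B.good n) = 1" for n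
    unfolding A.prob_good[OF S] B.prob_good[OF S] .
  let ?E = "insert {} {cylinder n x s | n x s. True}"
  let ?C = "(\<lambda>(a, r). cylinder 0 (\<lambda>_. a) (\<lambda>_. - real r)) ` UNIV"
  show ?thesis
  proof (rule measure_eqI_generator_eq_countable[where A = ?C, OF Int_stable_cylinders])
    fix X assume "X \<in> ?E"
    then consider "X = {}" | n x s where "X = cylinder n x s" by blast
    then show "emeasure (distr Q1 skeleton_space A.skel) X = emeasure (distr Q2 skeleton_space B.skel) X"
    proof cases
      case (2 n x s)
      show ?thesis
        unfolding 2 emeasure_distr[OF A.skel_measurable cylinder_sets] emeasure_distr[OF B.skel_measurable cylinder_sets]
          A.emeasure_eq_measure B.emeasure_eq_measure A.prob_cylinder[OF A] B.prob_cylinder[OF B] by (rule refl)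
    qed simp
  next
    show "\<Union> ?C = UNIV"
    proof (intro equalityI subsetI)
      fix y :: "nat \<Rightarrow> nat list \<times> real"
      obtain r where "- snd (y 0) < real r" using reals_Archimedean2 by blast
      then have "y \<in> cylinder 0 (\<lambda>_. fst (y 0)) (\<lambda>_. - real r)" by (simp add: cylinder_def)
      then show "y \<in> \<Union> ?C" by blast
    qed simp
    interpret DA: prob_space "distr Q1 skeleton_space A.skel"
      by (rule A.prob_space_distr[OF A.skel_measurable])
    show "emeasure (distr Q1 skeleton_space A.skel) X \<noteq> \<infinity>" for X
      using DA.emeasure_finite[of X] unfolding infinity_ennreal_def .
    show "sets (distr Q1 skeleton_space A.skel) = sigma_sets UNIV ?E"
      "sets (distr Q2 skeleton_space B.skel) = sigma_sets UNIV ?E"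
      by (simp_all only: sets_distr sets_skeleton_space)
    show "countable ?C" by (intro countable_image) simp
    show "?C \<subseteq> ?E" by (intro image_subsetI) auto
    show "?E \<subseteq> Pow UNIV" unfolding Pow_UNIV by (rule subset_UNIV)
  qed
qed

section \<open>Regularity of almost all samples, and the conclusion\<close>

lemma (in prob_space) AE_exponential_pos:
  assumes "distributed M lborel Y (exponential_density 1)"
  shows "AE \<omega> in M. 0 < Y \<omega>"
proof -
  have "\<P>(\<omega> in M. 0 < Y \<omega>) = 1"
    using exponential_distributedD_gt[OF assms, of 0] by simp
  then have "AE \<omega> in M. \<omega> \<in> {\<omega> \<in> space M. 0 < Y \<omega>}" by (rule AE_prob_1)
  then show ?thesis by eventually_elim simp
qed

text \<open>
  The probability that \<open>n + 1\<close> independent variables are all at most \<open>1\<close> is \<open>q ^ Suc n\<close> with \<open>q < 1\<close>.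
\<close>

lemma (in prob_space) AE_exponential_recurrent:
  fixes h :: "nat \<Rightarrow> 'i"
  assumes indep: "indep_vars (\<lambda>_. borel) X I" and h: "inj h" "range h \<subseteq> I"
    and X: "\<And>n. distributed M lborel (X (h n)) (exponential_density 1)"
  shows "AE \<omega> in M. \<exists>\<^sub>\<infinity>n. 1 < X (h n) \<omega>"
proof -
  have X_meas: "X (h n) \<in> borel_measurable M" for n
    using distributed_measurable[OF X[of n]] by simp
  define q where "q = 1 - exp (- 1 :: real)"
  have q: "0 \<le> q" "q < 1" by (auto simp: q_def)
  have le: "prob (X (h n) -` {..1} \<inter> space M) = q" for n
  proof -
    have "X (h n) -` {..1} \<inter> space M = {\<omega> \<in> space M. X (h n) \<omega> \<le> 1}" by auto
    then show ?thesis using exponential_distributedD_le[OF X[of n], of 1] by (simp add: q_def)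
  qed
  have block: "prob (\<Inter>i\<in>h ` {a..a + n}. X i -` {..1} \<inter> space M) = q ^ Suc n" for a n
  proof -
    have "prob (\<Inter>i\<in>h ` {a..a + n}. X i -` {..1} \<inter> space M) = (\<Prod>i\<in>h ` {a..a + n}. prob (X i -` {..1} \<inter> space M))"
      using h by (intro indep_varsD[OF indep]) auto
    also have "\<dots> = (\<Prod>m\<in>{a..a + n}. q)"
      using inj_on_subset[OF h(1)] by (subst prod.reindex) (auto simp: le)
    finally show ?thesis by simp
  qed
  have "AE \<omega> in M. \<exists>n\<ge>a. 1 < X (h n) \<omega>" for a
  proof -
    let ?A = "{\<omega> \<in> space M. \<forall>n. a \<le> n \<longrightarrow> X (h n) \<omega> \<le> 1}"
    have A: "?A \<in> events"
      using X_meas by (intro sets.sets_Collect_countable_All sets.sets_Collect_imp borel_measurable_le) auto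
    have "prob ?A \<le> q ^ Suc n" for n
    proof -
      have "(\<Inter>i\<in>h ` {a..a + n}. X i -` {..1} \<inter> space M) \<in> events"
        using X_meas by (intro sets.finite_INT) (auto intro: measurable_sets)
      then have "prob ?A \<le> prob (\<Inter>i\<in>h ` {a..a + n}. X i -` {..1} \<inter> space M)"
        by (intro finite_measure_mono) auto
      then show ?thesis by (simp only: block)
    qed
    moreover have "(\<lambda>n. q ^ Suc n) \<longlonglongrightarrow> 0"
      using q by (intro LIMSEQ_Suc LIMSEQ_realpow_zero) auto
    ultimately have "prob ?A \<le> 0" by (intro LIMSEQ_le_const) blast+
    then have "prob ?A = 0" by (simp only: measure_le_0_iff)
    then have "AE \<omega> in M. \<omega> \<notin> ?A" by (rule prob_eq_0[OF A, THEN iffD1])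
    then show ?thesis using AE_space
    proof eventually_elim
      case (elim \<omega>)
      then obtain n where "a \<le> n" "\<not> X (h n) \<omega> \<le> 1" by blast
      then show ?case by (intro exI[of _ n]) simp
    qed
  qed
  then have "AE \<omega> in M. \<forall>a. \<exists>n\<ge>a. 1 < X (h n) \<omega>" unfolding AE_all_countable by blast
  then show ?thesis
  proof eventually_elim
    case (elim \<omega>)
    then show ?case by (simp add: INFM_nat_le)
  qed
qed

context driver_space
begin

lemma AE_refresh_mem:
  assumes l: "l \<in> {2..k}"
  shows "AE \<omega> in P. nat \<lfloor>X (Refresh l n) \<omega>\<rfloor> \<in> {1..M l}"
proof -
  let ?A = "\<lambda>y. {\<omega> \<in> space P. nat \<lfloor>X (Refresh l n) \<omega>\<rfloor> = y}"
  have "X (Refresh l n) \<in> borel_measurable P" using l by (intro X_measurable) (auto simp: drivers_def)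
  then have "(\<lambda>\<omega>. nat \<lfloor>X (Refresh l n) \<omega>\<rfloor>) \<in> P \<rightarrow>\<^sub>M count_space UNIV" by measurable
  then have A: "?A y \<in> events" for y by (rule Collect_eq_sets)
  have "prob (\<Union>y\<in>{1..M l}. ?A y) = (\<Sum>y\<in>{1..M l}. prob (?A y))"
  proof (rule finite_measure_finite_Union)
    show "disjoint_family_on ?A {1..M l}" by (auto simp: disjoint_family_on_def)
  qed (use A in auto)
  also have "\<dots> = (\<Sum>y\<in>{1..M l}. 1 / M l)" by (intro sum.cong refl refresh l)
  also have "\<dots> = 1" using M_pos[of l] l by simp
  finally have "AE \<omega> in P. \<omega> \<in> (\<Union>y\<in>{1..M l}. ?A y)" by (rule AE_prob_1)
  then show ?thesis by eventually_elim auto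
qed

lemma AE_states_in_tree:
  assumes "l \<le> k"
  shows "AE \<omega> in P. \<forall>n. states l \<omega> n \<in> tree M l"
proof -
  have "AE \<omega> in P. \<forall>j\<in>{2..k}. \<forall>n. nat \<lfloor>X (Refresh j n) \<omega>\<rfloor> \<in> {1..M j}"
    by (intro AE_finite_allI) (auto simp only: AE_all_countable intro!: AE_refresh_mem)
  then show ?thesis
  proof eventually_elim
    case (elim \<omega>)
    show ?case
    proof
      fix n show "states l \<omega> n \<in> tree M l"
        using M_pos elim assms by (intro chain_in_tree) auto
    qed
  qed
qed

text \<open>
  The states of level \<open>l\<close> are random, but the first \<open>n\<close> rings depend on finitely many of them, and there
  are only countably many finite sequences of states to which the result for fixed states is
  applied.
\<close>

lemma AE_no_ties_states:
  assumes l: "l < k"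
  shows "AE \<omega> in P. \<forall>n. rings_in_order (clock_set M l) (durations \<gamma> l (states l \<omega>) (\<lambda>r. X r \<omega>))
    (ring_order (clock_set M l) (durations \<gamma> l (states l \<omega>) (\<lambda>r. X r \<omega>)) n)"
proof -
  let ?I = "clock_set M l"
  have "0 < card (tree M l)" using M_pos l by (intro card_tree_pos) auto
  then obtain z0 where z0: "z0 \<in> tree M l" by (metis card.empty ex_in_conv less_irrefl)
  define c where "c zs m = (if m < length zs then zs ! m else z0)" for zs :: "nat list list" and m
  have c: "c zs m \<in> tree M l" if "zs \<in> lists (tree M l)" for zs m
    using that z0 nth_mem[of m zs] by (auto simp: c_def)
  have "countable (lists (tree M l))" by (intro countable_lists countable_finite) simp
  moreover have "AE \<omega> in P. \<forall>n. rings_in_order ?I (durations \<gamma> l (c zs) (\<lambda>r. X r \<omega>)) (ring_order ?I (durations \<gamma> l (c zs) (\<lambda>r. X r \<omega>)) n)"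
    if "zs \<in> lists (tree M l)" for zs
    unfolding AE_all_countable using c[OF that] by (intro allI AE_no_ties_frozen l)
  ultimately have "AE \<omega> in P. \<forall>zs\<in>lists (tree M l). \<forall>n. rings_in_order ?I (durations \<gamma> l (c zs) (\<lambda>r. X r \<omega>))
      (ring_order ?I (durations \<gamma> l (c zs) (\<lambda>r. X r \<omega>)) n)"
    by (simp add: AE_ball_countable)
  moreover have "AE \<omega> in P. \<forall>n. states l \<omega> n \<in> tree M l" using l by (intro AE_states_in_tree) simp
  ultimately show ?thesis
  proof eventually_elim
    case (elim \<omega>)
    show ?case
    proof
      fix n
      define zs where "zs = map (states l \<omega>) [0..<Suc n]"
      let ?D = "durations \<gamma> l (states l \<omega>) (\<lambda>r. X r \<omega>)" and ?D' = "durations \<gamma> l (c zs) (\<lambda>r. X r \<omega>)"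
      define ws where "ws = ring_order ?I ?D' n"
      have zs: "zs \<in> lists (tree M l)" using elim(2) by (auto simp: zs_def simp del: upt_Suc)
      have len: "length ws = n" by (simp add: ws_def)
      have D: "?D i m = ?D' i m" if "m \<le> count_list ws i" for i m
      proof -
        have "m < Suc n" using that count_le_length[of ws i] len by simp
        then have "c zs m = states l \<omega> m" by (simp add: c_def zs_def del: upt_Suc)
        then show ?thesis by (simp add: durations_def)
      qed
      have "ring_order ?I ?D (length ws) = ws \<longleftrightarrow> ring_order ?I ?D' (length ws) = ws"
        by (rule ring_order_eq_cong) (rule D)
      then have "ring_order ?I ?D n = ws" by (simp add: len ws_def)
      moreover have "rings_in_order ?I ?D ws \<longleftrightarrow> rings_in_order ?I ?D' ws" by (rule rings_in_order_cong_counts) (rule D)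
      moreover have "rings_in_order ?I ?D' ws" using elim(1) zs by (simp add: ws_def)
      ultimately show "rings_in_order ?I ?D (ring_order ?I ?D n)" by simp
    qed
  qed
qed

lemma AE_regular_sample:
  assumes \<sigma>: "\<And>l x i \<omega>. \<omega> \<in> space P \<Longrightarrow> l \<in> {1..k} \<Longrightarrow> 1 \<le> x \<Longrightarrow> \<sigma> l x i \<omega> = (\<Sum>m<i. X (Gap l x m) \<omega>)"
    and T: "\<And>l n \<omega>. \<omega> \<in> space P \<Longrightarrow> l \<in> {1..k} \<Longrightarrow> T l n \<omega> = X (Clock l n) \<omega>"
    and U: "\<And>l n \<omega>. \<omega> \<in> space P \<Longrightarrow> l \<in> {2..k} \<Longrightarrow> real (U l n \<omega>) = X (Refresh l n) \<omega>"
  shows "AE \<omega> in P. regular_sample M \<gamma> k (\<lambda>r. X r \<omega>) (\<lambda>l x i. \<sigma> l x i \<omega>) (\<lambda>l n. T l n \<omega>) (\<lambda>l n. U l n \<omega>)"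
proof -
  have gap_pos: "AE \<omega> in P. \<forall>l\<in>{1..k}. \<forall>x\<in>{1..}. \<forall>n. 0 < X (Gap l x n) \<omega>"
  proof (rule AE_finite_allI)
    fix l assume l: "l \<in> {1..k}"
    have "AE \<omega> in P. \<forall>n. 0 < X (Gap l x n) \<omega>" if "x \<in> {1..}" for x
      unfolding AE_all_countable using l that by (intro allI AE_exponential_pos gap) auto
    then show "AE \<omega> in P. \<forall>x\<in>{1..}. \<forall>n. 0 < X (Gap l x n) \<omega>" by (subst AE_ball_countable) auto
  qed simp
  have clock_pos: "AE \<omega> in P. \<forall>l\<in>{1..k}. \<forall>n. 0 < X (Clock l n) \<omega>"
    by (intro AE_finite_allI) (auto simp: AE_all_countable intro!: AE_exponential_pos clock)
  have gap_rec: "AE \<omega> in P. \<forall>l\<in>{1..k}. \<forall>x\<in>{1..}. \<exists>\<^sub>\<infinity>n. 1 < X (Gap l x n) \<omega>"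
  proof (rule AE_finite_allI)
    fix l assume l: "l \<in> {1..k}"
    have "AE \<omega> in P. \<exists>\<^sub>\<infinity>n. 1 < X (Gap l x n) \<omega>" if "x \<in> {1..}" for x
      using l that by (intro AE_exponential_recurrent[OF indep] gap) (auto simp: inj_def drivers_def)
    then show "AE \<omega> in P. \<forall>x\<in>{1..}. \<exists>\<^sub>\<infinity>n. 1 < X (Gap l x n) \<omega>" by (subst AE_ball_countable) auto
  qed simp
  have clock_rec: "AE \<omega> in P. \<forall>l\<in>{1..k}. \<exists>\<^sub>\<infinity>n. 1 < X (Clock l n) \<omega>"
  proof (rule AE_finite_allI)
    fix l assume l: "l \<in> {1..k}"
    then show "AE \<omega> in P. \<exists>\<^sub>\<infinity>n. 1 < X (Clock l n) \<omega>"
      by (intro AE_exponential_recurrent[OF indep] clock) (auto simp: inj_def drivers_def)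
  qed simp
  have refresh: "AE \<omega> in P. \<forall>j\<in>{2..k}. \<forall>n. nat \<lfloor>X (Refresh j n) \<omega>\<rfloor> \<in> {1..M j}"
    by (intro AE_finite_allI) (auto simp only: AE_all_countable intro!: AE_refresh_mem)
  have no_ties: "AE \<omega> in P. \<forall>l\<in>{..<k}. \<forall>n. rings_in_order (clock_set M l) (durations \<gamma> l (states l \<omega>) (\<lambda>r. X r \<omega>))
      (ring_order (clock_set M l) (durations \<gamma> l (states l \<omega>) (\<lambda>r. X r \<omega>)) n)"
    by (intro AE_finite_allI AE_no_ties_states) auto
  from AE_space gap_pos clock_pos gap_rec clock_rec refresh no_ties show ?thesis
  proof eventually_elim
    case (elim \<omega>)
    have U_mem: "U l n \<omega> \<in> {1..M l}" if "l \<in> {2..k}" for l n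
    proof -
      have "nat \<lfloor>X (Refresh l n) \<omega>\<rfloor> \<in> {1..M l}" using elim(6) that by blast
      then show ?thesis unfolding U[OF elim(1) that, symmetric] by simp
    qed
    show ?case
    proof (rule regular_sample.intro)
      show "1 \<le> M j" if "j \<in> {1..k}" for j by (rule M_pos[OF that])
      show "0 < \<gamma> j x" if "j \<in> {1..k}" "x \<in> tree M j" for j x by (rule \<gamma>_pos[OF that])
      show "\<sigma> l x i \<omega> = (\<Sum>m<i. X (Gap l x m) \<omega>)" if "l \<in> {1..k}" "1 \<le> x" for l x i
        by (rule \<sigma>[OF elim(1) that])
      show "T l n \<omega> = X (Clock l n) \<omega>" if "l \<in> {1..k}" for l n by (rule T[OF elim(1) that])
      show "real (U l n \<omega>) = X (Refresh l n) \<omega>" if "l \<in> {2..k}" for l n by (rule U[OF elim(1) that])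
      show "U l n \<omega> \<in> {1..M l}" if "l \<in> {2..k}" for l n by (rule U_mem[OF that])
      show "0 < X (Gap l x n) \<omega>" if "l \<in> {1..k}" "1 \<le> x" for l x n using elim(2) that by simp
      show "0 < X (Clock l n) \<omega>" if "l \<in> {1..k}" for l n using elim(3) that by simp
      show "\<exists>\<^sub>\<infinity>n. 1 < X (Gap l x n) \<omega>" if "l \<in> {1..k}" "1 \<le> x" for l x using elim(4) that by simp
      show "\<exists>\<^sub>\<infinity>n. 1 < X (Clock l n) \<omega>" if "l \<in> {1..k}" for l using elim(5) that by simp
      show "rings_in_order (clock_set M l) (durations \<gamma> l (states l \<omega>) (\<lambda>r. X r \<omega>))
          (ring_order (clock_set M l) (durations \<gamma> l (states l \<omega>) (\<lambda>r. X r \<omega>)) n)" if "l < k" for l n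
        by (rule spec[OF bspec[OF elim(7)]]) (use that in simp)
    qed
  qed
qed

definition hold :: "nat \<Rightarrow> 'a \<Rightarrow> real" where
  "hold n \<omega> = \<gamma> k (states k \<omega> n) * X (Clock k n) \<omega>"

lemma states_measurable: "l \<le> k \<Longrightarrow> (\<lambda>\<omega>. states l \<omega> n) \<in> P \<rightarrow>\<^sub>M count_space UNIV"
  using chain_drivers_subset by (intro chain_measurable X_measurable) auto

lemma hold_measurable: "1 \<le> k \<Longrightarrow> hold n \<in> borel_measurable P"
proof -
  assume k: "1 \<le> k"
  have "(\<lambda>\<omega>. \<gamma> k (states k \<omega> n)) \<in> borel_measurable P"
    by (rule measurable_compose[OF states_measurable]) auto
  moreover have "X (Clock k n) \<in> borel_measurable P"
    using k by (intro X_measurable) (auto simp: drivers_def)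
  ultimately show ?thesis by (simp add: hold_def[abs_def])
qed

text \<open>
  The clocks \<open>T\<close> of level \<open>k\<close> are independent of the drivers of the states, so each holding time
  contributes a factor \<open>exp (- s m / \<gamma> k (x m))\<close>.
\<close>

lemma skeleton_states_hold:
  assumes k: "1 \<le> k"
  shows "skeleton P (\<lambda>n \<omega>. states k \<omega> n) hold (tree M k)
    (\<lambda>n x s. path_prob k x n * (\<Prod>m\<le>n. exp (- s m / \<gamma> k (x m))))"
proof unfold_locales
  fix n :: nat and x :: "nat \<Rightarrow> nat list" and s :: "nat \<Rightarrow> real"
  assume x: "\<And>m. x m \<in> tree M k" and s: "\<And>m. 0 \<le> s m"
  have g: "0 < \<gamma> k (x m)" for m using \<gamma>_pos[OF _ x] k by auto
  define K where "K j = (if j = 0 then chain_drivers k else {Clock k (j - 1)})" for j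
  define B where "B j = (if j = 0 then {d \<in> space (PiM (chain_drivers k) (\<lambda>_. borel)). \<forall>m\<le>n. chain M \<gamma> k d m = x m}
     else {d \<in> space (PiM {Clock k (j - 1)} (\<lambda>_. borel)). s (j - 1) / \<gamma> k (x (j - 1)) < d (Clock k (j - 1))})"
    for j :: nat
  let ?R = "\<lambda>j \<omega>. \<lambda>i\<in>K j. X i \<omega>"
  have R_space: "?R j \<omega> \<in> space (PiM (K j) (\<lambda>_. borel))" for j \<omega>
    by (auto simp: space_PiM)
  have R0: "?R 0 \<omega> \<in> B 0 \<longleftrightarrow> (\<forall>m\<le>n. states k \<omega> m = x m)" for \<omega>
  proof -
    have "chain M \<gamma> k (?R 0 \<omega>) = states k \<omega>" by (rule chain_cong) (simp add: K_def)
    moreover have "?R 0 \<omega> \<in> space (PiM (K 0) (\<lambda>_. borel))" by (rule R_space)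
    ultimately show ?thesis by (simp add: B_def K_def)
  qed
  have R1: "?R (Suc m) \<omega> \<in> B (Suc m) \<longleftrightarrow> s m / \<gamma> k (x m) < X (Clock k m) \<omega>" for m \<omega>
  proof -
    have "?R (Suc m) \<omega> \<in> space (PiM (K (Suc m)) (\<lambda>_. borel))" by (rule R_space)
    then show ?thesis by (simp add: B_def K_def)
  qed
  have B: "B j \<in> sets (PiM (K j) (\<lambda>_. borel))" for j
  proof (cases j)
    case 0
    show ?thesis unfolding 0 B_def K_def using chain_prefix_sets by (simp only: if_True refl)
  next
    case (Suc m)
    have "{d \<in> space (PiM {Clock k m} (\<lambda>_. borel)). s m / \<gamma> k (x m) < (d (Clock k m) :: real)} \<in> sets (PiM {Clock k m} (\<lambda>_. borel))"
      by (intro borel_measurable_less borel_measurable_const measurable_component_singleton) simp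
    then show ?thesis by (simp add: Suc B_def K_def)
  qed
  have split: "(\<forall>j\<in>{..Suc n}. Q j) \<longleftrightarrow> Q 0 \<and> (\<forall>m\<le>n. Q (Suc m))" for Q
    unfolding atMost_Suc_eq_insert_0 by auto
  have "(\<forall>m\<le>n. states k \<omega> m = x m \<and> s m < hold m \<omega>)
      \<longleftrightarrow> (\<forall>m\<le>n. states k \<omega> m = x m) \<and> (\<forall>m\<le>n. s m / \<gamma> k (x m) < X (Clock k m) \<omega>)" for \<omega>
  proof -
    have "states k \<omega> m = x m \<and> s m < hold m \<omega> \<longleftrightarrow> states k \<omega> m = x m \<and> s m / \<gamma> k (x m) < X (Clock k m) \<omega>" for m
      using g[of m] by (auto simp: hold_def pos_divide_less_eq mult.commute)
    then show ?thesis by blast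
  qed
  then have "{\<omega> \<in> space P. \<forall>m\<le>n. states k \<omega> m = x m \<and> s m < hold m \<omega>}
      = {\<omega> \<in> space P. \<forall>j\<in>{..Suc n}. ?R j \<omega> \<in> B j}"
    unfolding split R0 R1 by blast
  also have "prob \<dots> = (\<Prod>j\<in>{..Suc n}. prob {\<omega> \<in> space P. ?R j \<omega> \<in> B j})"
  proof (rule prob_blocks[OF indep])
    show "K j \<subseteq> drivers k" for j
      using chain_drivers_subset[of k] k by (auto simp: K_def drivers_def)
    show "disjoint_family_on K {..Suc n}"
      by (auto simp: disjoint_family_on_def K_def chain_drivers_def split: if_splits)
  qed (use B in auto)
  also have "\<dots> = prob {\<omega> \<in> space P. ?R 0 \<omega> \<in> B 0} * (\<Prod>m\<le>n. prob {\<omega> \<in> space P. ?R (Suc m) \<omega> \<in> B (Suc m)})"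
    by (rule prod.atMost_Suc_shift)
  also have "(\<Prod>m\<le>n. prob {\<omega> \<in> space P. ?R (Suc m) \<omega> \<in> B (Suc m)}) = (\<Prod>m\<le>n. exp (- s m / \<gamma> k (x m)))"
  proof (rule prod.cong[OF refl])
    fix m
    have "0 \<le> s m / \<gamma> k (x m)" using s g[of m] by simp
    then show "prob {\<omega> \<in> space P. ?R (Suc m) \<omega> \<in> B (Suc m)} = exp (- s m / \<gamma> k (x m))"
      unfolding R1 using exponential_distributedD_gt[OF clock[of k m], of "s m / \<gamma> k (x m)"] k by simp
  qed
  also have "prob {\<omega> \<in> space P. ?R 0 \<omega> \<in> B 0} = path_prob k x n"
    unfolding R0 using k x by (intro law_of_states) auto
  finally show "prob {\<omega> \<in> space P. \<forall>m\<le>n. states k \<omega> m = x m \<and> s m < hold m \<omega>}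
      = path_prob k x n * (\<Prod>m\<le>n. exp (- s m / \<gamma> k (x m)))" .
qed (use states_measurable[of k] hold_measurable[OF k] in auto)

end

lemma driver_space_marks_environment:
  assumes env: "marks_environment P k M \<sigma> T U"
    and M: "\<And>j. j \<in> {1..k} \<Longrightarrow> 1 \<le> M j"
    and \<gamma>: "\<And>j x. j \<in> {1..k} \<Longrightarrow> x \<in> tree M j \<Longrightarrow> 0 < \<gamma> j x"
    and p: "\<And>j x. j \<in> {1..<k} \<Longrightarrow> x \<in> tree M j \<Longrightarrow> p j x = 1 / (1 + real (M (j + 1)) * \<gamma> j x)"
  shows "driver_space P k M \<gamma> p (driver_var \<sigma> T U)"
proof -
  interpret prob_space P using env by (simp add: marks_environment_def)
  show ?thesis
  proof unfold_locales
    show indep: "indep_vars (\<lambda>_. borel) (driver_var \<sigma> T U) (drivers k)"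
      using env by (simp add: marks_environment_def)
    show "distributed P lborel (driver_var \<sigma> T U (Gap l x n)) (exponential_density 1)"
      if "l \<in> {1..k}" "1 \<le> x" for l x n
      using env that by (simp add: marks_environment_def)
    show "distributed P lborel (driver_var \<sigma> T U (Clock l n)) (exponential_density 1)" if "l \<in> {1..k}" for l n
      using env that by (simp add: marks_environment_def)
    show "prob {\<omega> \<in> space P. nat \<lfloor>driver_var \<sigma> T U (Refresh l n) \<omega>\<rfloor> = y} = 1 / M l"
      if l: "l \<in> {2..k}" and y: "y \<in> {1..M l}" for l n y
    proof -
      have "driver_var \<sigma> T U (Refresh l n) \<in> borel_measurable P"
      proof -
        have "Refresh l n \<in> drivers k" using l by (auto simp: drivers_def)
        with indep show ?thesis unfolding indep_vars_def by blast
      qed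
      then have "(\<lambda>\<omega>. real (U l n \<omega>)) \<in> borel_measurable P" by simp
      then have "(\<lambda>\<omega>. nat \<lfloor>real (U l n \<omega>)\<rfloor>) \<in> P \<rightarrow>\<^sub>M count_space UNIV" by measurable
      then have U: "U l n \<in> P \<rightarrow>\<^sub>M count_space UNIV" by simp
      have "prob {\<omega> \<in> space P. U l n \<omega> = y} = measure (distr P (count_space UNIV) (U l n)) {y}"
        by (subst measure_distr[OF U]) (auto intro!: arg_cong[where f = prob])
      also have "\<dots> = pmf (pmf_of_set {1..M l}) y"
        using env l by (simp add: marks_environment_def pmf.rep_eq)
      also have "\<dots> = 1 / M l" using y by simp
      finally show ?thesis by simp
    qed
  qed (use M \<gamma> p in auto)
qed

theorem lemma3p7:
  fixes k :: nat and M :: "nat \<Rightarrow> nat"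
    and \<gamma> :: "nat \<Rightarrow> nat list \<Rightarrow> real" and p :: "nat \<Rightarrow> nat list \<Rightarrow> real"
    and P :: "'a measure" and Q :: "'b measure"
    and \<sigma> :: "nat \<Rightarrow> nat \<Rightarrow> nat \<Rightarrow> 'a \<Rightarrow> real" and T :: "nat \<Rightarrow> nat \<Rightarrow> 'a \<Rightarrow> real"
    and U :: "nat \<Rightarrow> nat \<Rightarrow> 'a \<Rightarrow> nat" and Z :: "real \<Rightarrow> 'b \<Rightarrow> nat list"
  assumes "1 \<le> k"
    and "\<And>j. j \<in> {1..k} \<Longrightarrow> 1 \<le> M j"
    and "\<And>j x. j \<in> {1..k} \<Longrightarrow> x \<in> tree M j \<Longrightarrow> 0 < \<gamma> j x"
    and "\<And>j x. j \<in> {1..<k} \<Longrightarrow> x \<in> tree M j \<Longrightarrow> p j x = 1 / (1 + real (M (j + 1)) * \<gamma> j x)"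
    and "marks_environment P k M \<sigma> T U"
    and "trap_model Q k M (\<gamma> k) p Z"
  shows "(\<lambda>\<omega>. \<lambda>t\<in>{0..}. marks_process M \<gamma> \<sigma> T U k t \<omega>) \<in> completion P \<rightarrow>\<^sub>M path_space
    \<and> distr (completion P) path_space (\<lambda>\<omega>. \<lambda>t\<in>{0..}. marks_process M \<gamma> \<sigma> T U k t \<omega>)
       = distr Q path_space (\<lambda>\<omega>. \<lambda>t\<in>{0..}. Z t \<omega>)"
proof -
  interpret D: driver_space P k M \<gamma> p "driver_var \<sigma> T U"
    by (rule driver_space_marks_environment[OF assms(5,2,3,4)])
  let ?X = "\<lambda>\<omega>. \<lambda>t\<in>{0..}. marks_process M \<gamma> \<sigma> T U k t \<omega>" and ?Z = "\<lambda>\<omega>. \<lambda>t\<in>{0..}. Z t \<omega>"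
  let ?F = "\<lambda>y. \<lambda>t\<in>{0..}. jump_path (\<lambda>n. fst (y n)) (\<lambda>n. snd (y n)) t"
  define f where "f n x s = D.path_prob k x n * (\<Prod>m\<le>n. exp (- s m / \<gamma> k (x m)))" for n x s
  obtain J H where Q: "prob_space Q" and Z: "\<And>t. 0 \<le> t \<Longrightarrow> Z t \<in> Q \<rightarrow>\<^sub>M count_space UNIV"
    and J: "\<And>n. J n \<in> Q \<rightarrow>\<^sub>M count_space UNIV" and H: "\<And>n. H n \<in> borel_measurable Q"
    and law: "\<And>n x s. (\<forall>m\<le>n. x m \<in> tree M k \<and> 0 \<le> s m) \<Longrightarrow>
           measure Q {\<omega> \<in> space Q. \<forall>m\<le>n. J m \<omega> = x m \<and> s m < H m \<omega>} =
             pmf (pmf_of_set (tree M k)) (x 0) *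
             (\<Prod>m<n. pmf (jump_pmf M p k (x m)) (x (Suc m))) *
             (\<Prod>m\<le>n. exp (- s m / \<gamma> k (x m)))"
    and ZJH: "AE \<omega> in Q. \<forall>t\<ge>0. Z t \<omega> = jump_path (\<lambda>n. J n \<omega>) (\<lambda>n. H n \<omega>) t"
    using assms(6) unfolding trap_model_def by blast
  interpret Q: prob_space Q by (rule Q)
  have "0 < card (tree M k)" by (rule card_tree_pos[OF assms(2)])
  then obtain a where a: "a \<in> tree M k" by (metis card.empty ex_in_conv less_irrefl)
  interpret A: skeleton P "\<lambda>n \<omega>. D.states k \<omega> n" D.hold "tree M k" f
    using D.skeleton_states_hold[OF assms(1)] by (simp add: f_def[abs_def])
  interpret B: skeleton Q J H "tree M k" f
  proof unfold_locales
    fix n :: nat and x :: "nat \<Rightarrow> nat list" and s :: "nat \<Rightarrow> real"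
    assume x: "\<And>m. x m \<in> tree M k" and s: "\<And>m. 0 \<le> s m"
    then have "pmf (pmf_of_set (tree M k)) (x 0) = 1 / card (tree M k)"
      by (subst pmf_of_set) auto
    then show "Q.prob {\<omega> \<in> space Q. \<forall>m\<le>n. J m \<omega> = x m \<and> s m < H m \<omega>} = f n x s"
      using law[of n x s] x s by (simp add: f_def D.path_prob_def)
  qed (use J H in auto)
  have AE_regular: "AE \<omega> in P. regular_sample M \<gamma> k (\<lambda>r. driver_var \<sigma> T U r \<omega>)
      (\<lambda>l x i. \<sigma> l x i \<omega>) (\<lambda>l n. T l n \<omega>) (\<lambda>l n. U l n \<omega>)"
  proof (rule D.AE_regular_sample)
    fix l x i :: nat and \<omega> assume "\<omega> \<in> space P" "l \<in> {1..k}" "1 \<le> x"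
    then have "\<sigma> l x 0 \<omega> = 0" using assms(5) by (simp add: marks_environment_def)
    then show "\<sigma> l x i \<omega> = (\<Sum>m<i. driver_var \<sigma> T U (Gap l x m) \<omega>)"
      using sum_lessThan_telescope[of "\<lambda>m. \<sigma> l x m \<omega>" i] by simp
  qed auto
  have good: "AE \<omega> in P. D.states k \<omega> n \<in> tree M k \<and> 0 < D.hold n \<omega>" for n
    using AE_regular
  proof eventually_elim
    case (elim \<omega>)
    interpret R: regular_sample M \<gamma> k "\<lambda>r. driver_var \<sigma> T U r \<omega>"
      "\<lambda>l x i. \<sigma> l x i \<omega>" "\<lambda>l n. T l n \<omega>" "\<lambda>l n. U l n \<omega>" by (rule elim)
    have "D.states k \<omega> n \<in> tree M k" by (rule R.states_in_tree) simp
    moreover have "0 < T k n \<omega>" using R.clock_pos[of k n] assms(1) by simp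
    ultimately show ?case using assms(1,3) by (simp add: D.hold_def)
  qed
  have AE_X: "AE \<omega> in P. ?X \<omega> = ?F (A.skel \<omega>)"
    using AE_regular
  proof eventually_elim
    case (elim \<omega>)
    interpret R: regular_sample M \<gamma> k "\<lambda>r. driver_var \<sigma> T U r \<omega>"
      "\<lambda>l x i. \<sigma> l x i \<omega>" "\<lambda>l n. T l n \<omega>" "\<lambda>l n. U l n \<omega>" by (rule elim)
    show ?case
    proof (rule restrict_ext)
      fix t :: real assume "t \<in> {0..}"
      then have "0 \<le> t" by simp
      from R.marks_path_is_jump_path[OF assms(1) this]
      show "marks_process M \<gamma> \<sigma> T U k t \<omega> = jump_path (\<lambda>n. fst (A.skel \<omega> n)) (\<lambda>n. snd (A.skel \<omega> n)) t"
        by (simp only: marks_process_def A.skel_def D.hold_def fst_conv snd_conv)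
    qed
  qed
  have FA: "(\<lambda>\<omega>. ?F (A.skel \<omega>)) \<in> P \<rightarrow>\<^sub>M path_space"
    by (rule measurable_compose[OF A.skel_measurable path_functional_measurable])
  have FB: "(\<lambda>\<omega>. ?F (B.skel \<omega>)) \<in> Q \<rightarrow>\<^sub>M path_space"
    by (rule measurable_compose[OF B.skel_measurable path_functional_measurable])
  have X_meas: "?X \<in> completion P \<rightarrow>\<^sub>M path_space"
    using FA _ AE_X by (rule measurable_completion_cong_AE) (simp add: path_space_def space_PiM)
  have "distr (completion P) path_space ?X = distr (completion P) path_space (\<lambda>\<omega>. ?F (A.skel \<omega>))"
    using X_meas measurable_completion[OF FA] AE_completion[OF AE_X] by (rule distr_cong_AE)
  also have "\<dots> = distr P path_space (\<lambda>\<omega>. ?F (A.skel \<omega>))" by (rule distr_completion[OF FA])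
  also have "\<dots> = distr (distr P skeleton_space A.skel) path_space ?F"
    by (subst distr_distr[OF path_functional_measurable A.skel_measurable]) (simp add: comp_def)
  also have "distr P skeleton_space A.skel = distr Q skeleton_space B.skel"
    by (rule skeleton_distr_unique[OF A.skeleton_axioms B.skeleton_axioms good a])
  also have "distr (distr Q skeleton_space B.skel) path_space ?F = distr Q path_space (\<lambda>\<omega>. ?F (B.skel \<omega>))"
    by (subst distr_distr[OF path_functional_measurable B.skel_measurable]) (simp add: comp_def)
  also have "\<dots> = distr Q path_space ?Z"
  proof (rule distr_cong_AE[OF FB])
    show "?Z \<in> Q \<rightarrow>\<^sub>M path_space"
      unfolding path_space_def using Z by (intro measurable_restrict) auto
    show "AE \<omega> in Q. ?F (B.skel \<omega>) = ?Z \<omega>"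
      using ZJH
    proof eventually_elim
      case (elim \<omega>)
      show ?case
      proof (rule restrict_ext)
        fix t :: real assume "t \<in> {0..}"
        with elim show "jump_path (\<lambda>n. fst (B.skel \<omega> n)) (\<lambda>n. snd (B.skel \<omega> n)) t = Z t \<omega>"
          by (simp add: B.skel_def)
      qed
    qed
  qed
  finally show ?thesis using X_meas by blast
qed

end
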